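(* For every hyperbolic algebraic surface in $\mathbb{S}^n$ or $\mathbb{H}^n$, a charged standard layer creates a zero electrostatic field in its hyperbolicity domain.
   Context: $\mathbb{S}^n\subset\mathbb{R}^{n+1}$ is the unit sphere, $\mathbb{H}^n\subset\mathbb{R}^{n,1}$ is the upper sheet of $-x_0^2+x_1^2+\dots+x_n^2=-1$. A point charge creates at distance $r$ a field directed along the (shortest, in the spherical case) geodesic, with magnitude proportional to $1/\sin^{n-1}r$ in $\mathbb{S}^n$ and $1/\sinh^{n-1}r$ in $\mathbb{H}^n$; the field of a charge distribution is obtained by integration. An algebraic surface $M$ of degree $d$ ($d\ge 2$) in $\mathbb{S}^n$ or $\mathbb{H}^n$ is the zero set, in $\mathbb{S}^n$ or $\mathbb{H}^n$, of a real homogeneous polynomial $p$ of degree $d$ in $n+1$ variables. $M$ is hyperbolic with respect to a point $x$ if every great circle through $x$ intersects $M$ in $d$ distinct pairs of antipodal points (case $\mathbb{S}^n$), or if every geodesic through $x$ intersects $M$ in $d$ distinct points (case $\mathbb{H}^n$). The hyperbolicity domain of $M$ is the set of all such $x$, and $M$ is hyperbolic if this set is non-empty. The same notion is used for level sets $p^{-1}(\epsilon)$ with $|\epsilon|$ small: $p^{-1}(\epsilon)\cap\mathbb{S}^n$ (resp. $p^{-1}(\epsilon)\cap\mathbb{H}^n$) is hyperbolic with respect to $x$ if every great circle through $x$ meets it in $2d$ distinct points (resp. every geodesic through $x$ meets it in $d$ distinct points). A standard layer is the shell $\{\epsilon_1\le p(x)\le\epsilon_2\}$ intersected with $\mathbb{S}^n$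 or $\mathbb{H}^n$, with $\epsilon_1<\epsilon_2$ close enough to $0$ that the level sets are still hyperbolic and each component of the shell is a thin layer around one component of $M$. The hyperbolicity domain of the layer is the intersection of the hyperbolicity domains of $p^{-1}(\epsilon_1)$ and $p^{-1}(\epsilon_2)$. Charging rule: fix a point $x$ in the hyperbolicity domain; each component of the layer carries charge of constant density (the same absolute value for all components), positive if the corresponding component of $p^{-1}(\epsilon_1)$ lies closer to $x$ than the corresponding component of $p^{-1}(\epsilon_2)$ (along shortest geodesics from $x$), and negative otherwise.
   Formalization: The dimension is assumed to be n ≥ 2; for n = 1 the claim fails, because the hyperbolicity domain is then the whole circle or line and contains the charged layer itself, inside which the field varies and is not identically zero. *)

theory Defs
  imports "HOL-Analysis.Analysis"
begin

text \<open>
  The ambient space of dimension \<open>n + 1\<close> is \<open>real \<times> (real^'n)\<close>, where \<open>n = CARD('n)\<close>; the first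
  component is the coordinate \<open>x\<^sub>0\<close>.
\<close>

datatype geometry = Spherical | Hyperbolic

fun ambient_form :: "geometry \<Rightarrow> real \<times> (real^'n) \<Rightarrow> real \<times> (real^'n) \<Rightarrow> real" where
  "ambient_form Spherical x y = fst x * fst y + snd x \<bullet> snd y"
| "ambient_form Hyperbolic x y = - (fst x * fst y) + snd x \<bullet> snd y"

fun model :: "geometry \<Rightarrow> (real \<times> (real^'n)) set" where
  "model Spherical = sphere 0 1"
| "model Hyperbolic = {x. ambient_form Hyperbolic x x = - 1 \<and> fst x > 0}"

fun gcos :: "geometry \<Rightarrow> real \<Rightarrow> real" where
  "gcos Spherical t = cos t"
| "gcos Hyperbolic t = cosh t"

fun gsin :: "geometry \<Rightarrow> real \<Rightarrow> real" where
  "gsin Spherical t = sin t"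
| "gsin Hyperbolic t = sinh t"

fun gdist :: "geometry \<Rightarrow> real \<times> (real^'n) \<Rightarrow> real \<times> (real^'n) \<Rightarrow> real" where
  "gdist Spherical x y = arccos (ambient_form Spherical x y)"
| "gdist Hyperbolic x y = arcosh (- ambient_form Hyperbolic x y)"

definition unit_tangents :: "geometry \<Rightarrow> real \<times> (real^'n) \<Rightarrow> (real \<times> (real^'n)) set" where
  "unit_tangents g x = {v. ambient_form g x v = 0 \<and> ambient_form g v v = 1}"

text \<open>The unit speed geodesic with initial point \<open>x\<close> and initial velocity \<open>v \<in> unit_tangents g x\<close>.\<close>

definition geodesic :: "geometry \<Rightarrow> real \<times> (real^'n) \<Rightarrow> real \<times> (real^'n) \<Rightarrow> real \<Rightarrow> real \<times> (real^'n)" where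
  "geodesic g x v t = gcos g t *\<^sub>R x + gsin g t *\<^sub>R v"

text \<open>The complete geodesics through \<open>x\<close>; the great circles through \<open>x\<close> in the spherical case.\<close>

definition geodesics_through :: "geometry \<Rightarrow> real \<times> (real^'n) \<Rightarrow> (real \<times> (real^'n)) set set" where
  "geodesics_through g x = (\<lambda>v. range (geodesic g x v)) ` unit_tangents g x"

text \<open>The parameters in which a geodesic starting at \<open>x\<close> is a unique shortest path from \<open>x\<close>.\<close>

fun shortest_range :: "geometry \<Rightarrow> real set" where
  "shortest_range Spherical = {0<..<pi}"
| "shortest_range Hyperbolic = {0<..}"

definition homogeneous_polynomial :: "nat \<Rightarrow> ('a::euclidean_space \<Rightarrow> real) \<Rightarrow> bool" where
  "homogeneous_polynomial d p \<longleftrightarrow>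
     (\<exists>c :: ('a \<Rightarrow> nat) \<Rightarrow> real. \<forall>x.
        p x = (\<Sum>\<alpha> | \<alpha> \<in> Basis \<rightarrow>\<^sub>E {..d} \<and> (\<Sum>b\<in>Basis. \<alpha> b) = d.
                 c \<alpha> * (\<Prod>b\<in>Basis. (x \<bullet> b) ^ \<alpha> b)))"

definition level_set :: "geometry \<Rightarrow> (real \<times> (real^'n) \<Rightarrow> real) \<Rightarrow> real \<Rightarrow> (real \<times> (real^'n)) set" where
  "level_set g p e = {x \<in> model g. p x = e}"

abbreviation surface :: "geometry \<Rightarrow> (real \<times> (real^'n) \<Rightarrow> real) \<Rightarrow> (real \<times> (real^'n)) set" where
  "surface g p \<equiv> level_set g p 0"

definition shell ::
  "geometry \<Rightarrow> (real \<times> (real^'n) \<Rightarrow> real) \<Rightarrow> real \<Rightarrow> real \<Rightarrow> (real \<times> (real^'n)) set" where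
  "shell g p e1 e2 = {x \<in> model g. e1 \<le> p x \<and> p x \<le> e2}"

text \<open>
  In the definitions below \<open>card\<close> is compared with a positive number when \<open>d > 0\<close>, so the
  intersections are then finite.
\<close>

fun meets_surface_hyperbolically ::
  "geometry \<Rightarrow> nat \<Rightarrow> (real \<times> (real^'n)) set \<Rightarrow> (real \<times> (real^'n)) set \<Rightarrow> bool" where
  "meets_surface_hyperbolically Spherical d M C \<longleftrightarrow> card ((\<lambda>y. {y, - y}) ` (C \<inter> M)) = d"
| "meets_surface_hyperbolically Hyperbolic d M C \<longleftrightarrow> card (C \<inter> M) = d"

definition surface_hyperbolicity_domain ::
  "geometry \<Rightarrow> nat \<Rightarrow> (real \<times> (real^'n) \<Rightarrow> real) \<Rightarrow> (real \<times> (real^'n)) set" where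
  "surface_hyperbolicity_domain g d p =
     {x \<in> model g. \<forall>C \<in> geodesics_through g x. meets_surface_hyperbolically g d (surface g p) C}"

definition hyperbolic_surface :: "geometry \<Rightarrow> nat \<Rightarrow> (real \<times> (real^'n) \<Rightarrow> real) \<Rightarrow> bool" where
  "hyperbolic_surface g d p \<longleftrightarrow> surface_hyperbolicity_domain g d p \<noteq> {}"

text \<open>
  A level set \<open>p = e\<close> with \<open>e \<noteq> 0\<close> need not be antipodally symmetric, so in the spherical case points
  rather than antipodal pairs are counted.
\<close>

fun meets_level_hyperbolically ::
  "geometry \<Rightarrow> nat \<Rightarrow> (real \<times> (real^'n)) set \<Rightarrow> (real \<times> (real^'n)) set \<Rightarrow> bool" where
  "meets_level_hyperbolically Spherical d L C \<longleftrightarrow> card (C \<inter> L) = 2 * d"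
| "meets_level_hyperbolically Hyperbolic d L C \<longleftrightarrow> card (C \<inter> L) = d"

definition level_hyperbolicity_domain ::
  "geometry \<Rightarrow> nat \<Rightarrow> (real \<times> (real^'n) \<Rightarrow> real) \<Rightarrow> real \<Rightarrow> (real \<times> (real^'n)) set" where
  "level_hyperbolicity_domain g d p e =
     {x \<in> model g. \<forall>C \<in> geodesics_through g x. meets_level_hyperbolically g d (level_set g p e) C}"

definition layer_hyperbolicity_domain ::
  "geometry \<Rightarrow> nat \<Rightarrow> (real \<times> (real^'n) \<Rightarrow> real) \<Rightarrow> real \<Rightarrow> real \<Rightarrow> (real \<times> (real^'n)) set" where
  "layer_hyperbolicity_domain g d p e1 e2 =
     level_hyperbolicity_domain g d p e1 \<inter> level_hyperbolicity_domain g d p e2"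

definition contains_one_component_of :: "'a::topological_space set \<Rightarrow> 'a set \<Rightarrow> bool" where
  "contains_one_component_of K A \<longleftrightarrow> (\<exists>!C. C \<in> components A \<and> C \<subseteq> K)"

text \<open>
  Each component of the shell is a layer around (or, if \<open>0 \<notin> {e1..e2}\<close>, next to) one component of the
  surface. Adjoining the value \<open>0\<close> to the interval covers both situations: for
  \<open>e1 \<le> 0 \<le> e2\<close> the set \<open>K\<close> below ranges over the components of the shell itself. In all cases
  every component of the shell contains exactly one component of either bounding level set.
\<close>

definition standard_layer ::
  "geometry \<Rightarrow> nat \<Rightarrow> (real \<times> (real^'n) \<Rightarrow> real) \<Rightarrow> real \<Rightarrow> real \<Rightarrow> bool" where
  "standard_layer g d p e1 e2 \<longleftrightarrow>
     e1 < e2 \<and>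
     level_hyperbolicity_domain g d p e1 \<noteq> {} \<and>
     level_hyperbolicity_domain g d p e2 \<noteq> {} \<and>
     (\<forall>K \<in> components (shell g p (min e1 0) (max e2 0)).
        contains_one_component_of K (surface g p) \<and>
        contains_one_component_of K (shell g p e1 e2) \<and>
        contains_one_component_of K (level_set g p e1) \<and>
        contains_one_component_of K (level_set g p e2))"

text \<open>
  For a component \<open>K\<close> of a standard layer, \<open>K \<inter> level_set g p e1\<close> and \<open>K \<inter> level_set g p e2\<close> are the
  corresponding components of the two level sets.
\<close>

definition positively_charged ::
  "geometry \<Rightarrow> (real \<times> (real^'n) \<Rightarrow> real) \<Rightarrow> real \<Rightarrow> real \<Rightarrow> real \<times> (real^'n) \<Rightarrow> (real \<times> (real^'n)) set \<Rightarrow> bool"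
  where
  "positively_charged g p e1 e2 x K \<longleftrightarrow>
     (\<forall>v \<in> unit_tangents g x. \<forall>s \<in> shortest_range g. \<forall>t \<in> shortest_range g.
        geodesic g x v s \<in> K \<inter> level_set g p e1 \<and> geodesic g x v t \<in> K \<inter> level_set g p e2
        \<longrightarrow> s < t)"

definition charge_density ::
  "geometry \<Rightarrow> (real \<times> (real^'n) \<Rightarrow> real) \<Rightarrow> real \<Rightarrow> real \<Rightarrow> real \<Rightarrow> real \<times> (real^'n) \<Rightarrow> real \<times> (real^'n) \<Rightarrow> real"
  where
  "charge_density g p e1 e2 \<rho> x y =
     (if y \<in> shell g p e1 e2
      then if positively_charged g p e1 e2 x (connected_component_set (shell g p e1 e2) y)
           then \<rho> else - \<rho>
      else 0)"

text \<open>
  The Riemannian volume as the cone measure: the volume of \<open>A\<close> is \<open>n + 1\<close> times the Lebesgue measure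
  of \<open>{c *\<^sub>R y | c y. 0 < c \<and> c \<le> 1 \<and> y \<in> A}\<close>. The model is orthogonal to the radial direction
  with respect to the ambient form, which has determinant of absolute value 1, so that
  \<open>dz = c\<^sup>n dc dvol(y)\<close> for \<open>z = c *\<^sub>R y\<close>.
\<close>

definition volume :: "geometry \<Rightarrow> (real \<times> (real^'n)) measure" where
  "volume g = scale_measure (of_nat (CARD('n) + 1))
     (distr (restrict_space lborel {c *\<^sub>R y | c y. 0 < c \<and> c \<le> 1 \<and> y \<in> model g}) borel
        (\<lambda>z. z /\<^sub>R sqrt \<bar>ambient_form g z z\<bar>))"

text \<open>The initial velocity at \<open>x\<close> of the shortest geodesic from \<open>x\<close> to \<open>y\<close>.\<close>

definition direction_to ::
  "geometry \<Rightarrow> real \<times> (real^'n) \<Rightarrow> real \<times> (real^'n) \<Rightarrow> real \<times> (real^'n)" where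
  "direction_to g x y = (y - gcos g (gdist g x y) *\<^sub>R x) /\<^sub>R gsin g (gdist g x y)"

text \<open>
  The field at \<open>x\<close> of a unit positive charge at \<open>y\<close> points away from \<open>y\<close>; \<open>\<kappa>\<close> is the constant of
  proportionality. The degenerate positions \<open>y = x\<close> and \<open>y = - x\<close> get the value 0.
\<close>

definition point_charge_field ::
  "geometry \<Rightarrow> real \<Rightarrow> real \<times> (real^'n) \<Rightarrow> real \<times> (real^'n) \<Rightarrow> real \<times> (real^'n)" where
  "point_charge_field g \<kappa> y x = - (\<kappa> / gsin g (gdist g x y) ^ (CARD('n) - 1)) *\<^sub>R direction_to g x y"

text \<open>
  The field at \<open>x\<close> of the charge density \<open>\<sigma>\<close> exists and equals \<open>E\<close>. Existence is part of the notion
  because the Bochner integral of a non-integrable function is 0 by convention.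
\<close>

definition has_electrostatic_field ::
  "geometry \<Rightarrow> real \<Rightarrow> (real \<times> (real^'n) \<Rightarrow> real) \<Rightarrow> real \<times> (real^'n) \<Rightarrow> real \<times> (real^'n) \<Rightarrow> bool" where
  "has_electrostatic_field g \<kappa> \<sigma> x E \<longleftrightarrow>
     has_bochner_integral (volume g) (\<lambda>y. \<sigma> y *\<^sub>R point_charge_field g \<kappa> y x) E"

end

theory Submission
  imports Defs "HOL-Computational_Algebra.Fundamental_Theorem_Algebra"
begin

text \<open>
  In polar coordinates at \<open>x\<close> the volume is \<open>gsin t ^ (n - 1) dt dv\<close>, so the kernel cancels the Jacobian
  and the field at \<open>x\<close> is, up to a constant, the integral of \<open>v L(v)\<close> over the unit tangent vectors, where
  \<open>L(v)\<close> is the total charge on the ray in direction \<open>v\<close>. It vanishes as soon as \<open>L(v) = L(- v)\<close>.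

  With \<open>w = exp (i t)\<close>, respectively \<open>w = exp t\<close>, the equation \<open>p = e\<close> along a geodesic through \<open>x\<close> becomes
  \<open>Q(w) - e w ^ d = 0\<close> with \<open>degree Q = 2 * d\<close>. By hyperbolicity all its roots are simple and correspond to
  crossings of the geodesic with the level set, and their product does not depend on \<open>e\<close>. (In the
  hyperbolic case \<open>d\<close> must be even, and the roots are \<open>\<plusminus> exp t\<close>.) Hence the sum of the crossing
  parameters along the whole geodesic, those in direction \<open>- v\<close> counted negatively, does not depend on the
  level \<open>e\<close>.

  As the crossings are simple and their number is fixed, they depend continuously on \<open>v\<close>, so the components of
  a level set are nested spheres, each met once by every ray from \<open>x\<close>. A component of the layer meets every
  ray in the interval between its two crossings, whose order does not depend on \<open>v\<close>. Comparing the orders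
  along the geodesic through two points of the domain shows that the charges, as seen from \<open>x\<close>, have the signs
  prescribed at \<open>x\<^sub>0\<close> or all the opposite ones. So \<open>L(v)\<close> is, up to a constant, the difference of the sums of
  the crossing parameters for the two levels in direction \<open>v\<close>, and \<open>L(v) = L(- v)\<close>.
\<close>

section \<open>Geodesics in the two models\<close>

text \<open>The hypotheses supply only counts of points, so all regularity is extracted from counts
  that reach their maximum. One argument recurs: an odd continuous function on the unit tangent
  vectors at a point, which form a connected sphere since the dimension is at least 2, has a zero.
  It forces \<open>d\<close> to be even in the hyperbolic case, keeps the base point and its
  antipode off the bounding levels, and removes an ambiguity of \<open>2 * pi\<close> in the
  spherical sum of crossings. That a layer component fills the interval between its two crossings,
  rather than the complement, is not a local fact: local analysis along a ray allows both. In the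
  hyperbolic case \<open>p\<close> is unbounded along every ray; in the spherical case the
  complement would split the component into two caps around \<open>x\<close> and \<open>- x\<close>.
  The volume is a cone measure, so polar coordinates are introduced in the ambient vector space.
  There the cotangent (or hyperbolic cotangent) of the distance enters linearly, and the change of
  variables reduces to affine substitutions in iterated integrals.\<close>

lemma ambient_form_commute: "ambient_form g x y = ambient_form g y x"
  by (cases g) (auto simp: inner_commute mult.commute)

lemma bilinear_ambient_form: "bilinear (ambient_form g)"
  by (cases g) (auto simp: bilinear_def linear_iff algebra_simps inner_add_left inner_add_right)

lemmas ambient_form_simps =
  bilinear_ladd[OF bilinear_ambient_form] bilinear_radd[OF bilinear_ambient_form]
  bilinear_lmul[OF bilinear_ambient_form] bilinear_rmul[OF bilinear_ambient_form]
  bilinear_lneg[OF bilinear_ambient_form] bilinear_rneg[OF bilinear_ambient_form]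
  bilinear_lsub[OF bilinear_ambient_form] bilinear_rsub[OF bilinear_ambient_form]
  bilinear_lzero[OF bilinear_ambient_form] bilinear_rzero[OF bilinear_ambient_form]

lemma continuous_on_ambient_form [continuous_intros]:
  "continuous_on S f \<Longrightarrow> continuous_on S h \<Longrightarrow> continuous_on S (\<lambda>z. ambient_form g (f z) (h z))"
  by (cases g) (auto intro!: continuous_intros)

lemma continuous_on_gcos [continuous_intros]:
  fixes f :: "'a::t2_space \<Rightarrow> real"
  shows "continuous_on S f \<Longrightarrow> continuous_on S (\<lambda>z. gcos g (f z))"
  by (cases g) (auto intro!: continuous_on_cos continuous_on_cosh)

lemma continuous_on_gsin [continuous_intros]:
  fixes f :: "'a::t2_space \<Rightarrow> real"
  shows "continuous_on S f \<Longrightarrow> continuous_on S (\<lambda>z. gsin g (f z))"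
  by (cases g) (auto intro!: continuous_on_sin continuous_on_sinh)

lemma continuous_on_geodesic [continuous_intros]:
  fixes t :: "'a::t2_space \<Rightarrow> real"
  shows "continuous_on S v \<Longrightarrow> continuous_on S t \<Longrightarrow> continuous_on S (\<lambda>z. geodesic g x (v z) (t z))"
  unfolding geodesic_def by (intro continuous_intros)

text \<open>The strict inequality on the upper sheet is turned into a closed one: the form is
  nonnegative where \<open>fst x = 0\<close>, so it cannot be \<open>- 1\<close> there.\<close>

lemma closed_model: "closed (model g :: (real \<times> (real^'n)) set)"
proof (cases g)
  case Hyperbolic
  have "x \<in> model Hyperbolic \<longleftrightarrow> ambient_form Hyperbolic x x = -1 \<and> fst x \<ge> 0" for x :: "real \<times> (real^'n)"
  proof -
    have False if "ambient_form Hyperbolic x x = -1" "fst x = 0"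
      using that inner_ge_zero[of "snd x"] by simp
    then show ?thesis by (auto simp: order_le_less simp del: ambient_form.simps)
  qed
  then have "model Hyperbolic = {x :: real \<times> (real^'n). ambient_form Hyperbolic x x = -1} \<inter> {x. fst x \<ge> 0}"
    by auto
  moreover have "closed \<dots>"
    by (intro closed_Int closed_Collect_eq closed_Collect_le continuous_intros)
  ultimately show ?thesis using Hyperbolic by simp
qed auto

text \<open>Cauchy-Schwarz applied to the equation of the tangent space, with
  \<open>norm (snd x)\<close> eliminated. It is the quantitative reason why tangent vectors are
  spacelike and why geodesics stay on the upper sheet.\<close>

lemma hyperboloid_tangent:
  fixes x v :: "real \<times> (real^'n)"
  assumes "x \<in> model Hyperbolic" and "ambient_form Hyperbolic x v = 0"
  shows "(fst v)\<^sup>2 * (fst x)\<^sup>2 \<le> ((fst x)\<^sup>2 - 1) * (norm (snd v))\<^sup>2"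
proof -
  have x: "(norm (snd x))\<^sup>2 = (fst x)\<^sup>2 - 1"
    using assms(1) by (auto simp: power2_norm_eq_inner power2_eq_square[of "fst x"])
  have "\<bar>snd x \<bullet> snd v\<bar> \<le> norm (snd x) * norm (snd v)" by (rule Cauchy_Schwarz_ineq2)
  then have "\<bar>fst x * fst v\<bar> \<le> norm (snd x) * norm (snd v)" using assms(2) by simp
  then have "\<bar>fst x * fst v\<bar>\<^sup>2 \<le> (norm (snd x) * norm (snd v))\<^sup>2" by (intro power_mono) auto
  then show ?thesis by (simp add: power_mult_distrib x mult.commute)
qed

lemma ambient_form_tangent_pos:
  fixes x v :: "real \<times> (real^'n)"
  assumes "x \<in> model g" and "ambient_form g x v = 0" and "v \<noteq> 0"
  shows "ambient_form g v v > 0"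
proof (cases g)
  case Spherical
  have "ambient_form g v v = v \<bullet> v" using Spherical by (simp add: inner_prod_def)
  then show ?thesis using assms(3) by simp
next
  case Hyperbolic
  have pos: "fst x > 0" using assms(1) Hyperbolic by simp
  have ineq: "(fst v)\<^sup>2 * (fst x)\<^sup>2 \<le> ((fst x)\<^sup>2 - 1) * (norm (snd v))\<^sup>2"
    using hyperboloid_tangent assms Hyperbolic by blast
  have "snd v \<noteq> 0"
  proof
    assume "snd v = 0"
    then have "fst v = 0" using assms(2) Hyperbolic pos by simp
    with \<open>snd v = 0\<close> assms(3) show False by (simp add: prod_eq_iff)
  qed
  then have "(norm (snd v))\<^sup>2 > 0" by simp
  then have "(fst v)\<^sup>2 * (fst x)\<^sup>2 < (norm (snd v))\<^sup>2 * (fst x)\<^sup>2"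
    using ineq unfolding left_diff_distrib mult.commute[of "(norm (snd v))\<^sup>2"] mult_1 by linarith
  then have "(fst v)\<^sup>2 < (norm (snd v))\<^sup>2"
    using pos by simp
  then show ?thesis using Hyperbolic by (simp add: power2_norm_eq_inner power2_eq_square[of "fst v"])
qed

text \<open>The curvature of the model, which is also the value of the ambient form on it; it lets
  both geometries share one set of trigonometric identities.\<close>

definition gsign :: "geometry \<Rightarrow> real" where
  "gsign g = (case g of Spherical \<Rightarrow> 1 | Hyperbolic \<Rightarrow> - 1)"

lemma gsign_square [simp]: "gsign g * gsign g = 1"
  by (cases g) (auto simp: gsign_def)

lemma gsign_mult_gsign_left [simp]: "gsign g * (gsign g * a) = a"
  by (simp flip: mult.assoc)

lemma gsign_nonzero [simp]: "gsign g \<noteq> 0"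
  by (cases g) (auto simp: gsign_def)

lemma ambient_form_model: "x \<in> model g \<Longrightarrow> ambient_form g x x = gsign g"
  by (cases g) (auto simp: gsign_def inner_prod_def[symmetric] norm_eq_1[symmetric] simp flip: power2_norm_eq_inner simp: dist_norm norm_prod_def power2_eq_square[of "fst x"])

lemma gcos_gsin: "(gcos g t)\<^sup>2 + gsign g * (gsin g t)\<^sup>2 = 1"
  by (cases g) (auto simp: gsign_def hyperbolic_pythagoras)

lemma gcos_add: "gcos g (s + t) = gcos g s * gcos g t - gsign g * gsin g s * gsin g t"
  by (cases g) (auto simp: gsign_def cos_add cosh_add)

lemma gsin_add: "gsin g (s + t) = gsin g s * gcos g t + gcos g s * gsin g t"
  by (cases g) (auto simp: sin_add sinh_add)

lemma gcos_minus [simp]: "gcos g (- t) = gcos g t"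
  by (cases g) auto

lemma gsin_minus [simp]: "gsin g (- t) = - gsin g t"
  by (cases g) auto

lemma gcos_0 [simp]: "gcos g 0 = 1" and gsin_0 [simp]: "gsin g 0 = 0"
  by (cases g; simp)+

lemma gsin_pos: "t \<in> shortest_range g \<Longrightarrow> gsin g t > 0"
  by (cases g) (auto intro: sin_gt_zero)

lemma gcos_inj_on: "inj_on (gcos g) (shortest_range g)"
proof (rule inj_onI)
  fix s t assume "s \<in> shortest_range g" "t \<in> shortest_range g" "gcos g s = gcos g t"
  then show "s = t"
    by (cases g) (auto dest: cos_inj_pi[rotated 4] arg_cong[of _ _ arcosh] simp: arcosh_cosh_real)
qed

section \<open>Geodesics issuing from a fixed base point\<close>

context
  fixes g :: geometry and x :: "real \<times> (real^'n)"
  assumes x: "x \<in> model g"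
begin

lemma unit_tangents_nonzero: "v \<in> unit_tangents g x \<Longrightarrow> v \<noteq> 0"
  by (auto simp: unit_tangents_def ambient_form_simps)

lemma uminus_unit_tangents: "v \<in> unit_tangents g x \<Longrightarrow> - v \<in> unit_tangents g x"
  by (auto simp: unit_tangents_def ambient_form_simps)

lemma ambient_form_geodesic:
  assumes "v \<in> unit_tangents g x"
  shows "ambient_form g x (geodesic g x v t) = gsign g * gcos g t"
    and "ambient_form g v (geodesic g x v t) = gsin g t"
  using assms x
  by (auto simp: geodesic_def unit_tangents_def ambient_form_simps ambient_form_model ambient_form_commute[of g v x])

lemma geodesic_in_model:
  assumes v: "v \<in> unit_tangents g x"
  shows "geodesic g x v t \<in> model g"
proof -
  have "ambient_form g (geodesic g x v t) (geodesic g x v t) =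
        gcos g t * gcos g t * gsign g + gsin g t * gsin g t"
    using v x by (simp add: geodesic_def unit_tangents_def ambient_form_simps ambient_form_model
        ambient_form_commute[of g v x] algebra_simps)
  also have "\<dots> = gsign g * ((gcos g t)\<^sup>2 + gsign g * (gsin g t)\<^sup>2)"
    by (simp add: algebra_simps power2_eq_square)
  finally have form: "ambient_form g (geodesic g x v t) (geodesic g x v t) = gsign g"
    by (simp add: gcos_gsin)
  show ?thesis
  proof (cases g)
    case Spherical
    then show ?thesis using form
      by (simp add: gsign_def norm_eq_1 inner_prod_def)
  next
    case Hyperbolic
    \<comment> \<open>For a unit tangent vector the inequality gives
      \<open>\<bar>fst v\<bar> < fst x\<close>; with \<open>\<bar>sinh t\<bar> < cosh t\<close>, the
      time component of the geodesic cannot change sign.\<close>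
    have pos: "fst x > 0" using x Hyperbolic by simp
    have ineq: "(fst v)\<^sup>2 * (fst x)\<^sup>2 \<le> ((fst x)\<^sup>2 - 1) * (norm (snd v))\<^sup>2"
      using hyperboloid_tangent x v Hyperbolic unfolding unit_tangents_def by blast
    have "(norm (snd v))\<^sup>2 = 1 + (fst v)\<^sup>2"
      using v Hyperbolic by (auto simp: unit_tangents_def power2_norm_eq_inner power2_eq_square[of "fst v"])
    with ineq have "(fst v)\<^sup>2 < (fst x)\<^sup>2" by (simp add: algebra_simps)
    then have "\<bar>fst v\<bar> < fst x" using pos by (metis abs_le_square_iff abs_of_pos not_le)
    moreover have "\<bar>sinh t\<bar> < cosh t"
      using sinh_less_cosh_real[of "\<bar>t\<bar>"] by (cases "t \<ge> 0") auto
    ultimately have "\<bar>sinh t\<bar> * \<bar>fst v\<bar> < cosh t * fst x"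
      by (intro mult_strict_mono') auto
    then have "fst (geodesic g x v t) > 0"
      using Hyperbolic by (auto simp: geodesic_def abs_mult[symmetric])
    then show ?thesis using Hyperbolic form by (simp add: gsign_def)
  qed
qed

lemma geodesic_inj:
  assumes "v \<in> unit_tangents g x" "w \<in> unit_tangents g x"
    and "s \<in> shortest_range g" "t \<in> shortest_range g"
    and eq: "geodesic g x v s = geodesic g x w t"
  shows "v = w \<and> s = t"
proof -
  have "gcos g s = gcos g t"
    using eq ambient_form_geodesic(1) assms(1,2) by (metis gsign_mult_gsign_left)
  then have st: "s = t" using gcos_inj_on assms(3,4) by (auto dest: inj_onD)
  moreover have "gsin g t *\<^sub>R v = gsin g t *\<^sub>R w"
    using eq st by (simp add: geodesic_def)
  then have "v = w" using gsin_pos[OF assms(4)] by simp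
  ultimately show ?thesis by simp
qed

lemma geodesic_minus: "geodesic g x (- v) t = geodesic g x v (- t)"
  by (simp add: geodesic_def)

text \<open>Split \<open>y\<close> into a multiple \<open>a\<close> of \<open>x\<close> and a
  tangent part \<open>w\<close>. The form makes \<open>a\<close> and the length of \<open>w\<close>
  satisfy the Pythagorean identity, so they are \<open>gcos t\<close> and \<open>gsin t\<close>;
  \<open>w = 0\<close> only at the excluded points.\<close>

lemma ex_geodesic:
  assumes y: "y \<in> model g" and ne: "y \<noteq> x" "y \<noteq> - x"
  shows "\<exists>t \<in> shortest_range g. \<exists>v \<in> unit_tangents g x. y = geodesic g x v t"
proof -
  define a where "a = gsign g * ambient_form g x y"
  define w where "w = y - a *\<^sub>R x"
  have tw: "ambient_form g x w = 0"
    using x by (simp add: w_def a_def ambient_form_simps ambient_form_model mult.commute)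
  have "ambient_form g y y = a\<^sup>2 * gsign g + ambient_form g w w"
  proof -
    have "y = a *\<^sub>R x + w" by (simp add: w_def)
    then have "ambient_form g y y = ambient_form g (a *\<^sub>R x + w) (a *\<^sub>R x + w)" by simp
    also have "\<dots> = a\<^sup>2 * gsign g + ambient_form g w w"
      using x tw by (simp add: ambient_form_simps ambient_form_model ambient_form_commute[of g w x] power2_eq_square)
    finally show ?thesis .
  qed
  then have nw: "ambient_form g w w = gsign g * (1 - a\<^sup>2)"
    using ambient_form_model[OF y] by (simp add: algebra_simps)
  have w0: "w \<noteq> 0"
  proof
    assume "w = 0"
    then have ya: "y = a *\<^sub>R x" by (simp add: w_def)
    moreover have "a\<^sup>2 = 1" using nw \<open>w = 0\<close> by (simp add: ambient_form_simps)
    ultimately show False using ne by (auto simp: power2_eq_1_iff)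
  qed
  then have pos: "ambient_form g w w > 0" using ambient_form_tangent_pos[OF x tw] by simp
  have "\<exists>t\<in>shortest_range g. gcos g t = a"
  proof (cases g)
    case Spherical
    then have "a\<^sup>2 < 1" using pos nw by (simp add: gsign_def)
    then have "\<bar>a\<bar> < 1" by (simp add: abs_square_less_1)
    then have "arccos a \<in> {0<..<pi}" "cos (arccos a) = a"
      using arccos_lt_bounded[of a] by auto
    then show ?thesis using Spherical by (metis gcos.simps(1) shortest_range.simps(1))
  next
    case Hyperbolic
    then have "a\<^sup>2 > 1" using pos nw by (simp add: gsign_def)
    \<comment> \<open>Two points of the upper sheet have negative ambient product: by Cauchy-Schwarz
      the product of the time components dominates. This rules out \<open>a < - 1\<close>.\<close>
    moreover have "a > 0"
    proof -
      have "norm (snd z) < fst z" if "z \<in> model Hyperbolic" for z :: "real \<times> (real^'n)"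
      proof -
        have "(norm (snd z))\<^sup>2 < (fst z)\<^sup>2"
          using that by (auto simp: power2_norm_eq_inner power2_eq_square[of "fst z"])
        then show ?thesis using that by (simp add: power2_less_imp_less)
      qed
      then have "norm (snd x) * norm (snd y) < fst x * fst y"
        using x y Hyperbolic by (intro mult_strict_mono') auto
      moreover have "snd x \<bullet> snd y \<le> norm (snd x) * norm (snd y)"
        by (rule norm_cauchy_schwarz)
      ultimately show ?thesis using Hyperbolic by (simp add: a_def gsign_def)
    qed
    ultimately have "a > 1" by (metis abs_of_pos abs_square_le_1 not_le)
    then have "arcosh a > 0" "cosh (arcosh a) = a" by (auto simp: cosh_arcosh_real)
    then show ?thesis using Hyperbolic by (metis gcos.simps(2) greaterThan_iff shortest_range.simps(2))
  qed
  then obtain t where t: "t \<in> shortest_range g" "gcos g t = a" by blast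
  define v where "v = w /\<^sub>R gsin g t"
  have "(gsin g t)\<^sup>2 = ambient_form g w w"
    using gcos_gsin[of g t] nw t(2)
    by (metis add_diff_cancel_left' gsign_mult_gsign_left)
  then have "v \<in> unit_tangents g x"
    using tw gsin_pos[OF t(1)]
    by (auto simp: unit_tangents_def v_def ambient_form_simps power2_eq_square field_simps)
  moreover have "y = geodesic g x v t"
    using gsin_pos[OF t(1)] t(2) by (simp add: geodesic_def v_def w_def)
  ultimately show ?thesis using t(1) by blast
qed

lemma gdist_geodesic:
  assumes "v \<in> unit_tangents g x" "t \<in> shortest_range g"
  shows "gdist g x (geodesic g x v t) = t"
  using ambient_form_geodesic(1)[OF assms(1), of t] assms(2)
  by (cases g) (auto simp: gsign_def arccos_cos arcosh_cosh_real simp del: ambient_form.simps)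

lemma direction_to_geodesic:
  assumes "v \<in> unit_tangents g x" "t \<in> shortest_range g"
  shows "direction_to g x (geodesic g x v t) = v"
  using gsin_pos[OF assms(2)] unfolding direction_to_def gdist_geodesic[OF assms]
  by (simp add: geodesic_def)

text \<open>The vector \<open>v'\<close> is the velocity at parameter \<open>s\<close>, so the
  addition formulas give a shift of the parameter. This lets one geodesic be read from two of its
  points.\<close>

lemma geodesic_rebase:
  assumes v: "v \<in> unit_tangents g x"
  obtains v' where "v' \<in> unit_tangents g (geodesic g x v s)"
    "\<And>t. geodesic g (geodesic g x v s) v' t = geodesic g x v (s + t)"
    "\<And>t. geodesic g (geodesic g x v s) (- v') t = geodesic g x v (s - t)"
proof -
  define v' where "v' = gcos g s *\<^sub>R v - (gsign g * gsin g s) *\<^sub>R x"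
  have "v' \<in> unit_tangents g (geodesic g x v s)"
  proof -
    have "ambient_form g v' v' = (gcos g s)\<^sup>2 + gsign g * (gsin g s)\<^sup>2"
      using v x
      by (simp add: v'_def unit_tangents_def ambient_form_simps ambient_form_model
          ambient_form_commute[of g v x] algebra_simps power2_eq_square)
    moreover have "ambient_form g (geodesic g x v s) v' = 0"
      using v x
      by (simp add: v'_def geodesic_def unit_tangents_def ambient_form_simps ambient_form_model
          ambient_form_commute[of g v x] algebra_simps)
    ultimately show ?thesis by (simp add: unit_tangents_def gcos_gsin)
  qed
  moreover have 1: "geodesic g (geodesic g x v s) v' t = geodesic g x v (s + t)" for t
    by (simp add: geodesic_def v'_def gcos_add gsin_add algebra_simps scaleR_add_right)
  moreover have "geodesic g (geodesic g x v s) (- v') t = geodesic g x v (s - t)" for t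
    using 1[of "- t"] by (simp add: geodesic_def)
  ultimately show ?thesis using that by blast
qed

text \<open>Models the tangent space on \<open>real^'n\<close>, whose sphere is connected and which
  carries Lebesgue measure. The vector \<open>x'\<close> in the proof absorbs the signature, so that
  the tangent space becomes a Euclidean hyperplane.\<close>

lemma tangent_parametrization:
  obtains T :: "real^'n \<Rightarrow> real \<times> (real^'n)" where
    "linear T" "inj T" "range T = {v. ambient_form g x v = 0}"
proof -
  define x' where "x' = (gsign g * fst x, snd x)"
  have form: "ambient_form g x v = x' \<bullet> v" for v
    by (cases g) (auto simp: x'_def inner_prod_def gsign_def)
  have "x \<noteq> 0" using ambient_form_model[OF x] by (auto simp: ambient_form_simps)
  then have "x' \<noteq> 0" by (auto simp: x'_def prod_eq_iff)
  then have "dim {v. x' \<bullet> v = 0} = DIM(real \<times> (real^'n)) - 1" by (rule dim_hyperplane)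
  then have "dim (UNIV :: (real^'n) set) = dim {v. x' \<bullet> v = 0}" by simp
  then obtain T :: "real^'n \<Rightarrow> real \<times> (real^'n)" where
    "linear T" "T ` UNIV = {v. x' \<bullet> v = 0}" "inj_on T UNIV"
    using subspace_isomorphism[OF subspace_UNIV subspace_hyperplane] by metis
  then show ?thesis using that by (simp add: form)
qed

lemma unit_tangents_parametrization:
  fixes T :: "real^'n \<Rightarrow> real \<times> (real^'n)"
  assumes T: "linear T" "inj T" "range T = {v. ambient_form g x v = 0}"
  shows "w \<noteq> 0 \<Longrightarrow> sqrt (ambient_form g (T w) (T w)) > 0"
    and "w \<noteq> 0 \<Longrightarrow> T w /\<^sub>R sqrt (ambient_form g (T w) (T w)) \<in> unit_tangents g x"
    and "unit_tangents g x = (\<lambda>w. T w /\<^sub>R sqrt (ambient_form g (T w) (T w))) ` sphere 0 1"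
proof -
  have pos: "ambient_form g (T w) (T w) > 0" if "w \<noteq> 0" for w
  proof -
    have "T w \<noteq> 0" using T that by (metis injD linear_0)
    moreover have "ambient_form g x (T w) = 0" using T(3) by blast
    ultimately show ?thesis using ambient_form_tangent_pos[OF x] by simp
  qed
  then show "w \<noteq> 0 \<Longrightarrow> sqrt (ambient_form g (T w) (T w)) > 0" by simp
  show in_U: "T w /\<^sub>R sqrt (ambient_form g (T w) (T w)) \<in> unit_tangents g x" if "w \<noteq> 0" for w
  proof -
    have "ambient_form g x (T w) = 0" using T(3) by blast
    moreover have "inverse (sqrt r) * (inverse (sqrt r) * r) = 1" if "r > 0" for r
      using that by (simp add: field_simps)
    ultimately show ?thesis using pos[OF that]
      by (simp add: unit_tangents_def ambient_form_simps)
  qed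
  show "unit_tangents g x = (\<lambda>w. T w /\<^sub>R sqrt (ambient_form g (T w) (T w))) ` sphere 0 1" (is "_ = ?v ` _")
  proof
    show "?v ` sphere 0 1 \<subseteq> unit_tangents g x" by (intro image_subsetI in_U) auto
  next
    show "unit_tangents g x \<subseteq> ?v ` sphere 0 1"
    proof
      fix v assume v: "v \<in> unit_tangents g x"
      then obtain u where u: "v = T u" using T(3) by (auto simp: unit_tangents_def)
      then have "u \<noteq> 0" using unit_tangents_nonzero[OF v] linear_0[OF T(1)] by auto
      have "?v (u /\<^sub>R norm u) = v"
        using v \<open>u \<noteq> 0\<close> unfolding u
        by (simp add: unit_tangents_def linear_scale[OF T(1)] ambient_form_simps real_sqrt_mult)
      then show "v \<in> ?v ` sphere 0 1" using \<open>u \<noteq> 0\<close> by (force intro!: image_eqI)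
    qed
  qed
qed

lemma compact_unit_tangents: "compact (unit_tangents g x)"
  and unit_tangents_nonempty: "unit_tangents g x \<noteq> {}"
  and connected_unit_tangents: "CARD('n) \<ge> 2 \<Longrightarrow> connected (unit_tangents g x)"
proof -
  obtain T :: "real^'n \<Rightarrow> real \<times> (real^'n)" where
    T: "linear T" "inj T" "range T = {v. ambient_form g x v = 0}"
    by (rule tangent_parametrization)
  have "continuous_on S T" for S using T(1) by (simp add: linear_continuous_on linear_linear)
  then have cont: "continuous_on (sphere 0 1) (\<lambda>w. T w /\<^sub>R sqrt (ambient_form g (T w) (T w)))"
    using unit_tangents_parametrization(1)[OF T] 
    by (intro continuous_intros \<open>\<And>S. continuous_on S T\<close>) (metis less_irrefl norm_zero mem_sphere_0 zero_neq_one)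
  note U = unit_tangents_parametrization(3)[OF T]
  show "compact (unit_tangents g x)"
    unfolding U by (intro compact_continuous_image cont) simp
  show "unit_tangents g x \<noteq> {}" unfolding U by simp
  show "connected (unit_tangents g x)" if "CARD('n) \<ge> 2"
    unfolding U using that by (intro connected_continuous_image cont connected_sphere) simp
qed

end

section \<open>Homogeneous polynomials along geodesics\<close>

definition binary_form :: "nat \<Rightarrow> (real \<Rightarrow> real \<Rightarrow> real) \<Rightarrow> bool" where
  "binary_form m f \<longleftrightarrow> (\<exists>c. \<forall>a b. f a b = (\<Sum>k\<le>m. c k * a ^ (m - k) * b ^ k))"

lemma binary_form_linear_mult:
  assumes "binary_form m f"
  shows "binary_form (Suc m) (\<lambda>a b. (a * r + b * s) * f a b)"
proof -
  obtain c where c: "f a b = (\<Sum>k\<le>m. c k * a ^ (m - k) * b ^ k)" for a b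
    using assms by (auto simp: binary_form_def)
  let ?c = "\<lambda>k. (if k \<le> m then r * c k else 0) + (if k = 0 then 0 else s * c (k - 1))"
  have "(a * r + b * s) * f a b = (\<Sum>k\<le>Suc m. ?c k * a ^ (Suc m - k) * b ^ k)" for a b
  proof -
    have "(\<Sum>k\<le>Suc m. (if k \<le> m then r * c k else 0) * a ^ (Suc m - k) * b ^ k) =
          (\<Sum>k\<le>m. (a * r) * (c k * a ^ (m - k) * b ^ k))"
      by (auto simp: Suc_diff_le intro!: sum.cong)
    moreover have "(\<Sum>k\<le>Suc m. (if k = 0 then 0 else s * c (k - 1)) * a ^ (Suc m - k) * b ^ k) =
          (\<Sum>k\<le>m. (b * s) * (c k * a ^ (m - k) * b ^ k))"
      by (subst sum.atMost_Suc_shift) (auto intro!: sum.cong)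
    ultimately show ?thesis
      by (simp add: c distrib_right sum.distrib sum_distrib_left del: sum.atMost_Suc)
  qed
  then show ?thesis unfolding binary_form_def by (intro exI[of _ ?c]) auto
qed

lemma binary_form_linear_power_mult:
  "binary_form m f \<Longrightarrow> binary_form (n + m) (\<lambda>a b. (a * r + b * s) ^ n * f a b)"
  by (induction n) (auto dest: binary_form_linear_mult simp: mult.assoc)

lemma binary_form_prod:
  "finite A \<Longrightarrow> binary_form (sum n A) (\<lambda>a b. \<Prod>i\<in>A. (a * r i + b * s i) ^ n i)"
proof (induction A rule: finite_induct)
  case empty
  show ?case by (auto simp: binary_form_def intro!: exI[of _ "\<lambda>_. 1"])
next
  case (insert i A)
  then show ?case using binary_form_linear_power_mult[OF insert.IH, of "n i" "r i" "s i"] by simp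
qed

lemma binary_form_sum:
  assumes "\<And>i. i \<in> A \<Longrightarrow> binary_form m (f i)"
  shows "binary_form m (\<lambda>a b. \<Sum>i\<in>A. w i * f i a b)"
proof -
  obtain c where c: "\<And>i a b. i \<in> A \<Longrightarrow> f i a b = (\<Sum>k\<le>m. c i k * a ^ (m - k) * b ^ k)"
    using assms unfolding binary_form_def by metis
  have "(\<Sum>i\<in>A. w i * f i a b) = (\<Sum>k\<le>m. (\<Sum>i\<in>A. w i * c i k) * a ^ (m - k) * b ^ k)" for a b
  proof -
    have "(\<Sum>i\<in>A. w i * f i a b) = (\<Sum>i\<in>A. \<Sum>k\<le>m. w i * c i k * a ^ (m - k) * b ^ k)"
      by (auto simp: c sum_distrib_left mult.assoc intro!: sum.cong)
    also have "\<dots> = (\<Sum>k\<le>m. \<Sum>i\<in>A. w i * c i k * a ^ (m - k) * b ^ k)"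
      by (rule sum.swap)
    finally show ?thesis by (simp add: sum_distrib_right)
  qed
  then show ?thesis unfolding binary_form_def by (intro exI) auto
qed

text \<open>A geodesic lies in the plane spanned by \<open>x\<close> and \<open>v\<close>, so this
  is how \<open>p\<close> looks along it, with \<open>a = gcos g t\<close> and
  \<open>b = gsin g t\<close>.\<close>

lemma homogeneous_polynomial_on_plane:
  assumes "homogeneous_polynomial d p"
  shows "binary_form d (\<lambda>a b. p (a *\<^sub>R x + b *\<^sub>R y))"
proof -
  obtain c where c: "\<And>x. p x = (\<Sum>\<alpha> | \<alpha> \<in> Basis \<rightarrow>\<^sub>E {..d} \<and> (\<Sum>b\<in>Basis. \<alpha> b) = d.
                 c \<alpha> * (\<Prod>b\<in>Basis. (x \<bullet> b) ^ \<alpha> b))"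
    using assms unfolding homogeneous_polynomial_def by blast
  have "binary_form d (\<lambda>a b. \<Prod>i\<in>Basis. (a * (x \<bullet> i) + b * (y \<bullet> i)) ^ \<alpha> i)"
    if "(\<Sum>b\<in>Basis. \<alpha> b) = d" for \<alpha>
    using binary_form_prod[of Basis \<alpha> "\<lambda>i. x \<bullet> i" "\<lambda>i. y \<bullet> i"] that by simp
  then show ?thesis
    unfolding c inner_add_left inner_scaleR_left by (intro binary_form_sum) auto
qed

lemma homogeneous_polynomial_continuous:
  assumes "homogeneous_polynomial d p" and "continuous_on S f"
  shows "continuous_on S (\<lambda>z. p (f z))"
proof -
  obtain c where c: "\<And>x. p x = (\<Sum>\<alpha> | \<alpha> \<in> Basis \<rightarrow>\<^sub>E {..d} \<and> (\<Sum>b\<in>Basis. \<alpha> b) = d.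
                 c \<alpha> * (\<Prod>b\<in>Basis. (x \<bullet> b) ^ \<alpha> b))"
    using assms(1) unfolding homogeneous_polynomial_def by blast
  show ?thesis unfolding c by (intro continuous_intros assms(2))
qed

lemma homogeneous_polynomial_differentiable:
  assumes "homogeneous_polynomial d p"
  shows "\<exists>p'. (p has_derivative p') (at x)"
proof -
  obtain c where "\<And>x. p x = (\<Sum>\<alpha> | \<alpha> \<in> Basis \<rightarrow>\<^sub>E {..d} \<and> (\<Sum>b\<in>Basis. \<alpha> b) = d.
                 c \<alpha> * (\<Prod>b\<in>Basis. (x \<bullet> b) ^ \<alpha> b))"
    using assms unfolding homogeneous_polynomial_def by blast
  then have c: "p = (\<lambda>x. \<Sum>\<alpha> | \<alpha> \<in> Basis \<rightarrow>\<^sub>E {..d} \<and> (\<Sum>b\<in>Basis. \<alpha> b) = d.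
                 c \<alpha> * (\<Prod>b\<in>Basis. (x \<bullet> b) ^ \<alpha> b))"
    by auto
  show ?thesis unfolding c by (rule exI, (rule derivative_intros refl)+)
qed

lemma homogeneous_polynomial_minus:
  assumes "homogeneous_polynomial d p"
  shows "p (- x) = (- 1) ^ d * p x"
proof -
  obtain c where c: "\<And>a b. p (a *\<^sub>R x + b *\<^sub>R 0) = (\<Sum>k\<le>d. c k * a ^ (d - k) * b ^ k)"
    using homogeneous_polynomial_on_plane[OF assms, of x 0] unfolding binary_form_def by auto
  have "p (a *\<^sub>R x) = c 0 * a ^ d" for a
    using c[of a 0] by (simp add: power_0_left if_distrib if_distribR cong: if_cong)
  from this[of 1] this[of "-1"] show ?thesis by simp
qed

text \<open>Setting \<open>a = 1\<close> gives a polynomial in \<open>b\<close> whose degree drops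
  below \<open>d\<close> because the top coefficient vanishes; \<open>d\<close> roots are then too
  many.\<close>

lemma binary_form_roots:
  fixes f :: "real \<Rightarrow> real \<Rightarrow> real"
  assumes f: "\<And>a b. f a b = (\<Sum>k\<le>d. c k * a ^ (d - k) * b ^ k)"
    and c: "c d = 0" and d: "d > 0"
    and Z: "finite Z" "card Z = d" "\<And>u. u \<in> Z \<Longrightarrow> f 1 u = 0"
  shows "f a b = 0"
proof -
  define q where "q = (\<Sum>k\<le>d. monom (c k) k)"
  have q: "poly q u = f 1 u" for u
    by (simp add: q_def f poly_sum poly_monom)
  have coeff: "coeff q k = (if k \<le> d then c k else 0)" for k
    by (simp add: q_def coeff_sum)
  have "q = 0"
  proof (rule ccontr)
    assume "q \<noteq> 0"
    have "coeff q k = 0" if "k > d - 1" for k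
      using that c by (cases "k = d") (auto simp: coeff)
    then have "degree q \<le> d - 1" by (intro degree_le) auto
    moreover have "Z \<subseteq> {u. poly q u = 0}" using Z(3) q by auto
    then have "d \<le> card {u. poly q u = 0}"
      using Z(2) poly_roots_finite[OF \<open>q \<noteq> 0\<close>] card_mono by metis
    moreover have "card {u. poly q u = 0} \<le> degree q"
      using \<open>q \<noteq> 0\<close> by (rule card_poly_roots_bound)
    ultimately show False using d by simp
  qed
  then have "c k = 0" if "k \<le> d" for k using coeff[of k] that by simp
  then show ?thesis by (simp add: f)
qed

text \<open>Over the complex numbers the orders of the roots add up to the degree, so with that many
  distinct roots every order is 1. This is how maximal intersection counts yield
  transversality.\<close>

lemma rsquarefree_card_roots:
  fixes R :: "complex poly"
  assumes "R \<noteq> 0" and "card {w. poly R w = 0} \<ge> degree R"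
  shows "rsquarefree R"
proof -
  let ?Z = "{w. poly R w = 0}"
  have fin: "finite ?Z" using assms(1) by (rule poly_roots_finite)
  have "order w R \<ge> 1" if "w \<in> ?Z" for w
    using that assms(1) by (simp add: order_root Suc_le_eq)
  moreover have "(\<Sum>w\<in>?Z. order w R) = degree R"
    using size_proots_complex[of R] assms(1) by (simp add: size_multiset_overloaded_eq)
  ultimately have "order w R = 1" if "w \<in> ?Z" for w
  proof -
    have "(\<Sum>w\<in>?Z. order w R - 1) = 0"
      using \<open>(\<Sum>w\<in>?Z. order w R) = degree R\<close> assms(2)
        sum_subtractf_nat[of ?Z "\<lambda>_. 1" "\<lambda>w. order w R", OF \<open>\<And>w. w \<in> ?Z \<Longrightarrow> order w R \<ge> 1\<close>]
      by (metis card_eq_sum diff_is_0_eq)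
    then show ?thesis
      using fin that \<open>\<And>w. w \<in> ?Z \<Longrightarrow> order w R \<ge> 1\<close>[OF that] by auto
  qed
  then show ?thesis
    using assms(1) order_root[of R] unfolding rsquarefree_def by force
qed

text \<open>Vieta's formula for the product of the roots, from evaluating the factorization at
  0.\<close>

lemma prod_complex_roots:
  fixes R :: "complex poly"
  assumes "R \<noteq> 0" and "card {w. poly R w = 0} \<ge> degree R"
  shows "lead_coeff R * (\<Prod>w | poly R w = 0. - w) = coeff R 0"
proof -
  have "smult (lead_coeff R) (\<Prod>w|poly R w = 0. [:-w, 1:]) = R"
    using complex_poly_decompose_rsquarefree rsquarefree_card_roots assms by blast
  then have "poly R 0 = poly (smult (lead_coeff R) (\<Prod>w|poly R w = 0. [:-w, 1:])) 0" by simp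
  then show ?thesis by (simp only: poly_smult poly_prod) (simp add: poly_0_coeff_0[symmetric])
qed

text \<open>
  The substitution \<open>w = exp (i t)\<close>, respectively \<open>w = exp t\<close>, turns a homogeneous polynomial along a
  geodesic into a Laurent polynomial.
\<close>

definition gunit :: "geometry \<Rightarrow> complex" where
  "gunit g = (case g of Spherical \<Rightarrow> \<i> | Hyperbolic \<Rightarrow> 1)"

definition gexp :: "geometry \<Rightarrow> real \<Rightarrow> complex" where
  "gexp g t = exp (gunit g * of_real t)"

lemma gunit_nonzero [simp]: "gunit g \<noteq> 0"
  by (cases g) (auto simp: gunit_def)

lemma gexp_nonzero [simp]: "gexp g t \<noteq> 0"
  by (simp add: gexp_def)

text \<open>Euler's formulas multiplied by \<open>gexp g t\<close>, which makes the right-hand sides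
  here and in \<open>gexp_gsin\<close> polynomial in \<open>gexp g t\<close>.\<close>

lemma gexp_gcos: "gexp g t * of_real (gcos g t) = ((gexp g t)\<^sup>2 + 1) / 2"
proof (cases g)
  case Spherical
  then show ?thesis
    by (simp add: gexp_def gunit_def cos_of_real[symmetric] cos_exp_eq field_simps power2_eq_square exp_minus)
next
  case Hyperbolic
  then show ?thesis
    by (simp add: gexp_def gunit_def cosh_field_def exp_of_real field_simps power2_eq_square exp_minus)
qed

lemma gexp_gsin: "gexp g t * of_real (gsin g t) = ((gexp g t)\<^sup>2 - 1) / (2 * gunit g)"
proof (cases g)
  case Spherical
  then show ?thesis
    by (simp add: gexp_def gunit_def sin_of_real[symmetric] sin_exp_eq field_simps power2_eq_square exp_minus)
next
  case Hyperbolic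
  then show ?thesis
    by (simp add: gexp_def gunit_def sinh_field_def exp_of_real field_simps power2_eq_square exp_minus)
qed

text \<open>Each of the \<open>d\<close> factors \<open>gcos\<close> or \<open>gsin\<close> absorbs
  one factor of \<open>gexp g t ^ d\<close>. Only squares of \<open>w\<close> occur, so
  \<open>Q\<close> is even; in the hyperbolic case this supplies the roots \<open>- exp t\<close>,
  which no real parameter reaches.\<close>

lemma binary_form_gexp:
  assumes "binary_form d f"
  obtains Q :: "complex poly" where "degree Q \<le> 2 * d" "\<And>w. poly Q (- w) = poly Q w"
    "\<And>t. of_real (f (gcos g t) (gsin g t)) * gexp g t ^ d = poly Q (gexp g t)"
proof -
  obtain c where c: "f a b = (\<Sum>k\<le>d. c k * a ^ (d - k) * b ^ k)" for a b
    using assms by (auto simp: binary_form_def)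
  define h where "h = 1 / (2 * gunit g)"
  define Q where "Q = (\<Sum>k\<le>d. smult (of_real (c k)) ([:1/2, 0, 1/2:] ^ (d - k) * [:- h, 0, h:] ^ k))"
  have Q: "poly Q w = (\<Sum>k\<le>d. of_real (c k) * (((w\<^sup>2 + 1) / 2) ^ (d - k) * ((w\<^sup>2 - 1) / (2 * gunit g)) ^ k))" for w
    by (simp add: Q_def poly_sum h_def power2_eq_square add_divide_distrib diff_divide_distrib algebra_simps)
  have "degree Q \<le> 2 * d"
    unfolding Q_def
  proof (rule degree_sum_le)
    fix k assume "k \<in> {..d}"
    have "degree (smult (of_real (c k)) ([:1/2, 0, 1/2:] ^ (d - k) * [:- h, 0, h:] ^ k)) \<le>
      degree ([:1/2, 0, 1/2:] ^ (d - k) :: complex poly) + degree ([:- h, 0, h:] ^ k)"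
      by (rule order_trans[OF degree_smult_le degree_mult_le])
    also have "\<dots> \<le> 2 * (d - k) + 2 * k"
      by (intro add_mono order_trans[OF degree_power_le] mult_right_mono) auto
    finally show "degree (smult (of_real (c k)) ([:1/2, 0, 1/2:] ^ (d - k) * [:- h, 0, h:] ^ k)) \<le> 2 * d"
      using \<open>k \<in> {..d}\<close> by simp
  qed simp
  moreover have "poly Q (- w) = poly Q w" for w by (simp add: Q)
  moreover have "of_real (f (gcos g t) (gsin g t)) * gexp g t ^ d = poly Q (gexp g t)" for t
  proof -
    have "of_real (c k) * of_real (gcos g t) ^ (d - k) * of_real (gsin g t) ^ k * gexp g t ^ d =
      of_real (c k) * (((gexp g t)\<^sup>2 + 1) / 2) ^ (d - k) * (((gexp g t)\<^sup>2 - 1) / (2 * gunit g)) ^ k"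
      if "k \<le> d" for k
    proof -
      have "gexp g t ^ d = gexp g t ^ (d - k) * gexp g t ^ k"
        using that by (simp flip: power_add)
      then show ?thesis
        unfolding gexp_gcos[symmetric] gexp_gsin[symmetric] power_mult_distrib by simp
    qed
    then show ?thesis
      unfolding c Q of_real_sum of_real_mult of_real_power sum_distrib_right
      by (intro sum.cong) (auto simp: mult.assoc)
  qed
  ultimately show ?thesis using that by blast
qed

lemma gexp_has_vector_derivative:
  "(gexp g has_vector_derivative (gunit g * gexp g t)) (at t)"
proof -
  have "((\<lambda>t. complex_of_real t) has_vector_derivative complex_of_real 1) (at t)"
    by (rule has_vector_derivative_of_real[OF DERIV_ident])
  then have 1: "((\<lambda>t. gunit g * of_real t) has_vector_derivative gunit g * complex_of_real 1) (at t)"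
    by (rule has_vector_derivative_mult_right)
  have "gexp g = exp \<circ> (\<lambda>t. gunit g * of_real t)"
    by (auto simp: gexp_def)
  then show ?thesis
    using field_vector_diff_chain_at[OF 1 DERIV_exp] by simp
qed

lemma gexp_eq: "gexp g t = of_real (gcos g t) + gunit g * of_real (gsin g t)"
proof -
  have "gunit g * (gexp g t * of_real (gsin g t)) = ((gexp g t)\<^sup>2 - 1) / 2"
    by (simp add: gexp_gsin)
  moreover have "gexp g t * (of_real (gcos g t) + gunit g * of_real (gsin g t)) =
      gexp g t * of_real (gcos g t) + gunit g * (gexp g t * of_real (gsin g t))"
    by (simp add: algebra_simps)
  ultimately have "gexp g t * (of_real (gcos g t) + gunit g * of_real (gsin g t)) = gexp g t * gexp g t"
    by (simp only: gexp_gcos) (simp add: power2_eq_square field_simps)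
  then show ?thesis by (metis gexp_nonzero mult_left_cancel)
qed

lemma gexp_eq_iff: "gexp g s = gexp g t \<longleftrightarrow> gcos g s = gcos g t \<and> gsin g s = gsin g t"
proof
  assume eq: "gexp g s = gexp g t"
  have "gexp g s * of_real (gcos g s) = gexp g s * of_real (gcos g t)"
    unfolding gexp_gcos using gexp_gcos[of g t] by (simp add: eq)
  moreover have "gexp g s * of_real (gsin g s) = gexp g s * of_real (gsin g t)"
    unfolding gexp_gsin using gexp_gsin[of g t] by (simp add: eq)
  ultimately show "gcos g s = gcos g t \<and> gsin g s = gsin g t" by simp
qed (simp add: gexp_eq)

lemma gexp_inj:
  assumes "gexp g s = gexp g t" and "g = Spherical \<Longrightarrow> s \<in> {- pi <..< pi} \<and> t \<in> {- pi <..< pi}"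
  shows "s = t"
proof (cases g)
  case Spherical
  then have "cis s = cis t" using assms(1) gexp_eq_iff[of g s t] by (simp add: complex_eq_iff)
  moreover have "Arg (cis u) = u" if "u \<in> {- pi <..< pi}" for u
    using that by (intro Arg_cis) auto
  ultimately show ?thesis using assms(2)[OF Spherical] by metis
next
  case Hyperbolic
  then show ?thesis using assms(1) gexp_eq_iff[of g s t] by simp
qed

text \<open>Turns a count of points on a geodesic into a count of values of \<open>gexp\<close> or
  \<open>tanh\<close>, which separate the same parameters.\<close>

lemma card_image_cong:
  assumes "\<And>s t. s \<in> Z \<Longrightarrow> t \<in> Z \<Longrightarrow> f s = f t \<longleftrightarrow> h s = h t"
  shows "card (f ` Z) = card (h ` Z)"
proof -
  have "bij_betw (\<lambda>y. h (inv_into Z f y)) (f ` Z) (h ` Z)"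
    by (rule bij_betwI[where g = "\<lambda>y. f (inv_into Z h y)"])
      (auto simp: inv_into_into f_inv_into_f, (metis assms f_inv_into_f imageI inv_into_into)+)
  then show ?thesis by (rule bij_betw_same_card)
qed

lemma gcos_fun: "gcos Spherical = cos" "gcos Hyperbolic = cosh"
  and gsin_fun: "gsin Spherical = sin" "gsin Hyperbolic = sinh"
  by auto

text \<open>The image is an interval containing \<open>l v\<close> and
  \<open>l (- v) = - l v\<close>, hence 0. The dimension enters through connectedness: in dimension
  1 there are only two unit tangent vectors.\<close>

lemma odd_function_zero_unit_tangent:
  fixes l :: "real \<times> (real^'n) \<Rightarrow> real"
  assumes dimension: "CARD('n) \<ge> 2" and x: "x \<in> model g" and l: "continuous_on (unit_tangents g x) l"
    and odd: "\<And>v. l (- v) = - l v"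
  shows "\<exists>v \<in> unit_tangents g x. l v = 0"
proof -
  obtain v where v: "v \<in> unit_tangents g x" using unit_tangents_nonempty[OF x] by blast
  have "connected (l ` unit_tangents g x)"
    using connected_continuous_image[OF l] connected_unit_tangents[OF x dimension] by blast
  moreover have "l v \<in> l ` unit_tangents g x" "- l v \<in> l ` unit_tangents g x"
    using v uminus_unit_tangents[OF x v] odd[of v] by (auto simp: image_iff) metis
  ultimately have "0 \<in> l ` unit_tangents g x"
    unfolding connected_iff_interval by (metis linear neg_0_le_iff_le neg_le_0_iff_le)
  then show ?thesis by auto
qed

text \<open>The level \<open>e\<close> and the base point stay variable. The assumption
  \<open>even_degree\<close> is a consequence of hyperbolicity of the zero surface and is discharged
  by \<open>even_degree_of_hyperbolic_surface\<close>.\<close>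

locale hyperbolic_level =
  fixes g :: geometry and p :: "real \<times> (real^'n) \<Rightarrow> real" and d :: nat
  assumes dimension: "CARD('n) \<ge> 2"
    and degree_pos: "d > 0"
    and even_degree: "g = Hyperbolic \<Longrightarrow> even d"
    and homogeneous: "homogeneous_polynomial d p"
begin

lemma continuous_on_p [continuous_intros]:
  "continuous_on S f \<Longrightarrow> continuous_on S (\<lambda>z. p (f z))"
  using homogeneous homogeneous_polynomial_continuous by blast

lemma ray_polynomial:
  obtains Q :: "complex poly" where "degree Q \<le> 2 * d" "\<And>w. poly Q (- w) = poly Q w"
    "\<And>t. of_real (p (geodesic g x v t)) * gexp g t ^ d = poly Q (gexp g t)"
  using binary_form_gexp[OF homogeneous_polynomial_on_plane[OF homogeneous, of x v], of g]
  unfolding geodesic_def by metis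

text \<open>In the spherical case the intersection count itself gives \<open>2 * d\<close> distinct
  roots, on the unit circle. In the hyperbolic case it gives \<open>d\<close> positive ones, and
  since \<open>d\<close> is even so is \<open>R\<close>, which adds their negatives. The degree
  bound leaves room for no further roots and no multiplicities.\<close>

lemma level_roots:
  fixes Q :: "complex poly"
  assumes x: "x \<in> level_hyperbolicity_domain g d p e" and v: "v \<in> unit_tangents g x"
    and Q: "degree Q \<le> 2 * d" "\<And>w. poly Q (- w) = poly Q w"
      "\<And>t. of_real (p (geodesic g x v t)) * gexp g t ^ d = poly Q (gexp g t)"
  defines "R \<equiv> Q - monom (of_real e) d"
  defines "Z \<equiv> {t. p (geodesic g x v t) = e}"
  shows "R \<noteq> 0" and "degree R = 2 * d"
    and "{w. poly R w = 0} = gexp g ` Z \<union> (if g = Hyperbolic then uminus ` gexp g ` Z else {})"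
    and "card {w. poly R w = 0} = 2 * d"
    and "finite (gexp g ` Z)"
proof -
  have xm: "x \<in> model g" using x by (simp add: level_hyperbolicity_domain_def)
  let ?C = "range (geodesic g x v)" and ?L = "level_set g p e"
  let ?W = "gexp g ` Z \<union> (if g = Hyperbolic then uminus ` gexp g ` Z else {})"
  have meets: "meets_level_hyperbolically g d ?L ?C"
    using x v by (auto simp: level_hyperbolicity_domain_def geodesics_through_def)
  have CL: "?C \<inter> ?L = geodesic g x v ` Z"
    using geodesic_in_model[OF xm v] by (auto simp: Z_def level_set_def)
  have geo_eq: "geodesic g x v s = geodesic g x v t \<longleftrightarrow> gexp g s = gexp g t" for s t
    using ambient_form_geodesic[OF xm v] unfolding gexp_eq_iff
    by (metis geodesic_def gsign_mult_gsign_left)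
  have card_eq: "card (?C \<inter> ?L) = card (gexp g ` Z)"
    unfolding CL by (rule card_image_cong) (rule geo_eq)
  then have card_pos: "card (gexp g ` Z) > 0"
    using meets degree_pos by (cases g) auto
  then show fin: "finite (gexp g ` Z)" using card_ge_0_finite by blast
  have card_W: "finite ?W \<and> card ?W = 2 * d"
  proof (cases g)
    case Spherical
    then show ?thesis using fin meets card_eq by simp
  next
    case Hyperbolic
    have "w \<noteq> - w'" if ww: "w \<in> gexp g ` Z" "w' \<in> gexp g ` Z" for w w'
    proof -
      obtain s t where "w = gexp g s" "w' = gexp g t" using ww by blast
      then have st: "w = of_real (exp s)" "w' = of_real (exp t)"
        using Hyperbolic by (simp_all only: gexp_def gunit_def geometry.case mult_1_left exp_of_real)
      have "exp s + exp t \<noteq> (0 :: real)" by (metis add_pos_pos exp_gt_zero less_irrefl)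
      then have "of_real (exp s) + of_real (exp t) \<noteq> (0 :: complex)" by (metis of_real_add of_real_eq_0_iff)
      then show ?thesis unfolding st by (metis add.right_inverse add.commute)
    qed
    then have "gexp g ` Z \<inter> uminus ` gexp g ` Z = {}" by auto
    then have "card (gexp g ` Z \<union> uminus ` gexp g ` Z) = 2 * card (gexp g ` Z)"
      using fin by (subst card_Un_disjoint) (auto simp: card_image)
    then show ?thesis using fin meets card_eq Hyperbolic by simp
  qed
  have root: "poly R (gexp g t) = 0" if "t \<in> Z" for t
    using that Q(3)[of t] by (simp add: R_def Z_def poly_monom)
  have W: "?W \<subseteq> {w. poly R w = 0}"
  proof -
    have "poly R (- gexp g t) = 0" if "t \<in> Z" "g = Hyperbolic" for t
      using root[OF that(1)] even_degree[OF that(2)] by (simp add: R_def Q(2) poly_monom)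
    then show ?thesis using root by auto
  qed
  show "R \<noteq> 0"
  proof
    \<comment> \<open>If \<open>R\<close> vanished, the whole geodesic would lie on the level,
      against the finite count.\<close>
    assume "R = 0"
    have "p (geodesic g x v t) = e" for t
    proof -
      have "poly R (gexp g t) = 0" by (simp add: \<open>R = 0\<close>)
      then have "of_real (p (geodesic g x v t)) * gexp g t ^ d = of_real e * gexp g t ^ d"
        using Q(3)[of t] by (simp add: R_def poly_monom)
      then show ?thesis by simp
    qed
    then have "geodesic g x v ` shortest_range g \<subseteq> ?C \<inter> ?L"
      unfolding CL Z_def by auto
    moreover have "infinite (geodesic g x v ` shortest_range g)"
    proof -
      have "inj_on (geodesic g x v) (shortest_range g)"
        using geodesic_inj[OF xm v v] by (auto intro: inj_onI)
      moreover have "infinite (shortest_range g)"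
        by (cases g) (auto simp: infinite_Ioo infinite_Ioi)
      ultimately show ?thesis by (simp add: finite_image_iff)
    qed
    ultimately have "infinite (?C \<inter> ?L)" using finite_subset by blast
    then show False using card_eq card_pos by simp
  qed
  then have fin_roots: "finite {w. poly R w = 0}" and le: "card {w. poly R w = 0} \<le> degree R"
    using poly_roots_finite card_poly_roots_bound by blast+
  have deg: "degree R \<le> 2 * d"
    unfolding R_def by (intro degree_diff_le Q(1) order_trans[OF degree_monom_le]) auto
  have "2 * d \<le> card {w. poly R w = 0}"
    using card_mono[OF fin_roots W] card_W by simp
  with le deg show "degree R = 2 * d" and card: "card {w. poly R w = 0} = 2 * d" by auto
  show "{w. poly R w = 0} = ?W"
    using card_subset_eq[OF fin_roots W] card card_W by simp
qed

text \<open>Differentiating \<open>poly R (gexp g t)\<close> relates the derivative of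
  \<open>p\<close> along the ray to \<open>pderiv R\<close> at a simple root, up to nonzero
  factors.\<close>

lemma level_simple_crossing:
  assumes x: "x \<in> level_hyperbolicity_domain g d p e" and v: "v \<in> unit_tangents g x"
    and t: "p (geodesic g x v t) = e"
  shows "\<exists>D. D \<noteq> 0 \<and> ((\<lambda>t. p (geodesic g x v t)) has_real_derivative D) (at t)"
proof -
  let ?f = "\<lambda>t. p (geodesic g x v t)"
  obtain Q :: "complex poly" where Q: "degree Q \<le> 2 * d" "\<And>w. poly Q (- w) = poly Q w"
    "\<And>t. of_real (p (geodesic g x v t)) * gexp g t ^ d = poly Q (gexp g t)"
    using ray_polynomial by metis
  define R where "R = Q - monom (of_real e) d"
  note roots = level_roots[OF x v Q, folded R_def]
  have R: "of_real (?f t - e) * gexp g t ^ d = poly R (gexp g t)" for t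
    using Q(3)[of t] by (simp add: R_def poly_monom algebra_simps)
  have "rsquarefree R"
    using rsquarefree_card_roots[OF roots(1)] roots(2,4) by simp
  moreover have "poly R (gexp g t) = 0" using R[of t] t by simp
  ultimately have R': "poly (pderiv R) (gexp g t) \<noteq> 0" using rsquarefree_roots by blast
  obtain c where c: "\<And>a b. p (a *\<^sub>R x + b *\<^sub>R v) = (\<Sum>k\<le>d. c k * a ^ (d - k) * b ^ k)"
    using homogeneous_polynomial_on_plane[OF homogeneous, of x v] unfolding binary_form_def by auto
  have "\<exists>D. (gcos g has_real_derivative D) (at t)"
    by (cases g) (auto simp: gcos_fun intro!: exI derivative_eq_intros)
  then obtain Dc where Dc: "(gcos g has_real_derivative Dc) (at t)" by blast
  have "\<exists>D. (gsin g has_real_derivative D) (at t)"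
    by (cases g) (auto simp: gsin_fun intro!: exI derivative_eq_intros)
  then obtain Ds where Ds: "(gsin g has_real_derivative Ds) (at t)" by blast
  have "\<exists>D. (?f has_real_derivative D) (at t)"
    unfolding geodesic_def c by (rule exI, (rule derivative_intros Dc Ds refl)+)
  then obtain D where D: "(?f has_real_derivative D) (at t)" by blast
  have 1: "((\<lambda>t. of_real (?f t - e) * gexp g t ^ d) has_vector_derivative
      of_real D * gexp g t ^ d) (at t)"
  proof -
    have "((\<lambda>t. ?f t - e) has_real_derivative D) (at t)"
      using D by (auto intro!: derivative_eq_intros)
    then have "((\<lambda>t. of_real (?f t - e) :: complex) has_vector_derivative of_real D) (at t)"
      by (rule has_vector_derivative_of_real)
    moreover have "\<exists>E. ((\<lambda>t. gexp g t ^ d) has_vector_derivative E) (at t)"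
      using field_vector_diff_chain_at[OF gexp_has_vector_derivative DERIV_power[OF DERIV_ident]] unfolding comp_def by blast
    then obtain E where "((\<lambda>t. gexp g t ^ d) has_vector_derivative E) (at t)" by blast
    ultimately have "((\<lambda>t. of_real (?f t - e) * gexp g t ^ d) has_vector_derivative
        of_real (?f t - e) * E + of_real D * gexp g t ^ d) (at t)"
      by (rule has_vector_derivative_mult)
    \<comment> \<open>At a crossing the term containing \<open>E\<close> vanishes.\<close>
    then show ?thesis using t by simp
  qed
  have "((\<lambda>t. poly R (gexp g t)) has_vector_derivative
      gunit g * gexp g t * poly (pderiv R) (gexp g t)) (at t)"
    using field_vector_diff_chain_at[OF gexp_has_vector_derivative poly_DERIV] by (simp add: comp_def)
  then have "of_real D * gexp g t ^ d = gunit g * gexp g t * poly (pderiv R) (gexp g t)"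
    using vector_derivative_unique_at[OF 1] R by simp
  then have "D \<noteq> 0" using R' by auto
  then show ?thesis using D by blast
qed

text \<open>Every crossing at \<open>x\<close> would be simple, but some tangent direction at \<open>x\<close> is critical for \<open>p\<close>.\<close>

lemma level_avoids_base:
  assumes x: "x \<in> level_hyperbolicity_domain g d p e"
  shows "p x \<noteq> e" and "g = Spherical \<Longrightarrow> p (- x) \<noteq> e"
proof -
  have xm: "x \<in> model g" using x by (simp add: level_hyperbolicity_domain_def)
  have critical: "\<exists>v \<in> unit_tangents g x. p' v = 0" if "(p has_derivative p') (at y)" for p' y
  proof (rule odd_function_zero_unit_tangent[OF dimension xm])
    show "continuous_on (unit_tangents g x) p'"
      using that by (simp add: has_derivative_bounded_linear linear_continuous_on)
    show "p' (- v) = - p' v" for v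
      using has_derivative_linear[OF that] by (simp add: linear_neg)
  qed
  show "p x \<noteq> e"
  proof
    assume e: "p x = e"
    obtain p' where p': "(p has_derivative p') (at x)"
      using homogeneous_polynomial_differentiable[OF homogeneous] by blast
    then obtain v where v: "v \<in> unit_tangents g x" "p' v = 0" using critical by blast
    have "(geodesic g x v has_vector_derivative v) (at 0)"
      unfolding geodesic_def
      by (cases g) (auto intro!: derivative_eq_intros simp: has_vector_derivative_def)
    moreover have "geodesic g x v 0 = x" by (simp add: geodesic_def)
    ultimately have "((p \<circ> geodesic g x v) has_derivative (p' \<circ> (\<lambda>h. h *\<^sub>R v))) (at 0)"
      using diff_chain_at p' unfolding has_vector_derivative_def by metis
    then have "((\<lambda>t. p (geodesic g x v t)) has_real_derivative 0) (at 0)"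
      using has_derivative_linear[OF p'] v(2)
      by (simp add: has_field_derivative_def comp_def linear_scale lambda_zero)
    then show False
      using level_simple_crossing[OF x v(1), of 0] e DERIV_unique \<open>geodesic g x v 0 = x\<close> by metis
  qed
  show "p (- x) \<noteq> e" if g: "g = Spherical"
  proof
    assume e: "p (- x) = e"
    obtain p' where p': "(p has_derivative p') (at (- x))"
      using homogeneous_polynomial_differentiable[OF homogeneous] by blast
    then obtain v where v: "v \<in> unit_tangents g x" "p' v = 0" using critical by blast
    \<comment> \<open>All great circles from \<open>x\<close> pass through \<open>- x\<close> at
      \<open>t = pi\<close>, with velocity \<open>- v\<close>, so a critical direction at
      \<open>- x\<close> can be chosen among the tangents at \<open>x\<close>.\<close>
    have "(geodesic g x v has_vector_derivative - v) (at pi)"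
      unfolding geodesic_def g
      by (auto intro!: derivative_eq_intros simp: has_vector_derivative_def)
    moreover have pi: "geodesic g x v pi = - x" by (simp add: geodesic_def g)
    ultimately have "((p \<circ> geodesic g x v) has_derivative (p' \<circ> (\<lambda>h. h *\<^sub>R (- v)))) (at pi)"
      using diff_chain_at p' unfolding has_vector_derivative_def by metis
    then have "((\<lambda>t. p (geodesic g x v t)) has_real_derivative 0) (at pi)"
      using has_derivative_linear[OF p'] v(2)
      by (simp add: has_field_derivative_def comp_def linear_scale linear_neg lambda_zero)
    then show False
      using level_simple_crossing[OF x v(1), of pi] e DERIV_unique pi by metis
  qed
qed

end

text \<open>Only the open part of a geodesic on which \<open>t\<close> is the distance from
  \<open>x\<close>; the opposite part is described by \<open>crossings\<close> in direction
  \<open>- v\<close>.\<close>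

definition crossings ::
  "geometry \<Rightarrow> (real \<times> (real^'n) \<Rightarrow> real) \<Rightarrow> real \<times> (real^'n) \<Rightarrow> real \<Rightarrow> real \<times> (real^'n) \<Rightarrow> real set" where
  "crossings g p x e v = {t \<in> shortest_range g. p (geodesic g x v t) = e}"

text \<open>For odd \<open>d\<close> the polynomial is an odd function, so it vanishes at some unit
  tangent vector \<open>v\<close>. Along that geodesic, \<open>p\<close> divided by
  \<open>cosh t ^ d\<close> is a polynomial in \<open>tanh t\<close> whose coefficient of order
  \<open>d\<close> is \<open>p v = 0\<close>. Its \<open>d\<close> distinct roots then force it to
  vanish identically, and the intersection would be infinite.\<close>

lemma even_degree_of_hyperbolic_surface:
  fixes p :: "real \<times> (real^'n) \<Rightarrow> real"
  assumes dimension: "CARD('n) \<ge> 2" and d: "d > 0" and hom: "homogeneous_polynomial d p"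
    and surf: "hyperbolic_surface Hyperbolic d p"
  shows "even d"
proof (rule ccontr)
  let ?g = Hyperbolic
  assume "odd d"
  obtain x where x: "x \<in> model ?g"
    and meets: "\<And>C. C \<in> geodesics_through ?g x \<Longrightarrow> meets_surface_hyperbolically ?g d (surface ?g p) C"
    using surf unfolding hyperbolic_surface_def surface_hyperbolicity_domain_def by blast
  have "p (- v) = - p v" for v
    using homogeneous_polynomial_minus[OF hom] \<open>odd d\<close> by simp
  then obtain v where v: "v \<in> unit_tangents ?g x" and pv: "p v = 0"
    using odd_function_zero_unit_tangent[OF dimension x, of p]
      homogeneous_polynomial_continuous[OF hom continuous_on_id] by auto
  obtain c where c: "\<And>a b. p (a *\<^sub>R x + b *\<^sub>R v) = (\<Sum>k\<le>d. c k * a ^ (d - k) * b ^ k)"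
    using homogeneous_polynomial_on_plane[OF hom, of x v] unfolding binary_form_def by auto
  have "c d = 0"
  proof -
    have "p v = (\<Sum>k\<le>d. c k * 0 ^ (d - k))" using c[of 0 1] by simp
    also have "\<dots> = (\<Sum>k\<le>d. if k = d then c k else 0)" by (intro sum.cong) auto
    finally show ?thesis using pv by simp
  qed
  let ?Z = "{t. p (geodesic ?g x v t) = 0}"
  have inj: "geodesic ?g x v s = geodesic ?g x v t \<longleftrightarrow> s = t" for s t
    using ambient_form_geodesic(2)[OF x v] by (metis gsin.simps(2) sinh_real_eq_iff)
  have CL: "range (geodesic ?g x v) \<inter> surface ?g p = geodesic ?g x v ` ?Z"
    using geodesic_in_model[OF x v] by (auto simp: level_set_def)
  have "card (geodesic ?g x v ` ?Z) = d"
    using meets[of "range (geodesic ?g x v)"] v unfolding CL[symmetric] by (auto simp: geodesics_through_def)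
  moreover have "card (tanh ` ?Z) = card (geodesic ?g x v ` ?Z)"
    by (rule card_image_cong) (use inj in simp)
  ultimately have card: "card (tanh ` ?Z) = d" by simp
  have scale: "p (geodesic ?g x v t) = cosh t ^ d * p (1 *\<^sub>R x + tanh t *\<^sub>R v)" for t
  proof -
    have "cosh t ^ (d - k) * sinh t ^ k = cosh t ^ d * tanh t ^ k" if "k \<le> d" for k
    proof -
      have "cosh t ^ d = cosh t ^ (d - k) * cosh t ^ k" using that by (simp flip: power_add)
      moreover have "sinh t = cosh t * tanh t" by (simp add: tanh_def)
      ultimately show ?thesis by (simp add: power_mult_distrib)
    qed
    then show ?thesis
      unfolding geodesic_def c sum_distrib_left by (intro sum.cong) (auto simp: mult.assoc mult.left_commute)
  qed
  have "p (a *\<^sub>R x + b *\<^sub>R v) = 0" for a b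
  proof (rule binary_form_roots[OF c \<open>c d = 0\<close> d _ card])
    show "finite (tanh ` ?Z)" using card d card_ge_0_finite by metis
    show "p (1 *\<^sub>R x + u *\<^sub>R v) = 0" if "u \<in> tanh ` ?Z" for u
      using that scale by auto
  qed
  then have "?Z = UNIV" by (auto simp: geodesic_def)
  then have "infinite (tanh ` ?Z)"
    using inj by (simp add: finite_image_iff inj_on_def infinite_UNIV_char_0)
  then show False using card d by simp
qed

section \<open>Crossing parameters on opposite rays\<close>

context hyperbolic_level
begin

text \<open>Every point of a geodesic other than \<open>x\<close> and, on the sphere,
  \<open>- x\<close> lies on exactly one of the two opposite rays, and
  \<open>level_avoids_base\<close> keeps these exceptional points off the level. Thus
  \<open>B\<close> represents every crossing once, modulo the period in the spherical case.\<close>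

lemma crossings_split:
  assumes x: "x \<in> level_hyperbolicity_domain g d p e" and v: "v \<in> unit_tangents g x"
  defines "B \<equiv> crossings g p x e v \<union> uminus ` crossings g p x e (- v)"
  shows "gexp g ` {t. p (geodesic g x v t) = e} = gexp g ` B"
    and "inj_on (gexp g) B"
    and "crossings g p x e v \<inter> uminus ` crossings g p x e (- v) = {}"
proof -
  have xm: "x \<in> model g" using x by (simp add: level_hyperbolicity_domain_def)
  have B_Z: "p (geodesic g x v t) = e" if "t \<in> B" for t
    using that by (auto simp: B_def crossings_def geodesic_minus[OF xm])
  have I_pos: "t > 0" if "t \<in> shortest_range g" for t
    using that by (cases g) auto
  show "crossings g p x e v \<inter> uminus ` crossings g p x e (- v) = {}"
    by (auto simp: crossings_def dest!: I_pos)
  have in_B: "t \<in> B" if "p (geodesic g x v t) = e" "\<bar>t\<bar> \<in> shortest_range g" for t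
  proof (cases "t \<ge> 0")
    case False
    then have "- t \<in> crossings g p x e (- v)" using that by (simp add: crossings_def geodesic_minus[OF xm])
    then have "- (- t) \<in> B" unfolding B_def by blast
    then show ?thesis by simp
  qed (use that in \<open>simp add: B_def crossings_def\<close>)
  have p0: "p (geodesic g x v 0) \<noteq> e"
    using level_avoids_base(1)[OF x] by (simp add: geodesic_def)
  show "inj_on (gexp g) B"
  proof (rule inj_onI, rule gexp_inj)
    fix s t assume "s \<in> B" "t \<in> B"
    then show "s \<in> {- pi<..<pi} \<and> t \<in> {- pi<..<pi}" if "g = Spherical"
      using that by (auto simp: B_def crossings_def intro: less_trans[of _ 0])
  qed
  show "gexp g ` {t. p (geodesic g x v t) = e} = gexp g ` B"
  proof
    show "gexp g ` {t. p (geodesic g x v t) = e} \<subseteq> gexp g ` B"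
    proof clarify
      fix t assume t: "e = p (geodesic g x v t)"
      show "gexp g t \<in> gexp g ` B"
      proof (cases g)
        case Hyperbolic
        have "t \<noteq> 0" using t p0 by auto
        then show ?thesis using in_B[of t] t Hyperbolic by auto
      next
        case Spherical
        \<comment> \<open>The representative of \<open>t\<close> modulo \<open>2 * pi\<close> that
          exceeds \<open>- pi\<close> and is at most \<open>pi\<close>.\<close>
        define s where "s = Arg (cis t)"
        have "cis s = cis t" by (simp add: s_def cis_Arg)
        then have eq: "gexp g s = gexp g t" "geodesic g x v s = geodesic g x v t"
          unfolding gexp_eq_iff geodesic_def by (simp_all add: Spherical complex_eq_iff)
        have "s \<noteq> 0" using p0 t eq by metis
        moreover have "s \<noteq> pi"
        proof
          assume "s = pi"
          then have "geodesic g x v s = - x" by (simp add: geodesic_def Spherical)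
          then show False using level_avoids_base(2)[OF x Spherical] t eq by simp
        qed
        moreover have "- pi < s" "s \<le> pi" using Arg_bounded[of "cis t"] by (auto simp: s_def)
        ultimately have "s \<in> B" using in_B[of s] t eq Spherical by auto
        then show ?thesis using eq by (metis imageI)
      qed
    qed
  qed (use B_Z in auto)
qed

lemma finite_crossings:
  assumes x: "x \<in> level_hyperbolicity_domain g d p e" and v: "v \<in> unit_tangents g x"
  shows "finite (crossings g p x e v)"
    and "card (crossings g p x e v) + card (crossings g p x e (- v)) = (if g = Spherical then 2 * d else d)"
proof -
  let ?Z = "{t. p (geodesic g x v t) = e}"
  let ?B = "crossings g p x e v \<union> uminus ` crossings g p x e (- v)"
  have xm: "x \<in> model g" using x by (simp add: level_hyperbolicity_domain_def)
  obtain Q :: "complex poly" where Q: "degree Q \<le> 2 * d" "\<And>w. poly Q (- w) = poly Q w"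
    "\<And>t. of_real (p (geodesic g x v t)) * gexp g t ^ d = poly Q (gexp g t)"
    using ray_polynomial by metis
  note roots = level_roots[OF x v Q]
  note split = crossings_split[OF x v]
  have finB: "finite ?B" using roots(5) split(1,2) by (simp add: finite_image_iff)
  then show "finite (crossings g p x e v)" by simp
  have "card (gexp g ` ?Z) = (if g = Spherical then 2 * d else d)"
  proof -
    have meets: "meets_level_hyperbolically g d (level_set g p e) (range (geodesic g x v))"
      using x v by (auto simp: level_hyperbolicity_domain_def geodesics_through_def)
    have "range (geodesic g x v) \<inter> level_set g p e = geodesic g x v ` ?Z"
      using geodesic_in_model[OF xm v] by (auto simp: level_set_def)
    moreover have "card (geodesic g x v ` ?Z) = card (gexp g ` ?Z)"
      using ambient_form_geodesic[OF xm v]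
      by (intro card_image_cong) (metis gexp_eq_iff geodesic_def gsign_mult_gsign_left)
    ultimately show ?thesis using meets by (cases g) auto
  qed
  moreover have "card (gexp g ` ?B) = card ?B" using split(2) by (rule card_image)
  moreover have "card ?B = card (crossings g p x e v) + card (uminus ` crossings g p x e (- v))"
    using finB split(3) by (intro card_Un_disjoint) auto
  moreover have "card (uminus ` crossings g p x e (- v)) = card (crossings g p x e (- v))"
    by (rule card_image) simp
  ultimately show "card (crossings g p x e v) + card (crossings g p x e (- v)) = (if g = Spherical then 2 * d else d)"
    using split(1) by simp
qed

text \<open>
  Vieta: the product of the roots is a quotient of coefficients that do not depend on the level.
  It determines the sum of the crossing parameters, modulo \<open>2 * pi\<close> in the spherical case.
\<close>

lemma crossing_sums_gexp:
  assumes x: "x \<in> level_hyperbolicity_domain g d p e" "x \<in> level_hyperbolicity_domain g d p e'"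
    and v: "v \<in> unit_tangents g x"
  defines "m \<equiv> (if g = Spherical then 1 else 2)"
  shows "gexp g (m * (\<Sum>(crossings g p x e v) - \<Sum>(crossings g p x e (- v)))) =
         gexp g (m * (\<Sum>(crossings g p x e' v) - \<Sum>(crossings g p x e' (- v))))"
proof -
  have xm: "x \<in> model g" using x by (simp add: level_hyperbolicity_domain_def)
  obtain Q :: "complex poly" where Q: "degree Q \<le> 2 * d" "\<And>w. poly Q (- w) = poly Q w"
    "\<And>t. of_real (p (geodesic g x v t)) * gexp g t ^ d = poly Q (gexp g t)"
    using ray_polynomial by metis
  have gexp_sum: "(\<Prod>t\<in>A. gexp g t) = gexp g (\<Sum>A)" for A
    by (induction A rule: infinite_finite_induct) (auto simp: gexp_def distrib_left exp_add)
  have "coeff Q (2 * d) * (if g = Spherical then 1 else (- 1) ^ d) *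
      gexp g (m * (\<Sum>(crossings g p x e v) - \<Sum>(crossings g p x e (- v)))) = coeff Q 0"
    and nz: "coeff Q (2 * d) \<noteq> 0"
    if x: "x \<in> level_hyperbolicity_domain g d p e" for e
  proof -
    define R where "R = Q - monom (of_real e) d"
    let ?Z = "{t. p (geodesic g x v t) = e}"
    let ?A = "crossings g p x e v" and ?A' = "crossings g p x e (- v)"
    let ?B = "?A \<union> uminus ` ?A'"
    note roots = level_roots[OF x v Q, folded R_def]
    note split = crossings_split[OF x v]
    have fin: "finite ?A" "finite ?A'"
      using finite_crossings[OF x v] finite_crossings[OF x uminus_unit_tangents[OF xm v]] by auto
    \<comment> \<open>Since \<open>0 < d\<close> and \<open>d < 2 * d\<close>, subtracting the
      monomial of degree \<open>d\<close> touches neither the leading nor the constant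
      coefficient.\<close>
    have lead: "lead_coeff R = coeff Q (2 * d)" and c0: "coeff R 0 = coeff Q 0"
      using degree_pos unfolding roots(2) by (auto simp: R_def coeff_diff)
    show "coeff Q (2 * d) \<noteq> 0" using lead roots(1) by (metis leading_coeff_0_iff)
    have "\<Sum>?B = \<Sum>?A + \<Sum>(uminus ` ?A')"
      using fin split(3) by (intro sum.union_disjoint) auto
    also have "\<Sum>(uminus ` ?A') = - \<Sum>?A'"
      by (subst sum.reindex) (auto simp: sum_negf)
    finally have sumB: "\<Sum>?B = \<Sum>?A - \<Sum>?A'" by simp
    have prodB: "(\<Prod>w\<in>gexp g ` ?Z. w) = gexp g (\<Sum>?A - \<Sum>?A')"
      unfolding split(1) sumB[symmetric] gexp_sum[symmetric] using split(2) by (simp add: prod.reindex)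
    have "card {w. poly R w = 0} = 2 * d" by (rule roots(4))
    \<comment> \<open>The number of roots is even, so the signs in Vieta's formula cancel.\<close>
    then have "(\<Prod>w | poly R w = 0. - w) = (\<Prod>w | poly R w = 0. w)"
      using prod.distrib[of "\<lambda>_. - 1" "\<lambda>w. w" "{w. poly R w = 0}"] by (simp add: power_mult)
    also have "\<dots> = (if g = Spherical then 1 else (- 1) ^ d) * gexp g (m * (\<Sum>?A - \<Sum>?A'))"
    proof (cases g)
      case Spherical
      then show ?thesis using roots(3) prodB by (simp add: m_def)
    next
      case Hyperbolic
      \<comment> \<open>The negatives of the positive roots repeat their product up to sign, so the
        product over all roots is a square up to sign; this is where \<open>m = 2\<close> comes
        from.\<close>
      let ?W = "gexp g ` ?Z"
      have finW: "finite ?W" by (rule roots(5))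
      have cardW: "card ?W = d"
        using finite_crossings(2)[OF x v] split fin Hyperbolic
        by (simp add: card_image card_Un_disjoint)
      have eq: "{w. poly R w = 0} = ?W \<union> uminus ` ?W" using roots(3) Hyperbolic by simp
      have "card (?W \<union> uminus ` ?W) + card (?W \<inter> uminus ` ?W) = card ?W + card (uminus ` ?W)"
        using finW by (intro card_Un_Int[symmetric]) auto
      moreover have "card (uminus ` ?W) = d" using cardW by (simp add: card_image)
      ultimately have "?W \<inter> uminus ` ?W = {}"
        using finW cardW roots(4) unfolding eq by simp
      then have "(\<Prod>w | poly R w = 0. w) = (\<Prod>w\<in>?W. w) * (\<Prod>w\<in>uminus ` ?W. w)"
        unfolding eq using finW by (intro prod.union_disjoint) auto
      also have "(\<Prod>w\<in>uminus ` ?W. w) = (- 1) ^ d * (\<Prod>w\<in>?W. w)"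
        using prod.distrib[of "\<lambda>_. - 1" "\<lambda>w. w" ?W] cardW by (subst prod.reindex) auto
      also have "(\<Prod>w\<in>?W. w) * ((- 1) ^ d * (\<Prod>w\<in>?W. w)) =
          (- 1) ^ d * gexp g (2 * (\<Sum>?A - \<Sum>?A'))"
        unfolding prodB by (simp add: gexp_def algebra_simps flip: exp_add)
      finally show ?thesis using Hyperbolic by (simp add: m_def)
    qed
    finally show "coeff Q (2 * d) * (if g = Spherical then 1 else (- 1) ^ d) *
      gexp g (m * (\<Sum>?A - \<Sum>?A')) = coeff Q 0"
      using prod_complex_roots[OF roots(1)] roots(2,4) lead c0 by (simp add: mult.assoc)
  qed
  note * = this
  have "coeff Q (2 * d) * (if g = Spherical then 1 else (- 1) ^ d) \<noteq> 0" using *(2)[OF x(1)] by simp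
  then show ?thesis using *(1)[OF x(1)] *(1)[OF x(2)] by (metis mult_left_cancel)
qed

text \<open>As \<open>Q\<close> has degree exactly \<open>2 * d\<close>, \<open>p\<close> grows like
  \<open>exp (d * t)\<close> along the ray. Formally, \<open>reflect_poly Q\<close> at
  \<open>exp (- t)\<close> equals \<open>p\<close> times \<open>exp (- t) ^ d\<close>: it tends to
  the nonzero leading coefficient, but would tend to 0 if \<open>p\<close> were bounded.\<close>

lemma hyperbolic_level_unbounded:
  assumes x: "x \<in> level_hyperbolicity_domain g d p e" and v: "v \<in> unit_tangents g x"
    and g: "g = Hyperbolic"
  shows "\<exists>t \<ge> b. \<bar>p (geodesic g x v t)\<bar> > B"
proof (rule ccontr)
  assume "\<not> ?thesis"
  then have bound: "\<bar>p (geodesic g x v t)\<bar> \<le> B" if "t \<ge> b" for t using that not_less by blast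
  obtain Q :: "complex poly" where Q: "degree Q \<le> 2 * d" "\<And>w. poly Q (- w) = poly Q w"
    "\<And>t. of_real (p (geodesic g x v t)) * gexp g t ^ d = poly Q (gexp g t)"
    using ray_polynomial by metis
  define R where "R = Q - monom (of_real e) d"
  note roots = level_roots[OF x v Q, folded R_def]
  have "coeff Q (2 * d) = lead_coeff R"
    using degree_pos unfolding roots(2) by (auto simp: R_def coeff_diff)
  then have "coeff Q (2 * d) \<noteq> 0" using roots(1) by simp
  then have deg: "degree Q = 2 * d" using Q(1) by (meson le_antisym le_degree)
  have gexp: "gexp g t = of_real (exp t)" for t
    by (simp only: g gexp_def gunit_def geometry.case mult_1_left exp_of_real)
  have lim: "((\<lambda>t. exp (- t)) \<longlongrightarrow> (0::real)) at_top"
    using exp_at_bot filterlim_compose filterlim_uminus_at_bot_at_top by blast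
  have "((\<lambda>t. complex_of_real (exp (- t))) \<longlongrightarrow> of_real 0) at_top"
    by (intro tendsto_of_real lim)
  then have "((\<lambda>t. poly (reflect_poly Q) (of_real (exp (- t)))) \<longlongrightarrow> poly (reflect_poly Q) (of_real 0)) at_top"
    by (rule isCont_tendsto_compose[OF poly_isCont])
  then have lim1: "((\<lambda>t. poly (reflect_poly Q) (of_real (exp (- t)))) \<longlongrightarrow> lead_coeff Q) at_top"
    by simp
  have "((\<lambda>t. poly (reflect_poly Q) (of_real (exp (- t)))) \<longlongrightarrow> 0) at_top"
  proof (rule Lim_null_comparison)
    show "((\<lambda>t. B * exp (- t)) \<longlongrightarrow> 0) at_top"
      using tendsto_mult_right_zero[OF lim, of B] by simp
    show "\<forall>\<^sub>F t in at_top. norm (poly (reflect_poly Q) (of_real (exp (- t)))) \<le> B * exp (- t)"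
    proof (rule eventually_at_top_linorderI)
      fix t assume t: "t \<ge> max b 0"
      have inv: "inverse (complex_of_real (exp (- t))) = of_real (exp t)"
        by (simp add: exp_minus)
      have "poly (reflect_poly Q) (of_real (exp (- t))) = of_real (exp (- t)) ^ (2 * d) * poly Q (of_real (exp t))"
        by (subst poly_reflect_poly_nz) (auto simp: deg inv simp del: of_real_exp)
      also have "\<dots> = of_real (p (geodesic g x v t)) * (of_real (exp (- t)) ^ (2 * d) * of_real (exp t) ^ d)"
        using Q(3)[of t] by (simp add: gexp)
      also have "exp (- t) ^ (2 * d) * exp t ^ d = exp (- t) ^ d"
      proof -
        have "exp (- t) ^ d * exp t ^ d = 1"
          by (simp flip: power_mult_distrib exp_add)
        then show ?thesis by (simp add: mult_2 power_add)
      qed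
      then have "complex_of_real (exp (- t)) ^ (2 * d) * of_real (exp t) ^ d = of_real (exp (- t) ^ d)"
        by (metis of_real_mult of_real_power)
      finally have "norm (poly (reflect_poly Q) (of_real (exp (- t)))) = \<bar>p (geodesic g x v t)\<bar> * exp (- t) ^ d"
        by (simp only: norm_mult norm_of_real) simp
      also have "\<dots> \<le> B * exp (- t)"
      proof (rule mult_mono)
        have "exp (- t) ^ d \<le> exp (- t) ^ 1"
          using t degree_pos by (intro power_decreasing) auto
        then show "exp (- t) ^ d \<le> exp (- t)" by simp
        show "\<bar>p (geodesic g x v t)\<bar> \<le> B" using bound t by simp
        then show "0 \<le> B" by simp
      qed auto
      finally show "norm (poly (reflect_poly Q) (of_real (exp (- t)))) \<le> B * exp (- t)" .
    qed
  qed
  then have "lead_coeff Q = 0" using lim1 tendsto_unique trivial_limit_at_top_linorder by blast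
  then show False using deg \<open>coeff Q (2 * d) \<noteq> 0\<close> by simp
qed

end

section \<open>Components of the level sets\<close>

lemma real_derivative_sides:
  fixes f :: "real \<Rightarrow> real"
  assumes D: "(f has_real_derivative D) (at t)" "D \<noteq> 0"
  shows "\<exists>\<delta>>0. \<forall>h>0. h < \<delta> \<longrightarrow> D * (f (t + h) - f t) > 0 \<and> D * (f (t - h) - f t) < 0"
proof (cases "D > 0")
  case True
  obtain \<delta>1 \<delta>2 where "\<delta>1 > 0" "\<delta>2 > 0" "\<And>h. h > 0 \<Longrightarrow> h < \<delta>1 \<Longrightarrow> f (t - h) < f t"
    "\<And>h. h > 0 \<Longrightarrow> h < \<delta>2 \<Longrightarrow> f t < f (t + h)"
    using DERIV_pos_inc_left[OF D(1) True] DERIV_pos_inc_right[OF D(1) True] by blast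
  then show ?thesis using True by (intro exI[of _ "min \<delta>1 \<delta>2"]) (auto intro!: mult_pos_neg)
next
  case False
  then have "D < 0" using D(2) by simp
  obtain \<delta>1 \<delta>2 where "\<delta>1 > 0" "\<delta>2 > 0" "\<And>h. h > 0 \<Longrightarrow> h < \<delta>1 \<Longrightarrow> f (t - h) > f t"
    "\<And>h. h > 0 \<Longrightarrow> h < \<delta>2 \<Longrightarrow> f t > f (t + h)"
    using DERIV_neg_dec_left[OF D(1) \<open>D < 0\<close>] DERIV_neg_dec_right[OF D(1) \<open>D < 0\<close>] by blast
  then show ?thesis using \<open>D < 0\<close>
    by (intro exI[of _ "min \<delta>1 \<delta>2"]) (auto intro!: mult_neg_pos mult_neg_neg)
qed

lemma real_derivative_sign_change:
  fixes f :: "real \<Rightarrow> real"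
  assumes D: "(f has_real_derivative D) (at t)" "D \<noteq> 0" and N: "open N" "t \<in> N"
  obtains a b where "a < t" "t < b" "{a..b} \<subseteq> N" "(f a - f t) * (f b - f t) < 0"
proof -
  obtain r where r: "r > 0" "\<And>s. \<bar>s - t\<bar> < r \<Longrightarrow> s \<in> N"
    using N unfolding open_dist dist_real_def by blast
  obtain \<delta> where \<delta>: "\<delta> > 0" "\<And>h. h > 0 \<Longrightarrow> h < \<delta> \<Longrightarrow> D * (f (t + h) - f t) > 0 \<and> D * (f (t - h) - f t) < 0"
    using real_derivative_sides[OF D] by blast
  define h where "h = min \<delta> r / 2"
  have "h > 0" "h < \<delta>" "h < r" using \<delta>(1) r(1) by (auto simp: h_def min_def)
  moreover have "{t - h..t + h} \<subseteq> N"
  proof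
    fix s assume "s \<in> {t - h..t + h}"
    then have "\<bar>s - t\<bar> < r" using \<open>h < r\<close> by auto
    then show "s \<in> N" by (rule r(2))
  qed
  moreover have "(f (t - h) - f t) * (f (t + h) - f t) < 0"
    using \<delta>(2)[OF \<open>h > 0\<close> \<open>h < \<delta>\<close>] by (auto simp: zero_less_mult_iff mult_less_0_iff)
  ultimately show ?thesis using that[of "t - h" "t + h"] by simp
qed

text \<open>Both comparisons with the element at position \<open>i\<close> become lower bounds for
  the number of elements in an open half-line. Such bounds are what \<open>crossings_persist\<close>
  provides, so continuity of the ordered crossings follows.\<close>

lemma sorted_list_nth_less_iff:
  fixes A :: "real set"
  assumes "finite A" and i: "i < card A"
  shows "sorted_list_of_set A ! i < c \<longleftrightarrow> i < card (A \<inter> {..<c})"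
    and "c < sorted_list_of_set A ! i \<longleftrightarrow> card A - i \<le> card (A \<inter> {c<..})"
proof -
  let ?l = "sorted_list_of_set A"
  have len: "length ?l = card A" by simp
  have mono: "?l ! j < ?l ! k \<longleftrightarrow> j < k" if "j < card A" "k < card A" for j k
    using that strict_sorted_list_of_set[of A] len
    by (metis linorder_neqE_nat order_less_asym sorted_wrt_nth_less less_irrefl)
  have A: "A = (\<lambda>j. ?l ! j) ` {..<card A}"
    using assms(1) len by (metis set_sorted_list_of_set lessThan_atLeast0 list.set_map map_nth set_upt)
  have inj: "inj_on (\<lambda>j. ?l ! j) {..<card A}"
    using mono by (intro inj_onI) (metis lessThan_iff linorder_neqE_nat less_irrefl)
  have card_sub: "card (A \<inter> P) = card {j. j < card A \<and> ?l ! j \<in> P}" for P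
  proof -
    have "A \<inter> P = (\<lambda>j. ?l ! j) ` {j. j < card A \<and> ?l ! j \<in> P}" by (subst A) auto
    then show ?thesis using inj by (simp add: card_image inj_on_subset subset_iff)
  qed
  have le: "?l ! j \<le> ?l ! k" if "j \<le> k" "k < card A" for j k
    using that mono[of k j] by (meson le_less_trans not_le)
  show "?l ! i < c \<longleftrightarrow> i < card (A \<inter> {..<c})"
  proof
    assume "?l ! i < c"
    then have "{..i} \<subseteq> {j. j < card A \<and> ?l ! j \<in> {..<c}}"
      using le i by (auto intro: le_less_trans)
    then have "card {..i} \<le> card {j. j < card A \<and> ?l ! j \<in> {..<c}}" by (intro card_mono) auto
    then show "i < card (A \<inter> {..<c})" using card_sub by simp
  next
    assume *: "i < card (A \<inter> {..<c})"
    show "?l ! i < c"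
    proof (rule ccontr)
      assume "\<not> ?l ! i < c"
      then have "{j. j < card A \<and> ?l ! j \<in> {..<c}} \<subseteq> {..<i}"
        using le by (auto simp: not_less) (meson le_less_trans not_le)
      then have "card {j. j < card A \<and> ?l ! j \<in> {..<c}} \<le> card {..<i}" by (intro card_mono) auto
      then show False using * card_sub by simp
    qed
  qed
  show "c < ?l ! i \<longleftrightarrow> card A - i \<le> card (A \<inter> {c<..})"
  proof
    assume "c < ?l ! i"
    then have "{i..<card A} \<subseteq> {j. j < card A \<and> ?l ! j \<in> {c<..}}"
      using le by (auto intro: less_le_trans)
    then have "card {i..<card A} \<le> card {j. j < card A \<and> ?l ! j \<in> {c<..}}" by (intro card_mono) auto
    then show "card A - i \<le> card (A \<inter> {c<..})" using card_sub by simp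
  next
    assume *: "card A - i \<le> card (A \<inter> {c<..})"
    show "c < ?l ! i"
    proof (rule ccontr)
      assume "\<not> c < ?l ! i"
      then have "{j. j < card A \<and> ?l ! j \<in> {c<..}} \<subseteq> {Suc i..<card A}"
        using le[OF _ i] by (auto simp: not_less Suc_le_eq) (meson le_less_trans not_le)
      then have "card {j. j < card A \<and> ?l ! j \<in> {c<..}} \<le> card {Suc i..<card A}" by (intro card_mono) auto
      then show False using * card_sub i by simp
    qed
  qed
qed

text \<open>The union of all other members is closed because the family is finite, so a connected
  superset of one member inside the union cannot reach another.\<close>

lemma components_finite_disjoint_closed:
  assumes "finite I" and "\<And>i. i \<in> I \<Longrightarrow> connected (C i)" "\<And>i. i \<in> I \<Longrightarrow> closed (C i)"
    and ne: "\<And>i. i \<in> I \<Longrightarrow> C i \<noteq> {}"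
    and disj: "\<And>i j. i \<in> I \<Longrightarrow> j \<in> I \<Longrightarrow> i \<noteq> j \<Longrightarrow> C i \<inter> C j = {}"
  shows "components (\<Union>i\<in>I. C i) = C ` I"
proof -
  let ?S = "\<Union>i\<in>I. C i"
  have comp: "C i \<in> components ?S" if i: "i \<in> I" for i
    unfolding in_components_maximal
  proof (intro conjI allI impI)
    fix K assume K: "K \<noteq> {} \<and> C i \<subseteq> K \<and> K \<subseteq> ?S \<and> connected K"
    define R where "R = (\<Union>j\<in>I - {i}. C j)"
    have "closed R" using assms(1,3) unfolding R_def by (intro closed_UN) auto
    moreover have sub: "K \<subseteq> C i \<union> R" using K unfolding R_def by auto
    moreover have "C i \<inter> R = {}" using disj i unfolding R_def by blast
    ultimately have "C i \<inter> K = {} \<or> R \<inter> K = {}"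
      using K assms(3)[OF i] by (intro connected_closedD) auto
    moreover have "C i \<inter> K \<noteq> {}" using K ne[OF i] by blast
    ultimately have "K \<subseteq> C i" using sub by blast
    then show "K = C i" using K by blast
  qed (use assms i in auto)
  show ?thesis
  proof
    show "components ?S \<subseteq> C ` I"
    proof
      fix K assume K: "K \<in> components ?S"
      then obtain y where "y \<in> K" "y \<in> ?S" by (metis in_components_nonempty in_components_subset ex_in_conv subsetD)
      then obtain i where i: "i \<in> I" "y \<in> C i" by blast
      then show "K \<in> C ` I" using components_eq[OF K comp[OF i(1)]] \<open>y \<in> K\<close> by blast
    qed
  qed (use comp in auto)
qed

lemma shortest_range_facts:
  "open (shortest_range g)" "t \<in> shortest_range g \<Longrightarrow> t > 0"
  by (cases g; auto)+

text \<open>Meaningful when \<open>K\<close> is a component of a level set that is hyperbolic with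
  respect to \<open>x\<close>; \<open>component_crossing\<close> shows that exactly one parameter
  then qualifies.\<close>

definition crossing_param ::
  "geometry \<Rightarrow> real \<times> (real^'n) \<Rightarrow> (real \<times> (real^'n)) set \<Rightarrow> real \<times> (real^'n) \<Rightarrow> real" where
  "crossing_param g x K v = (THE t. t \<in> shortest_range g \<and> geodesic g x v t \<in> K)"

section \<open>Dependence of the crossings on the direction\<close>

context hyperbolic_level
begin

text \<open>Induction on \<open>k\<close>, splitting off the last crossing \<open>r\<close> in
  \<open>N\<close>. A cut \<open>c\<close> separates it from the others, which the induction
  hypothesis handles to the left of \<open>c\<close>. Near \<open>r\<close>, simplicity gives a sign
  change between two fixed parameters, which survives for nearby \<open>v\<close> and yields a
  crossing to the right of \<open>c\<close>.\<close>

lemma crossings_persist: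
  assumes x: "x \<in> level_hyperbolicity_domain g d p e" and v0: "v0 \<in> unit_tangents g x"
    and N: "open N" "card (crossings g p x e v0 \<inter> N) \<ge> k"
  shows "\<forall>\<^sub>F v in at v0 within unit_tangents g x. card (crossings g p x e v \<inter> N) \<ge> k"
  using N
proof (induction k arbitrary: N)
  case (Suc k)
  let ?U = "unit_tangents g x" and ?A = "crossings g p x e"
  have fin: "finite (?A v)" if "v \<in> ?U" for v using finite_crossings(1)[OF x that] .
  let ?B = "?A v0 \<inter> N"
  have finB: "finite ?B" using fin[OF v0] by simp
  have "?B \<noteq> {}" using Suc.prems(2) by auto
  define r where "r = Max ?B"
  have r: "r \<in> ?B" using Max_in[OF finB \<open>?B \<noteq> {}\<close>] by (simp add: r_def)
  have "\<exists>c<r. \<forall>s\<in>?B - {r}. s < c"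
  proof (cases "?B - {r} = {}")
    case True
    then show ?thesis by (metis empty_iff lt_ex)
  next
    case False
    have "Max (?B - {r}) \<in> ?B - {r}" using finB False by (intro Max_in) auto
    then have "Max (?B - {r}) < r" using finB Max_ge[of ?B] unfolding r_def by (metis DiffE insertCI order_le_less)
    then obtain c where "Max (?B - {r}) < c" "c < r" using dense by blast
    then show ?thesis using finB False by (metis Max_less_iff finite_Diff)
  qed
  then obtain c where c: "c < r" "\<And>s. s \<in> ?B - {r} \<Longrightarrow> s < c" by blast
  have "?B - {r} \<subseteq> ?A v0 \<inter> (N \<inter> {..<c})" using c by auto
  then have "card (?B - {r}) \<le> card (?A v0 \<inter> (N \<inter> {..<c}))" using fin[OF v0] by (intro card_mono) auto
  then have "k \<le> card (?A v0 \<inter> (N \<inter> {..<c}))" using Suc.prems(2) r finB by simp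
  then have ev1: "\<forall>\<^sub>F v in at v0 within ?U. k \<le> card (?A v \<inter> (N \<inter> {..<c}))"
    using Suc.prems(1) by (intro Suc.IH) auto
  have pr: "p (geodesic g x v0 r) = e" and rI: "r \<in> shortest_range g"
    using r by (auto simp: crossings_def)
  obtain D where D: "D \<noteq> 0" "((\<lambda>t. p (geodesic g x v0 t)) has_real_derivative D) (at r)"
    using level_simple_crossing[OF x v0 pr] by blast
  have "open (N \<inter> {c<..} \<inter> shortest_range g)"
    using Suc.prems(1) shortest_range_facts(1) by (intro open_Int) auto
  then obtain a b where ab: "a < r" "r < b" "{a..b} \<subseteq> N \<inter> {c<..} \<inter> shortest_range g"
    "(p (geodesic g x v0 a) - e) * (p (geodesic g x v0 b) - e) < 0"
    using real_derivative_sign_change[OF D(2,1)] r c rI pr by (metis (no_types, lifting) IntD2 IntI greaterThan_iff)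
  have cont: "continuous_on ?U (\<lambda>v. (p (geodesic g x v a) - e) * (p (geodesic g x v b) - e))"
    by (intro continuous_intros)
  have "((\<lambda>v. (p (geodesic g x v a) - e) * (p (geodesic g x v b) - e)) \<longlongrightarrow>
      (p (geodesic g x v0 a) - e) * (p (geodesic g x v0 b) - e)) (at v0 within ?U)"
    using cont v0 unfolding continuous_on_def by blast
  then have ev2: "\<forall>\<^sub>F v in at v0 within ?U. (p (geodesic g x v a) - e) * (p (geodesic g x v b) - e) < 0"
    using ab(4) by (rule order_tendstoD)
  have "\<forall>\<^sub>F v in at v0 within ?U. v \<in> ?U" by (simp add: eventually_at_filter)
  then show ?case using ev1 ev2
  proof eventually_elim
    case (elim v)
    let ?f = "\<lambda>t. p (geodesic g x v t) - e"
    have contf: "continuous_on {a..b} ?f" by (intro continuous_intros)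
    have "\<exists>t\<in>{a..b}. ?f t = 0"
    proof (cases "?f a < 0")
      case True
      then have "?f b > 0" using elim(3) by (simp add: mult_less_0_iff)
      then show ?thesis using IVT'[of ?f a 0 b] True contf ab(1,2) by force
    next
      case False
      then have "?f a > 0" "?f b < 0" using elim(3) by (auto simp: mult_less_0_iff)
      then show ?thesis using IVT2'[of ?f b 0 a] contf ab(1,2) by force
    qed
    then obtain t where t: "t \<in> {a..b}" "p (geodesic g x v t) = e" by auto
    then have "t \<in> ?A v" "t \<in> N" "c < t" using ab(3) by (auto simp: crossings_def subset_iff)
    then have "insert t (?A v \<inter> (N \<inter> {..<c})) \<subseteq> ?A v \<inter> N" by auto
    then have "card (insert t (?A v \<inter> (N \<inter> {..<c}))) \<le> card (?A v \<inter> N)"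
      using fin[OF elim(1)] by (intro card_mono) auto
    moreover have "card (insert t (?A v \<inter> (N \<inter> {..<c}))) = Suc (card (?A v \<inter> (N \<inter> {..<c})))"
      using fin[OF elim(1)] \<open>c < t\<close> by (intro card_insert_disjoint) auto
    ultimately show "Suc k \<le> card (?A v \<inter> N)" using elim(2) by simp
  qed
qed simp

text \<open>By \<open>crossings_persist\<close> the count can only grow near a given direction, and
  likewise for the opposite direction. The sum of the two is fixed, so both are locally constant,
  and the unit tangents are connected.\<close>

lemma card_crossings_constant:
  assumes x: "x \<in> level_hyperbolicity_domain g d p e"
    and "v \<in> unit_tangents g x" "v' \<in> unit_tangents g x"
  shows "card (crossings g p x e v) = card (crossings g p x e v')"
proof (rule connected_local_const[where f = "\<lambda>v. card (crossings g p x e v)" and A = "unit_tangents g x"])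
  let ?U = "unit_tangents g x" and ?A = "crossings g p x e"
  have xm: "x \<in> model g" using x by (simp add: level_hyperbolicity_domain_def)
  show "connected ?U" by (rule connected_unit_tangents[OF xm dimension])
  show "\<forall>v0\<in>?U. \<forall>\<^sub>F v in at v0 within ?U. card (?A v0) = card (?A v)"
  proof
    fix v0 assume v0: "v0 \<in> ?U"
    have 1: "\<forall>\<^sub>F v in at v0 within ?U. card (?A v) \<ge> card (?A v0)"
      using crossings_persist[OF x v0, of UNIV "card (?A v0)"] by simp
    have ev: "\<forall>\<^sub>F v in at (- v0) within ?U. card (?A v) \<ge> card (?A (- v0))"
      using crossings_persist[OF x uminus_unit_tangents[OF xm v0], of UNIV "card (?A (- v0))"] by simp
    have "filterlim uminus (at (- v0) within ?U) (at v0 within ?U)"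
      by (rule filterlim_at_withinI)
        (auto intro!: tendsto_intros always_eventually dest: uminus_unit_tangents[OF xm] simp: eventually_at_filter)
    then have 2: "\<forall>\<^sub>F v in at v0 within ?U. card (?A (- v)) \<ge> card (?A (- v0))"
      by (rule eventually_compose_filterlim[OF ev])
    have "\<forall>\<^sub>F v in at v0 within ?U. v \<in> ?U" by (simp add: eventually_at_filter)
    then show "\<forall>\<^sub>F v in at v0 within ?U. card (?A v0) = card (?A v)"
      using 1 2
    proof eventually_elim
      case (elim v)
      then show ?case using finite_crossings(2)[OF x v0] finite_crossings(2)[OF x elim(1)] by simp
    qed
  qed
qed (use assms in auto)

text \<open>\<open>r i v\<close> is the crossing at position \<open>i\<close> in increasing order.
  It is continuous in \<open>v\<close>, so each index sweeps out a compact connected set; these sets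
  are disjoint because a point determines its direction and distance from \<open>x\<close>.\<close>

lemma level_components:
  assumes x: "x \<in> level_hyperbolicity_domain g d p e"
  obtains r :: "nat \<Rightarrow> real \<times> (real^'n) \<Rightarrow> real" and D :: nat where "components (level_set g p e) = (\<lambda>i. (\<lambda>v. geodesic g x v (r i v)) ` unit_tangents g x) ` {..<D}"
    and "\<forall>i<D. continuous_on (unit_tangents g x) (r i)"
    and "\<forall>v\<in>unit_tangents g x. bij_betw (\<lambda>i. r i v) {..<D} (crossings g p x e v)"
proof -
  let ?U = "unit_tangents g x" and ?A = "crossings g p x e"
  have xm: "x \<in> model g" using x by (simp add: level_hyperbolicity_domain_def)
  obtain v1 where v1: "v1 \<in> ?U" using unit_tangents_nonempty[OF xm] by blast
  define D where "D = card (?A v1)"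
  have card: "card (?A v) = D" if "v \<in> ?U" for v
    unfolding D_def using card_crossings_constant[OF x that v1] .
  have fin: "finite (?A v)" if "v \<in> ?U" for v using finite_crossings(1)[OF x that] .
  define r where "r i v = sorted_list_of_set (?A v) ! i" for i v
  have bij: "bij_betw (\<lambda>i. r i v) {..<D} (?A v)" if "v \<in> ?U" for v
    unfolding r_def using fin[OF that] card[OF that]
    by (intro bij_betw_nth) auto
  have cont: "continuous_on ?U (r i)" if i: "i < D" for i
    unfolding continuous_on_def
  proof
    fix v0 assume v0: "v0 \<in> ?U"
    have evU: "\<forall>\<^sub>F v in at v0 within ?U. v \<in> ?U" by (simp add: eventually_at_filter)
    show "(r i \<longlongrightarrow> r i v0) (at v0 within ?U)"
    proof (rule order_tendstoI)
      fix c assume "c < r i v0"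
      then have "D - i \<le> card (?A v0 \<inter> {c<..})"
        using sorted_list_nth_less_iff(2)[OF fin[OF v0]] card[OF v0] i by (simp add: r_def)
      then have "\<forall>\<^sub>F v in at v0 within ?U. D - i \<le> card (?A v \<inter> {c<..})"
        by (intro crossings_persist[OF x v0]) auto
      with evU show "\<forall>\<^sub>F v in at v0 within ?U. c < r i v"
      proof eventually_elim
        case (elim v)
        then show ?case using sorted_list_nth_less_iff(2)[OF fin[OF elim(1)]] card[OF elim(1)] i
          by (simp add: r_def)
      qed
    next
      fix c assume "r i v0 < c"
      then have "Suc i \<le> card (?A v0 \<inter> {..<c})"
        using sorted_list_nth_less_iff(1)[OF fin[OF v0]] card[OF v0] i by (simp add: r_def Suc_le_eq)
      then have "\<forall>\<^sub>F v in at v0 within ?U. Suc i \<le> card (?A v \<inter> {..<c})"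
        by (intro crossings_persist[OF x v0]) auto
      with evU show "\<forall>\<^sub>F v in at v0 within ?U. r i v < c"
      proof eventually_elim
        case (elim v)
        then show ?case using sorted_list_nth_less_iff(1)[OF fin[OF elim(1)]] card[OF elim(1)] i
          by (simp add: r_def Suc_le_eq)
      qed
    qed
  qed
  have rI: "r i v \<in> ?A v" if "i < D" "v \<in> ?U" for i v
    using bij[OF that(2)] that(1) by (auto simp: bij_betw_def)
  let ?C = "\<lambda>i. (\<lambda>v. geodesic g x v (r i v)) ` ?U"
  have "level_set g p e = (\<Union>i\<in>{..<D}. ?C i)"
  proof
    show "level_set g p e \<subseteq> (\<Union>i\<in>{..<D}. ?C i)"
    proof
      fix y assume y: "y \<in> level_set g p e"
      then have ym: "y \<in> model g" "p y = e" by (auto simp: level_set_def)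
      have "y \<noteq> x" using level_avoids_base(1)[OF x] ym by auto
      moreover have "y \<noteq> - x"
      proof (cases g)
        case Spherical then show ?thesis using level_avoids_base(2)[OF x] ym by auto
      next
        case Hyperbolic then show ?thesis using ym xm by auto
      qed
      ultimately obtain t v where tv: "t \<in> shortest_range g" "v \<in> ?U" "y = geodesic g x v t"
        using ex_geodesic[OF xm ym(1)] by blast
      then have "t \<in> ?A v" using ym by (simp add: crossings_def)
      then obtain i where "i < D" "t = r i v" using bij[OF tv(2)] by (auto simp: bij_betw_def)
      then show "y \<in> (\<Union>i\<in>{..<D}. ?C i)" using tv by auto
    qed
    show "(\<Union>i\<in>{..<D}. ?C i) \<subseteq> level_set g p e"
      using rI geodesic_in_model[OF xm] by (auto simp: level_set_def crossings_def)
  qed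
  moreover have "components (\<Union>i\<in>{..<D}. ?C i) = ?C ` {..<D}"
  proof (rule components_finite_disjoint_closed)
    fix i assume "i \<in> {..<D}"
    then have "continuous_on ?U (\<lambda>v. geodesic g x v (r i v))"
      using cont by (intro continuous_intros) auto
    then show "connected (?C i)" "closed (?C i)"
      using connected_unit_tangents[OF xm dimension] compact_unit_tangents[OF xm]
      by (auto intro: connected_continuous_image compact_imp_closed compact_continuous_image)
    show "?C i \<noteq> {}" using v1 by auto
  next
    fix i j assume ij: "i \<in> {..<D}" "j \<in> {..<D}" "i \<noteq> j"
    show "?C i \<inter> ?C j = {}"
    proof (rule ccontr)
      assume "?C i \<inter> ?C j \<noteq> {}"
      then obtain y where "y \<in> ?C i" "y \<in> ?C j" by blast
      then obtain v w where vw: "v \<in> ?U" "w \<in> ?U" "geodesic g x v (r i v) = geodesic g x w (r j w)"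
        by (metis (no_types, lifting) imageE)
      moreover have "r i v \<in> shortest_range g" "r j w \<in> shortest_range g"
        using rI ij vw by (auto simp: crossings_def)
      ultimately have "v = w" "r i v = r j w" using geodesic_inj[OF xm] by blast+
      then show False using bij[OF vw(1)] ij by (auto simp: bij_betw_def inj_on_def)
    qed
  qed simp
  ultimately show ?thesis using that[of r D] cont bij by simp
qed

text \<open>Replaces the index, which depends on the base point, by the component itself, which does
  not; this allows crossings seen from two points to be compared.\<close>

lemma component_crossing:
  assumes x: "x \<in> level_hyperbolicity_domain g d p e" and K: "K \<in> components (level_set g p e)"
  shows "continuous_on (unit_tangents g x) (crossing_param g x K)"
    and "v \<in> unit_tangents g x \<Longrightarrow> crossing_param g x K v \<in> shortest_range g"
    and "v \<in> unit_tangents g x \<Longrightarrow> t \<in> shortest_range g \<Longrightarrow>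
      geodesic g x v t \<in> K \<longleftrightarrow> t = crossing_param g x K v"
proof -
  let ?U = "unit_tangents g x" and ?A = "crossings g p x e"
  have xm: "x \<in> model g" using x by (simp add: level_hyperbolicity_domain_def)
  obtain r and D :: nat where C: "components (level_set g p e) = (\<lambda>i. (\<lambda>v. geodesic g x v (r i v)) ` ?U) ` {..<D}"
    and cont': "\<forall>i<D. continuous_on ?U (r i)" and bij': "\<forall>v\<in>?U. bij_betw (\<lambda>i. r i v) {..<D} (?A v)"
    by (rule level_components[OF x])
  then have cont: "\<And>i. i < D \<Longrightarrow> continuous_on ?U (r i)"
    and bij: "\<And>v. v \<in> ?U \<Longrightarrow> bij_betw (\<lambda>i. r i v) {..<D} (?A v)"
    by simp_all
  from K[unfolded C] obtain i where i': "K = (\<lambda>v. geodesic g x v (r i v)) ` ?U" "i \<in> {..<D}"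
    by (rule imageE)
  then have i: "i < D" "K = (\<lambda>v. geodesic g x v (r i v)) ` ?U" by auto
  have rI: "r i v \<in> shortest_range g" if "v \<in> ?U" for v
    using bij[OF that] i(1) by (auto simp: bij_betw_def crossings_def)
  have iff: "t \<in> shortest_range g \<and> geodesic g x v t \<in> K \<longleftrightarrow> t = r i v" if "v \<in> ?U" for v t
  proof
    assume t: "t \<in> shortest_range g \<and> geodesic g x v t \<in> K"
    then obtain w where "w \<in> ?U" "geodesic g x v t = geodesic g x w (r i w)"
      unfolding i(2) by (metis (no_types, lifting) imageE)
    then show "t = r i v" using geodesic_inj[OF xm that, of w t "r i w"] rI[of w] t by auto
  next
    assume "t = r i v"
    then show "t \<in> shortest_range g \<and> geodesic g x v t \<in> K" using rI that unfolding i(2) by auto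
  qed
  then have eq: "crossing_param g x K v = r i v" if "v \<in> ?U" for v
    using that by (simp add: crossing_param_def)
  show "continuous_on ?U (crossing_param g x K)"
    using cont[OF i(1)] eq by (simp cong: continuous_on_cong)
  show "v \<in> ?U \<Longrightarrow> crossing_param g x K v \<in> shortest_range g"
    using eq rI by simp
  show "v \<in> ?U \<Longrightarrow> t \<in> shortest_range g \<Longrightarrow> geodesic g x v t \<in> K \<longleftrightarrow> t = crossing_param g x K v"
    using iff[of v t] eq[of v] by auto
qed

lemma components_crossings_bij:
  assumes x: "x \<in> level_hyperbolicity_domain g d p e" and v: "v \<in> unit_tangents g x"
  shows "bij_betw (\<lambda>K. crossing_param g x K v) (components (level_set g p e)) (crossings g p x e v)"
proof (rule bij_betw_imageI)
  have xm: "x \<in> model g" using x by (simp add: level_hyperbolicity_domain_def)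
  have geo: "geodesic g x v (crossing_param g x K v) \<in> K" if "K \<in> components (level_set g p e)" for K
    using component_crossing(2,3)[OF x that v] by blast
  show "inj_on (\<lambda>K. crossing_param g x K v) (components (level_set g p e))"
  proof (rule inj_onI)
    fix K L assume KL: "K \<in> components (level_set g p e)" "L \<in> components (level_set g p e)"
      "crossing_param g x K v = crossing_param g x L v"
    then have "K \<inter> L \<noteq> {}" using geo by (metis IntI empty_iff)
    then show "K = L" using components_eq KL by blast
  qed
  show "(\<lambda>K. crossing_param g x K v) ` components (level_set g p e) = crossings g p x e v"
  proof
    show "(\<lambda>K. crossing_param g x K v) ` components (level_set g p e) \<subseteq> crossings g p x e v"
      using component_crossing(2)[OF x _ v] geo in_components_subset[of _ "level_set g p e"]
      by (force simp: crossings_def level_set_def)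
    show "crossings g p x e v \<subseteq> (\<lambda>K. crossing_param g x K v) ` components (level_set g p e)"
    proof
      fix t assume t: "t \<in> crossings g p x e v"
      then have "geodesic g x v t \<in> level_set g p e"
        using geodesic_in_model[OF xm v] by (simp add: crossings_def level_set_def)
      then obtain K where K: "K \<in> components (level_set g p e)" "geodesic g x v t \<in> K"
        using Union_components[of "level_set g p e"] by blast
      then show "t \<in> (\<lambda>K. crossing_param g x K v) ` components (level_set g p e)"
        using component_crossing(3)[OF x K(1) v] t by (auto simp: crossings_def)
    qed
  qed
qed

end

section \<open>Components of the layer\<close>

locale layer = hyperbolic_level g p d
  for g :: geometry and p :: "real \<times> (real^'n) \<Rightarrow> real" and d :: nat +
  fixes e1 e2 :: real
  assumes standard: "standard_layer g d p e1 e2"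
begin

abbreviation shells :: "(real \<times> (real^'n)) set set" where
  "shells \<equiv> components (shell g p e1 e2)"

lemma e1_less_e2: "e1 < e2"
  using standard by (simp add: standard_layer_def)

lemma closed_shell: "closed (shell g p e1 e2)"
proof -
  have "shell g p e1 e2 = model g \<inter> {x. e1 \<le> p x} \<inter> {x. p x \<le> e2}"
    by (auto simp: shell_def)
  moreover have "closed \<dots>"
    by (intro closed_Int closed_model closed_Collect_le continuous_intros)
  ultimately show ?thesis by simp
qed

lemma level_subset_shell: "e \<in> {e1, e2} \<Longrightarrow> level_set g p e \<subseteq> shell g p e1 e2"
  using e1_less_e2 by (auto simp: level_set_def shell_def)

lemma closed_shell_component: "K \<in> shells \<Longrightarrow> closed K"
  using closed_components closed_shell by blast

text \<open>\<open>standard_layer\<close> counts inside a component \<open>K'\<close> of the shell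
  enlarged to level 0. It allows only one shell component in \<open>K'\<close>, so the shell
  component around the level component of \<open>K'\<close> is \<open>K\<close> itself.\<close>

lemma shell_component_level:
  assumes e: "e \<in> {e1, e2}" and K: "K \<in> shells"
  shows "\<exists>!C. C \<in> components (level_set g p e) \<and> C \<subseteq> K"
proof -
  let ?S = "shell g p e1 e2" and ?S' = "shell g p (min e1 0) (max e2 0)" and ?L = "level_set g p e"
  have K_props: "K \<subseteq> ?S" "connected K" "K \<noteq> {}"
    using K in_components_subset in_components_connected in_components_nonempty by blast+
  have sub: "?S \<subseteq> ?S'" by (auto simp: shell_def)
  then have "?S' \<noteq> {}" using K_props by blast
  then obtain K' where K': "K' \<in> components ?S'" "K \<subseteq> K'"
    using exists_component_superset[of K ?S'] K_props sub by blast
  have "contains_one_component_of K' ?S" "contains_one_component_of K' ?L"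
    using standard K'(1) e unfolding standard_layer_def by auto
  then have oneS: "\<exists>!D. D \<in> components ?S \<and> D \<subseteq> K'" and oneL: "\<exists>!C. C \<in> components ?L \<and> C \<subseteq> K'"
    unfolding contains_one_component_of_def .
  obtain C where C: "C \<in> components ?L" "C \<subseteq> K'" using oneL by blast
  have C_props: "C \<subseteq> ?L" "connected C" "C \<noteq> {}"
    using C(1) in_components_subset in_components_connected in_components_nonempty by blast+
  have "C \<subseteq> ?S" using C_props(1) level_subset_shell[OF e] by blast
  then obtain K2 where K2: "K2 \<in> components ?S" "C \<subseteq> K2"
    using exists_component_superset[of C ?S] C_props by blast
  have "K2 \<subseteq> K'"
  proof (rule components_maximal[OF K'(1)])
    show "connected K2" "K2 \<subseteq> ?S'"
      using K2(1) in_components_connected in_components_subset sub by blast+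
    show "K' \<inter> K2 \<noteq> {}" using C(2) K2(2) C_props(3) by blast
  qed
  then have "K2 = K" using oneS K K'(2) K2(1) by blast
  then have "C \<in> components ?L \<and> C \<subseteq> K" using C K2 by blast
  moreover have "C' = C" if "C' \<in> components ?L \<and> C' \<subseteq> K" for C'
  proof -
    from that have "C' \<subseteq> K" by (rule conjunct2)
    then have "C' \<subseteq> K'" using K'(2) by (rule order_trans)
    with that have "C' \<in> components ?L \<and> C' \<subseteq> K'" by simp
    then show ?thesis using oneL C by (rule_tac ex1E[OF oneL]) (simp only:, metis)
  qed
  ultimately show ?thesis by (rule ex1I)
qed

definition boundary :: "real \<Rightarrow> (real \<times> (real^'n)) set \<Rightarrow> (real \<times> (real^'n)) set" where
  "boundary e K = (THE C. C \<in> components (level_set g p e) \<and> C \<subseteq> K)"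

lemma boundary:
  assumes "e \<in> {e1, e2}" and "K \<in> shells"
  shows "boundary e K \<in> components (level_set g p e)" and "boundary e K \<subseteq> K"
    and "C \<in> components (level_set g p e) \<Longrightarrow> C \<subseteq> K \<Longrightarrow> C = boundary e K"
  using theI'[OF shell_component_level[OF assms]] shell_component_level[OF assms]
  unfolding boundary_def by blast+

lemma level_component_in_shell_component:
  assumes e: "e \<in> {e1, e2}" and C: "C \<in> components (level_set g p e)"
  obtains K where "K \<in> shells" "C = boundary e K"
proof -
  have C_props: "C \<subseteq> level_set g p e" "connected C" "C \<noteq> {}"
    using C in_components_subset in_components_connected in_components_nonempty by blast+
  have "C \<subseteq> shell g p e1 e2" using C_props(1) level_subset_shell[OF e] by blast
  then obtain K where K: "K \<in> shells" "C \<subseteq> K"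
    using exists_component_superset[of C "shell g p e1 e2"] C_props by blast
  then show ?thesis using that boundary(3)[OF e K(1) C] by blast
qed

lemma boundary_bij:
  assumes e: "e \<in> {e1, e2}"
  shows "bij_betw (boundary e) (shells) (components (level_set g p e))"
proof (rule bij_betw_imageI)
  show "inj_on (boundary e) (shells)"
  proof (rule inj_onI)
    fix K K' assume K: "K \<in> shells" "K' \<in> shells"
      and eq: "boundary e K = boundary e K'"
    have "boundary e K \<noteq> {}" using boundary(1)[OF e K(1)] in_components_nonempty by blast
    then have "K \<inter> K' \<noteq> {}" using boundary(2)[OF e K(1)] boundary(2)[OF e K(2)] eq by blast
    then show "K = K'" using components_eq[OF K] by blast
  qed
  show "boundary e ` shells = components (level_set g p e)"
    using boundary(1)[OF e] level_component_in_shell_component[OF e] by blast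
qed

text \<open>The component of the level set through \<open>y\<close> meets \<open>K\<close> and lies
  in the shell, hence in \<open>K\<close>, and there is only one such. Together with
  \<open>boundary\<close>, \<open>K\<close> meets the level exactly in
  \<open>boundary e K\<close>.\<close>

lemma boundary_iff:
  assumes e: "e \<in> {e1, e2}" and K: "K \<in> shells" and y: "y \<in> K" "p y = e"
  shows "y \<in> boundary e K"
proof -
  have "y \<in> level_set g p e"
    using y K in_components_subset by (force simp: level_set_def shell_def)
  then obtain C where C: "C \<in> components (level_set g p e)" "y \<in> C"
    using Union_components[of "level_set g p e"] by blast
  have "C \<subseteq> K"
  proof (rule components_maximal[OF K])
    show "connected C" using C in_components_connected by blast
    show "C \<subseteq> shell g p e1 e2" using C in_components_subset level_subset_shell[OF e] by blast
    show "K \<inter> C \<noteq> {}" using C y by blast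
  qed
  then show ?thesis using boundary(3)[OF e K C(1)] C(2) by blast
qed

end

section \<open>A layer seen from a point of its hyperbolicity domain\<close>

locale layer_at = layer g p d e1 e2
  for g :: geometry and p :: "real \<times> (real^'n) \<Rightarrow> real" and d :: nat and e1 e2 :: real +
  fixes x :: "real \<times> (real^'n)"
  assumes x: "x \<in> layer_hyperbolicity_domain g d p e1 e2"
begin

lemma x_model: "x \<in> model g"
  and x_level: "e \<in> {e1, e2} \<Longrightarrow> x \<in> level_hyperbolicity_domain g d p e"
  using x by (auto simp: layer_hyperbolicity_domain_def level_hyperbolicity_domain_def)

abbreviation U :: "(real \<times> (real^'n)) set" where "U \<equiv> unit_tangents g x"
abbreviation ray :: "real \<times> (real^'n) \<Rightarrow> real \<Rightarrow> real \<times> (real^'n)" where "ray \<equiv> geodesic g x"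

definition cross :: "real \<Rightarrow> (real \<times> (real^'n)) set \<Rightarrow> real \<times> (real^'n) \<Rightarrow> real" where
  "cross e K v = crossing_param g x (boundary e K) v"

lemma cross:
  assumes e: "e \<in> {e1, e2}" and K: "K \<in> shells"
  shows "continuous_on U (cross e K)"
    and "v \<in> U \<Longrightarrow> cross e K v \<in> shortest_range g"
    and "v \<in> U \<Longrightarrow> t \<in> shortest_range g \<Longrightarrow> ray v t \<in> boundary e K \<longleftrightarrow> t = cross e K v"
    and "v \<in> U \<Longrightarrow> t \<in> shortest_range g \<Longrightarrow> ray v t \<in> K \<and> p (ray v t) = e \<longleftrightarrow> t = cross e K v"
proof -
  note cc = component_crossing[OF x_level[OF e] boundary(1)[OF e K]]
  have [simp]: "cross e K = crossing_param g x (boundary e K)" by (auto simp: cross_def)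
  show "continuous_on U (cross e K)" using cc(1) by simp
  show "v \<in> U \<Longrightarrow> cross e K v \<in> shortest_range g" using cc(2) by simp
  show 3: "v \<in> U \<Longrightarrow> t \<in> shortest_range g \<Longrightarrow> ray v t \<in> boundary e K \<longleftrightarrow> t = cross e K v" using cc(3) by simp
  have "boundary e K \<subseteq> level_set g p e" using boundary(1)[OF e K] in_components_subset by blast
  then show "v \<in> U \<Longrightarrow> t \<in> shortest_range g \<Longrightarrow> ray v t \<in> K \<and> p (ray v t) = e \<longleftrightarrow> t = cross e K v"
    using 3 boundary_iff[OF e K, of "ray v t"] boundary(2)[OF e K] by (auto simp: level_set_def)
qed

lemma cross_neq:
  assumes K: "K \<in> shells" and v: "v \<in> U"
  shows "cross e1 K v \<noteq> cross e2 K v"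
  using cross(4)[OF _ K v cross(2)[OF _ K v], of e1 e1] cross(4)[OF _ K v cross(2)[OF _ K v], of e2 e2] e1_less_e2
  by auto

lemma ray_segment_in_component:
  assumes K: "K \<in> shells" and v: "v \<in> U"
    and s: "ray v s \<in> K" and seg: "\<And>r. r \<in> closed_segment s t \<Longrightarrow> e1 \<le> p (ray v r) \<and> p (ray v r) \<le> e2"
  shows "ray v t \<in> K"
proof -
  have "ray v ` closed_segment s t \<subseteq> K"
  proof (rule components_maximal[OF K])
    show "connected (ray v ` closed_segment s t)"
      by (intro connected_continuous_image continuous_intros) auto
    show "ray v ` closed_segment s t \<subseteq> shell g p e1 e2"
      using seg geodesic_in_model[OF x_model v] by (auto simp: shell_def)
    show "K \<inter> ray v ` closed_segment s t \<noteq> {}" using s by auto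
  qed
  then show ?thesis by auto
qed

text \<open>Away from its two crossings a ray cannot enter or leave \<open>K\<close>: the set of
  parameters in \<open>K\<close> is closed because \<open>K\<close> is, and open because there
  \<open>p\<close> lies strictly between \<open>e1\<close> and \<open>e2\<close>.\<close>

lemma ray_dichotomy:
  assumes K: "K \<in> shells" and v: "v \<in> U"
    and J: "connected J" "J \<subseteq> shortest_range g" "cross e1 K v \<notin> J" "cross e2 K v \<notin> J"
    and st: "s \<in> J" "t \<in> J" "ray v s \<in> K"
  shows "ray v t \<in> K"
proof -
  let ?Z = "J \<inter> ray v -` K"
  have cont: "continuous_on J (ray v)" by (intro continuous_intros)
  have "closedin (top_of_set J) ?Z"
    using continuous_closedin_preimage[OF cont closed_shell_component[OF K]] .
  moreover have "openin (top_of_set J) ?Z"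
    unfolding openin_euclidean_subtopology_iff
  proof (intro conjI ballI)
    fix r assume r: "r \<in> ?Z"
    then have rJ: "r \<in> shortest_range g" "r \<noteq> cross e1 K v" "r \<noteq> cross e2 K v" using J by auto
    have "ray v r \<in> shell g p e1 e2" using r K in_components_subset by blast
    then have bounds: "e1 < p (ray v r)" "p (ray v r) < e2"
      using r rJ cross(4)[OF _ K v rJ(1)] by (auto simp: shell_def order_le_less)
    have "isCont (\<lambda>t. p (ray v t)) r"
      by (rule continuous_on_interior[of UNIV]) (auto intro!: continuous_intros)
    then have lim: "((\<lambda>t. p (ray v t)) \<longlongrightarrow> p (ray v r)) (nhds r)"
      unfolding isCont_def tendsto_at_iff_tendsto_nhds[of "\<lambda>t. p (ray v t)"] .
    have "\<forall>\<^sub>F t in nhds r. e1 < p (ray v t)" "\<forall>\<^sub>F t in nhds r. p (ray v t) < e2"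
      using order_tendstoD[OF lim] bounds by auto
    then have "\<forall>\<^sub>F t in nhds r. e1 < p (ray v t) \<and> p (ray v t) < e2" by (rule eventually_conj)
    then obtain \<delta> where \<delta>: "\<delta> > 0" "\<And>t. dist t r < \<delta> \<Longrightarrow> e1 < p (ray v t) \<and> p (ray v t) < e2"
      unfolding eventually_nhds_metric by blast
    have "ray v t \<in> K" if "dist t r < \<delta>" for t
    proof (rule ray_segment_in_component[OF K v, of r])
      show "ray v r \<in> K" using r by simp
      fix q assume "q \<in> closed_segment r t"
      then have "dist q r \<le> dist t r"
        by (auto simp: closed_segment_eq_real_ivl dist_real_def split: if_splits)
      then show "e1 \<le> p (ray v q) \<and> p (ray v q) \<le> e2" using \<delta>(2)[of q] that by auto
    qed
    then show "\<exists>e>0. \<forall>t\<in>J. dist t r < e \<longrightarrow> t \<in> ?Z" using \<delta>(1) by auto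
  qed simp
  ultimately have "?Z = J" using J(1) st unfolding connected_clopen by blast
  then show ?thesis using st by blast
qed

text \<open>The crossing is transversal, and the values of \<open>p\<close> on the two bounding
  levels differ by \<open>e2 - e1\<close>, so near the crossing \<open>p\<close> is within the
  bounds on exactly one side.\<close>

lemma crossing_one_side:
  assumes e: "e \<in> {e1, e2}" and K: "K \<in> shells" and v: "v \<in> U"
  shows "\<exists>\<delta>>0. \<forall>h>0. h < \<delta> \<longrightarrow> (ray v (cross e K v - h) \<in> K \<longleftrightarrow> ray v (cross e K v + h) \<notin> K)"
proof -
  define a where "a = cross e K v"
  have a: "ray v a \<in> K" "p (ray v a) = e"
    using cross(4)[OF e K v cross(2)[OF e K v]] by (auto simp: a_def)
  let ?f = "\<lambda>t. p (ray v t)"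
  obtain D where D: "D \<noteq> 0" "(?f has_real_derivative D) (at a)"
    using level_simple_crossing[OF x_level[OF e] v a(2)] by blast
  obtain \<delta>1 where \<delta>1: "\<delta>1 > 0" "\<And>h. h > 0 \<Longrightarrow> h < \<delta>1 \<Longrightarrow> D * (?f (a + h) - e) > 0 \<and> D * (?f (a - h) - e) < 0"
    using real_derivative_sides[OF D(2,1)] a(2) by auto
  have "isCont ?f a" by (rule continuous_on_interior[of UNIV]) (auto intro!: continuous_intros)
  then have lim: "(?f \<longlongrightarrow> ?f a) (nhds a)"
    unfolding isCont_def tendsto_at_iff_tendsto_nhds[of ?f] .
  have "\<forall>\<^sub>F t in nhds a. dist (?f t) e < e2 - e1"
    using tendstoD[OF lim, of "e2 - e1"] e1_less_e2 a(2) by simp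
  then obtain \<delta>2 where \<delta>2: "\<delta>2 > 0" "\<And>t. dist t a < \<delta>2 \<Longrightarrow> dist (?f t) e < e2 - e1"
    unfolding eventually_nhds_metric by blast
  \<comment> \<open>The sign of \<open>m\<close> tells on which side of the crossing the shell lies:
    where \<open>p\<close> is larger at level \<open>e1\<close>, where it is smaller at level
    \<open>e2\<close>.\<close>
  define m where "m = (if e = e1 then D else - D)"
  have m: "m \<noteq> 0" using D(1) by (simp add: m_def)
  have band: "e1 \<le> ?f (a + s) \<and> ?f (a + s) \<le> e2 \<longleftrightarrow> m * s > 0" if s: "s \<noteq> 0" "\<bar>s\<bar> < min \<delta>1 \<delta>2" for s
  proof -
    have near: "\<bar>?f (a + s) - e\<bar> < e2 - e1" using \<delta>2(2)[of "a + s"] s by (simp add: dist_real_def)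
    have eq: "D * s * (?f (a + s) - e) = s * (D * (?f (a + s) - e))" by simp
    have sgn: "D * s * (?f (a + s) - e) > 0"
    proof (cases "s > 0")
      case True
      then show ?thesis unfolding eq using \<delta>1(2)[of s] s by (intro mult_pos_pos[of s]) auto
    next
      case False
      then have "s < 0" using s by simp
      then show ?thesis unfolding eq using \<delta>1(2)[of "- s"] s by (intro mult_neg_neg[of s]) auto
    qed
    have "A * B > 0 \<Longrightarrow> (A > 0 \<longleftrightarrow> B > 0) \<and> (A < 0 \<longleftrightarrow> B < 0)" for A B :: real
      by (auto simp: zero_less_mult_iff)
    from this[OF sgn] show ?thesis
      using near e s(1) D(1) by (cases "e = e1") (auto simp: m_def abs_less_iff)
  qed
  have in_K: "ray v (a + s) \<in> K \<longleftrightarrow> m * s > 0" if s: "s \<noteq> 0" "\<bar>s\<bar> < min \<delta>1 \<delta>2" for s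
  proof
    assume "ray v (a + s) \<in> K"
    then show "m * s > 0" using band[OF s] K in_components_subset by (fastforce simp: shell_def)
  next
    assume pos: "m * s > 0"
    show "ray v (a + s) \<in> K"
    proof (rule ray_segment_in_component[OF K v a(1)])
      fix q assume q: "q \<in> closed_segment a (a + s)"
      show "e1 \<le> ?f q \<and> ?f q \<le> e2"
      proof (cases "q = a")
        case True
        then show ?thesis using a(2) e e1_less_e2 by auto
      next
        case False
        then have "q - a \<noteq> 0" "\<bar>q - a\<bar> < min \<delta>1 \<delta>2" "m * (q - a) > 0"
          using q s pos by (auto simp: closed_segment_eq_real_ivl zero_less_mult_iff split: if_splits)
        then show ?thesis using band[of "q - a"] by simp
      qed
    qed
  qed
  show ?thesis
  proof (intro exI conjI allI impI)
    show "min \<delta>1 \<delta>2 > 0" using \<delta>1(1) \<delta>2(1) by simp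
    fix h :: real assume h: "h > 0" "h < min \<delta>1 \<delta>2"
    show "ray v (cross e K v - h) \<in> K \<longleftrightarrow> ray v (cross e K v + h) \<notin> K"
      using in_K[of "- h"] in_K[of h] h m unfolding a_def[symmetric]
      by (auto simp: zero_less_mult_iff mult_less_0_iff)
  qed
qed

text \<open>The two crossings cut the ray into three intervals on which membership in
  \<open>K\<close> is constant, and it flips at each crossing. Only two alternating patterns
  remain.\<close>

lemma ray_inside_or_outside:
  assumes K: "K \<in> shells" and v: "v \<in> U"
  defines "l \<equiv> min (cross e1 K v) (cross e2 K v)" and "u \<equiv> max (cross e1 K v) (cross e2 K v)"
  shows "(\<forall>t\<in>shortest_range g. ray v t \<in> K \<longleftrightarrow> l \<le> t \<and> t \<le> u) \<or>
         (\<forall>t\<in>shortest_range g. ray v t \<in> K \<longleftrightarrow> t \<le> l \<or> u \<le> t)"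
proof -
  let ?I = "shortest_range g"
  have I: "cross e1 K v \<in> ?I" "cross e2 K v \<in> ?I" using cross(2)[OF _ K v] by auto
  have I_ivl: "t \<in> ?I" if "l' \<in> ?I" "u' \<in> ?I" "l' \<le> t" "t \<le> u'" for l' u' t
    using that by (cases g) auto
  have lu: "l < u" "l \<in> ?I" "u \<in> ?I" "l > 0"
    using cross_neq[OF K v] I shortest_range_facts(2) by (auto simp: l_def u_def min_def max_def)
  have ends: "\<exists>e\<in>{e1, e2}. l = cross e K v" "\<exists>e\<in>{e1, e2}. u = cross e K v"
    by (auto simp: l_def u_def min_def max_def)
  have lK: "ray v l \<in> K" "ray v u \<in> K"
    using ends cross(4)[OF _ K v cross(2)[OF _ K v]] by auto
  have dichotomy: "ray v s \<in> K \<longleftrightarrow> ray v t \<in> K"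
    if J: "connected J" "J \<subseteq> ?I" "l \<notin> J" "u \<notin> J" "s \<in> J" "t \<in> J" for J s t
  proof -
    have "cross e1 K v \<notin> J" "cross e2 K v \<notin> J"
      using J(3,4) unfolding l_def u_def by (auto simp: min_def max_def split: if_splits)
    then show ?thesis using ray_dichotomy[OF K v J(1,2)] J(5,6) by blast
  qed
  have in1: "ray v s \<in> K \<longleftrightarrow> ray v t \<in> K" if "0 < s" "s < l" "0 < t" "t < l" for s t
  proof -
    have sub: "{0<..<l} \<subseteq> ?I" using lu(2) by (cases g) auto
    show ?thesis using that lu(1) by (intro dichotomy[OF _ sub]) auto
  qed
  have in2: "ray v s \<in> K \<longleftrightarrow> ray v t \<in> K" if "l < s" "s < u" "l < t" "t < u" for s t
  proof -
    have sub: "{l<..<u} \<subseteq> ?I" using I_ivl[OF lu(2,3)] by auto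
    show ?thesis using that lu(1) by (intro dichotomy[OF _ sub]) auto
  qed
  have in3: "ray v s \<in> K \<longleftrightarrow> ray v t \<in> K" if "u < s" "s \<in> ?I" "u < t" "t \<in> ?I" for s t
  proof -
    have sub: "{u<..} \<inter> ?I \<subseteq> ?I" by auto
    have conn: "connected ({u<..} \<inter> ?I)"
      by (intro convex_connected convex_Int) (cases g; simp)+
    show ?thesis using that lu(1) by (intro dichotomy[OF conn sub]) auto
  qed
  obtain \<delta>l where \<delta>l: "\<delta>l > 0" "\<And>h. h > 0 \<Longrightarrow> h < \<delta>l \<Longrightarrow> ray v (l - h) \<in> K \<longleftrightarrow> ray v (l + h) \<notin> K"
    using ends(1) crossing_one_side[OF _ K v] by auto
  obtain \<delta>u where \<delta>u: "\<delta>u > 0" "\<And>h. h > 0 \<Longrightarrow> h < \<delta>u \<Longrightarrow> ray v (u - h) \<in> K \<longleftrightarrow> ray v (u + h) \<notin> K"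
    using ends(2) crossing_one_side[OF _ K v] by auto
  obtain r where r: "r > 0" "\<And>s. \<bar>s - u\<bar> < r \<Longrightarrow> s \<in> ?I"
    using shortest_range_facts(1)[of g] lu(3) unfolding open_dist dist_real_def by blast
  define h where "h = min (min \<delta>l \<delta>u) (min r (min l (u - l))) / 2"
  have h: "0 < h" "h < \<delta>l" "h < \<delta>u" "h < r" "h < l" "h < u - l"
    using \<delta>l(1) \<delta>u(1) r(1) lu by (auto simp: h_def min_def)
  have hI: "u + h \<in> ?I" using r(2)[of "u + h"] h by simp
  note L = \<delta>l(2)[OF h(1,2)] and R = \<delta>u(2)[OF h(1,3)]
  have mid: "ray v (l + h) \<in> K \<longleftrightarrow> ray v (u - h) \<in> K" using in2[of "l + h" "u - h"] h by auto
  have first: "ray v t \<in> K \<longleftrightarrow> ray v (l - h) \<in> K" if "0 < t" "t < l" for t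
    using in1[of t "l - h"] that h by auto
  have second: "ray v t \<in> K \<longleftrightarrow> ray v (l + h) \<in> K" if "l < t" "t < u" for t
    using in2[of t "l + h"] that h by auto
  have third: "ray v t \<in> K \<longleftrightarrow> ray v (u + h) \<in> K" if "u < t" "t \<in> ?I" for t
    using in3[of t "u + h"] that h hI by auto
  show ?thesis
  proof (cases "ray v (l + h) \<in> K")
    case True
    have "ray v t \<in> K \<longleftrightarrow> l \<le> t \<and> t \<le> u" if "t \<in> ?I" for t
      using first[of t] second[of t] third[of t] that True L R mid lK shortest_range_facts(2)[OF that]
      by (metis less_irrefl linorder_neqE_linordered_idom not_le order_le_less)
    then show ?thesis by blast
  next
    case False
    have "ray v t \<in> K \<longleftrightarrow> t \<le> l \<or> u \<le> t" if "t \<in> ?I" for t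
      using first[of t] second[of t] third[of t] that False L R mid lK shortest_range_facts(2)[OF that]
      by (metis less_irrefl linorder_neqE_linordered_idom not_le order_le_less)
    then show ?thesis by blast
  qed
qed

end

lemma connected_order_constant:
  fixes f h :: "'a::topological_space \<Rightarrow> real"
  assumes "connected S" "continuous_on S f" "continuous_on S h"
    and neq: "\<And>v. v \<in> S \<Longrightarrow> f v \<noteq> h v" and vw: "v \<in> S" "w \<in> S" and less: "f v < h v"
  shows "f w < h w"
proof (rule ccontr)
  assume "\<not> f w < h w"
  then have "h w < f w" using neq[OF vw(2)] by simp
  have "connected ((\<lambda>v. f v - h v) ` S)"
    by (intro connected_continuous_image continuous_intros assms)
  note ivl = this[unfolded connected_iff_interval, rule_format]
  have "0 \<in> (\<lambda>v. f v - h v) ` S"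
    by (rule ivl[of "f v - h v" "f w - h w"]) (use vw less \<open>h w < f w\<close> in auto)
  then show False using neq by auto
qed

context layer_at
begin

lemma connected_U: "connected U" and compact_U: "compact U"
  using connected_unit_tangents[OF x_model dimension] compact_unit_tangents[OF x_model] by auto

text \<open>Excludes the pattern in which \<open>K\<close> lies outside the two crossings. In the
  hyperbolic case \<open>K\<close> would contain the end of a ray, where \<open>p\<close> is
  unbounded. In the spherical case the pattern is the same in all directions, and \<open>K\<close>
  would be covered by two disjoint closed caps around \<open>x\<close> and \<open>- x\<close>, both
  of which it meets.\<close>

lemma shell_component_inside:
  assumes K: "K \<in> shells" and v: "v \<in> U" and t: "t \<in> shortest_range g"
  shows "ray v t \<in> K \<longleftrightarrow> min (cross e1 K v) (cross e2 K v) \<le> t \<and> t \<le> max (cross e1 K v) (cross e2 K v)"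
proof -
  let ?I = "shortest_range g"
  define l u where "l v = min (cross e1 K v) (cross e2 K v)" and "u v = max (cross e1 K v) (cross e2 K v)" for v
  have cont: "continuous_on U l" "continuous_on U u"
    unfolding l_def u_def by (intro continuous_intros cross(1)[OF _ K]; simp)+
  have I: "l v \<in> ?I" "u v \<in> ?I" "l v < u v" "0 < l v" if "v \<in> U" for v
    using cross(2)[OF _ K that] cross_neq[OF K that] shortest_range_facts(2)
    by (auto simp: l_def u_def min_def max_def)
  have luK: "ray v (l v) \<in> K" "ray v (u v) \<in> K" if "v \<in> U" for v
    using cross(4)[OF _ K that cross(2)[OF _ K that]] by (auto simp: l_def u_def min_def max_def)
  define outside where "outside v \<longleftrightarrow> (\<forall>t\<in>?I. ray v t \<in> K \<longleftrightarrow> t \<le> l v \<or> u v \<le> t)" for v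
  define inside where "inside v \<longleftrightarrow> (\<forall>t\<in>?I. ray v t \<in> K \<longleftrightarrow> l v \<le> t \<and> t \<le> u v)" for v
  have either: "inside v \<or> outside v" if "v \<in> U" for v
    using ray_inside_or_outside[OF K that] by (simp add: inside_def outside_def l_def u_def)
  \<comment> \<open>Test points, one between the crossings and one before them. Each pattern is
    decided by membership of one of them in the closed set \<open>K\<close>, so both patterns are
    closed conditions on \<open>v\<close>.\<close>
  have half: "l v / 2 \<in> ?I" "(l v + u v) / 2 \<in> ?I" if "v \<in> U" for v
    using I[OF that] by (cases g; auto)+
  have inside_iff: "inside v \<longleftrightarrow> ray v ((l v + u v) / 2) \<in> K" "outside v \<longleftrightarrow> ray v (l v / 2) \<in> K"
    "\<not> (inside v \<and> outside v)" if "v \<in> U" for v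
  proof -
    have "inside v \<Longrightarrow> ray v ((l v + u v) / 2) \<in> K" "inside v \<Longrightarrow> ray v (l v / 2) \<notin> K"
      using half[OF that] I[OF that] by (auto simp: inside_def)
    moreover have "outside v \<Longrightarrow> ray v ((l v + u v) / 2) \<notin> K" "outside v \<Longrightarrow> ray v (l v / 2) \<in> K"
      using half[OF that] I[OF that] by (auto simp: outside_def)
    ultimately show "inside v \<longleftrightarrow> ray v ((l v + u v) / 2) \<in> K" "outside v \<longleftrightarrow> ray v (l v / 2) \<in> K"
      "\<not> (inside v \<and> outside v)" using either[OF that] by blast+
  qed
  have "\<not> outside v"
  proof
    assume out: "outside v"
    show False
    proof (cases g)
      case Hyperbolic
      obtain t where t: "t \<ge> u v" "\<bar>p (ray v t)\<bar> > max \<bar>e1\<bar> \<bar>e2\<bar>"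
        using hyperbolic_level_unbounded[OF x_level[of e1] v Hyperbolic] by blast
      then have "t \<in> ?I" using I[OF v] Hyperbolic by auto
      then have "ray v t \<in> K" using t out by (auto simp: outside_def)
      then have "ray v t \<in> shell g p e1 e2" using K in_components_subset by blast
      then show False using t(2) by (auto simp: shell_def)
    next
      case Spherical
      have closedin: "closedin (top_of_set U) (U \<inter> (\<lambda>v. ray v (f v)) -` K)" if "continuous_on U f" for f
        by (intro continuous_closedin_preimage closed_shell_component K continuous_intros that)
      have "closedin (top_of_set U) (U \<inter> {v. inside v})"
      proof -
        have "U \<inter> {v. inside v} = U \<inter> (\<lambda>v. ray v ((l v + u v) / 2)) -` K" using inside_iff(1) by auto
        then show ?thesis using closedin[of "\<lambda>v. (l v + u v) / 2"] by (simp add: continuous_intros cont)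
      qed
      moreover have "closedin (top_of_set U) (U \<inter> {v. outside v})"
      proof -
        have "U \<inter> {v. outside v} = U \<inter> (\<lambda>v. ray v (l v / 2)) -` K" using inside_iff(2) by auto
        then show ?thesis using closedin[of "\<lambda>v. l v / 2"] by (simp add: continuous_intros cont)
      qed
      moreover have "U \<subseteq> U \<inter> {v. inside v} \<union> U \<inter> {v. outside v}" using either by blast
      moreover have "(U \<inter> {v. inside v}) \<inter> (U \<inter> {v. outside v}) = {}" using inside_iff(3) by blast
      moreover have "U \<inter> {v. outside v} \<noteq> {}" using v out by blast
      ultimately have "U \<inter> {v. inside v} = {}"
        using connected_U unfolding connected_closedin_eq by blast
      then have all_out: "outside w" if "w \<in> U" for w using either[OF that] that by blast
      \<comment> \<open>The caps up to the first crossing and from the second one on. The factor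
        \<open>s\<close> fills them from a compact parameter set, which makes them closed;
        \<open>s = 0\<close> gives the poles \<open>x\<close> and \<open>- x\<close>.\<close>
      let ?T1 = "(\<lambda>(w, s). ray w (s * l w)) ` (U \<times> {0..1})"
      let ?T2 = "(\<lambda>(w, s). ray w (pi - s * (pi - u w))) ` (U \<times> {0..1})"
      have compact: "compact ((\<lambda>(w, s). ray w (f w s)) ` (U \<times> {0..1}))"
        if "continuous_on (U \<times> {0..1::real}) (\<lambda>z. f (fst z) (snd z))" for f
        unfolding case_prod_beta
        by (intro compact_continuous_image compact_Times compact_U compact_Icc continuous_intros that)
      have contU: "continuous_on (U \<times> {0..1::real}) (\<lambda>z. h (fst z))" if "continuous_on U h" for h :: "_ \<Rightarrow> real"
        by (rule continuous_on_compose2[OF that continuous_on_fst[OF continuous_on_id]]) auto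
      have cl: "closed ?T1" "closed ?T2"
        by (intro compact_imp_closed compact continuous_intros contU cont)+
      have range: "0 \<le> s * l w" "s * l w \<le> l w" "u w \<le> pi - s * (pi - u w)" "pi - s * (pi - u w) \<le> pi"
        if "w \<in> U" "s \<in> {0..1}" for w s
      proof -
        have "u w < pi" "l w > 0" using I[OF that(1)] Spherical by auto
        then show "0 \<le> s * l w" "s * l w \<le> l w" "pi - s * (pi - u w) \<le> pi"
          using that by (auto simp: mult_left_le_one_le)
        have "s * (pi - u w) \<le> 1 * (pi - u w)" using that \<open>u w < pi\<close> by (intro mult_right_mono) auto
        then show "u w \<le> pi - s * (pi - u w)" by simp
      qed
      have "K \<subseteq> ?T1 \<union> ?T2"
      proof
        fix y assume y: "y \<in> K"
        obtain w0 where w0: "w0 \<in> U" using v by blast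
        have ym: "y \<in> model g" using y K in_components_subset by (force simp: shell_def)
        consider "y = x" | "y = - x" | "y \<noteq> x" "y \<noteq> - x" by blast
        then show "y \<in> ?T1 \<union> ?T2"
        proof cases
          case 1
          then have "y = ray w0 (0 * l w0)" by (simp add: geodesic_def)
          then show ?thesis using w0 by force
        next
          case 2
          then have "y = ray w0 (pi - 0 * (pi - u w0))" by (simp add: geodesic_def Spherical)
          then show ?thesis using w0 by force
        next
          case 3
          then obtain t w where tw: "t \<in> ?I" "w \<in> U" "y = ray w t"
            using ex_geodesic[OF x_model ym] by blast
          then have "t \<le> l w \<or> u w \<le> t" using all_out[OF tw(2)] y by (auto simp: outside_def)
          then show ?thesis
          proof
            assume "t \<le> l w"
            then have "t / l w \<in> {0..1}" "y = ray w ((t / l w) * l w)"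
              using tw I[OF tw(2)] shortest_range_facts(2)[OF tw(1)] by auto
            then show ?thesis using tw(2) by (force intro!: image_eqI[of _ _ "(w, t / l w)"])
          next
            assume ut: "u w \<le> t"
            have "u w < pi" "t < pi" using I[OF tw(2)] tw(1) Spherical by auto
            then have "(pi - t) / (pi - u w) \<in> {0..1}" using ut by (auto simp: field_simps)
            moreover have "pi - (pi - t) / (pi - u w) * (pi - u w) = t" using \<open>u w < pi\<close> by simp
            then have "y = ray w (pi - (pi - t) / (pi - u w) * (pi - u w))" using tw(3) by simp
            ultimately show ?thesis using tw(2) by (force intro!: image_eqI[of _ _ "(w, (pi - t) / (pi - u w))"])
          qed
        qed
      qed
      moreover have "?T1 \<inter> ?T2 = {}"
      proof (rule ccontr)
        assume "?T1 \<inter> ?T2 \<noteq> {}"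
        then obtain y where "y \<in> ?T1" "y \<in> ?T2" by blast
        then obtain w s w' s' where *: "w \<in> U" "s \<in> {0..1}" "w' \<in> U" "s' \<in> {0..1}"
          "y = ray w (s * l w)" "y = ray w' (pi - s' * (pi - u w'))" by auto
        define t t' where "t = s * l w" and "t' = pi - s' * (pi - u w')"
        have eq: "ray w t = ray w' t'" using * by (simp add: t_def t'_def)
        have b: "0 \<le> t" "t \<le> l w" "u w' \<le> t'" "t' \<le> pi"
          using range[OF *(1,2)] range[OF *(3,4)] by (auto simp: t_def t'_def)
        have b': "l w < pi" "0 < u w'" using I[OF *(1)] I[OF *(3)] Spherical by auto
        have "gsign g * gcos g t = gsign g * gcos g t'"
          using ambient_form_geodesic(1)[OF x_model *(1), of t] ambient_form_geodesic(1)[OF x_model *(3), of t']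
          unfolding eq by simp
        then have "cos t = cos t'" using Spherical by (simp add: gsign_def)
        moreover have "t \<le> pi" "0 \<le> t'" using b b' by linarith+
        ultimately have "t = t'" using cos_inj_pi b by blast
        then have tI: "t \<in> ?I" using b b' Spherical by auto
        then have "w = w'" using geodesic_inj[OF x_model *(1,3) tI] eq \<open>t = t'\<close> by auto
        then show False using b \<open>t = t'\<close> I[OF *(1)] by auto
      qed
      moreover have "?T1 \<inter> K \<noteq> {}" "?T2 \<inter> K \<noteq> {}"
      proof -
        have "ray v (1 * l v) \<in> ?T1" using v by (intro image_eqI[of _ _ "(v, 1)"]) auto
        moreover have "ray v (pi - 1 * (pi - u v)) \<in> ?T2"
          using v by (intro image_eqI[of _ _ "(v, 1)"]) auto
        ultimately show "?T1 \<inter> K \<noteq> {}" "?T2 \<inter> K \<noteq> {}" using luK[OF v] by auto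
      qed
      ultimately show False
        using connected_closedD[OF in_components_connected[OF K], of ?T1 ?T2] cl by blast
    qed
  qed
  then have "inside v" using either[OF v] by blast
  then show ?thesis using t by (simp add: inside_def l_def u_def)
qed

lemma finite_shell_components: "finite (shells)"
proof -
  obtain v where v: "v \<in> U" using unit_tangents_nonempty[OF x_model] by blast
  have "finite (components (level_set g p e1))"
    using components_crossings_bij[OF x_level v, of e1] finite_crossings(1)[OF x_level v, of e1]
    by (simp add: bij_betw_finite)
  then show ?thesis using boundary_bij[of e1] by (simp add: bij_betw_finite)
qed

lemma cross_bij:
  assumes e: "e \<in> {e1, e2}" and v: "v \<in> U"
  shows "bij_betw (\<lambda>K. cross e K v) (shells) (crossings g p x e v)"
  using bij_betw_trans[OF boundary_bij[OF e] components_crossings_bij[OF x_level[OF e] v]]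
  by (simp add: comp_def cross_def)

lemma cross_sum:
  assumes e: "e \<in> {e1, e2}" and v: "v \<in> U"
  shows "(\<Sum>K\<in>shells. cross e K v) = \<Sum>(crossings g p x e v)"
  using sum.reindex_bij_betw[OF cross_bij[OF e v], of "\<lambda>t. t"] .

text \<open>Distinct boundary spheres are disjoint, so two crossing parameters never coincide, and
  the directions form a connected set. Applied to the two boundaries of one component, this makes
  the sign of its charge independent of the direction.\<close>

lemma cross_order_constant:
  assumes e: "e \<in> {e1, e2}" "e' \<in> {e1, e2}"
    and K: "K \<in> shells" "K' \<in> shells"
    and ne: "(e, K) \<noteq> (e', K')" and vw: "v \<in> U" "w \<in> U"
    and less: "cross e K v < cross e' K' v"
  shows "cross e K w < cross e' K' w"
proof (rule connected_order_constant[OF connected_U cross(1)[OF e(1) K(1)] cross(1)[OF e(2) K(2)] _ vw less])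
  fix v assume v: "v \<in> U"
  show "cross e K v \<noteq> cross e' K' v"
  proof
    assume eq: "cross e K v = cross e' K' v"
    then have "ray v (cross e K v) \<in> K \<and> p (ray v (cross e K v)) = e"
      "ray v (cross e K v) \<in> K' \<and> p (ray v (cross e K v)) = e'"
      using cross(4)[OF e(1) K(1) v cross(2)[OF e(1) K(1) v]] cross(4)[OF e(2) K(2) v cross(2)[OF e(2) K(2) v]] by auto
    then have "e = e'" "K \<inter> K' \<noteq> {}" by auto
    then show False using components_eq[OF K] ne by simp
  qed
qed

text \<open>
  In the spherical case the product of the crossings fixes their sum only modulo \<open>2 * pi\<close>; the
  ambiguity disappears because the defect is an odd continuous function on a connected set.
\<close>

lemma cross_sum_balance:
  assumes v: "v \<in> U"
  defines "S \<equiv> \<lambda>v. \<Sum>K\<in>shells. cross e2 K v - cross e1 K v"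
  shows "S v = S (- v)"
proof -
  define F where "F v = S v - S (- v)" for v
  let ?c = "\<lambda>e v. \<Sum>(crossings g p x e v)"
  define m :: real where "m = (if g = Spherical then 1 else 2)"
  have F: "F w = (?c e2 w - ?c e2 (- w)) - (?c e1 w - ?c e1 (- w))" if "w \<in> U" for w
    using cross_sum[OF _ that] cross_sum[OF _ uminus_unit_tangents[OF x_model that]]
    by (simp add: F_def S_def sum_subtractf)
  have gexp_diff: "gexp g a = gexp g b \<Longrightarrow> gexp g (a - b) = 1" for a b
    by (simp add: gexp_def algebra_simps exp_diff)
  have one: "gexp g (m * F w) = 1" if "w \<in> U" for w
    unfolding F[OF that] right_diff_distrib[of m "_ - _" "_ - _"]
    using crossing_sums_gexp[OF x_level[of e2] x_level[of e1] that] by (intro gexp_diff) (simp add: m_def)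
  have "F v = 0"
  proof (cases g)
    case Hyperbolic
    have "gexp g (m * F v) = gexp g 0" using one[OF v] by (simp add: gexp_def)
    then have "m * F v = 0" by (rule gexp_inj) (use Hyperbolic in simp)
    then show ?thesis by (simp add: m_def Hyperbolic)
  next
    case Spherical
    have cos: "cos (F w) = 1" if "w \<in> U" for w
      using one[OF that] gexp_eq_iff[of g "m * F w" 0] by (simp add: m_def Spherical gexp_def)
    have cont: "continuous_on U S"
      unfolding S_def by (intro continuous_intros cross(1)) auto
    have "continuous_on U (\<lambda>v. S (- v))"
      by (rule continuous_on_compose2[OF cont continuous_on_minus[OF continuous_on_id]])
        (rule image_subsetI, rule uminus_unit_tangents[OF x_model])
    then have contF: "continuous_on U F" unfolding F_def by (intro continuous_intros cont)
    then obtain w where w: "w \<in> U" "F w = 0"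
      using odd_function_zero_unit_tangent[OF dimension x_model, of F] by (auto simp: F_def)
    show ?thesis
    proof (rule ccontr)
      assume nz: "F v \<noteq> 0"
      obtain k :: int where k: "F v = of_int k * 2 * pi" using cos[OF v] cos_one_2pi_int by blast
      then have "\<bar>F v\<bar> = \<bar>of_int k\<bar> * (2 * pi)" by (simp add: abs_mult)
      moreover have "\<bar>of_int k :: real\<bar> \<ge> 1" using nz k by (cases "k = 0") auto
      ultimately have big: "\<bar>F v\<bar> \<ge> 1 * (2 * pi)" by (metis mult_right_mono pi_ge_zero mult_nonneg_nonneg zero_le_numeral)
      have "connected (F ` U)" by (intro connected_continuous_image contF connected_U)
      note ivl = this[unfolded connected_iff_interval, rule_format]
      have FU: "0 \<in> F ` U" "F v \<in> F ` U" using w v by force+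
      \<comment> \<open>A value of modulus at least \<open>2 * pi\<close> together with the zero of
        \<open>F\<close> forces an intermediate value of modulus \<open>pi\<close>, where
        \<open>cos\<close> is \<open>- 1\<close>.\<close>
      have "pi \<in> F ` U \<or> - pi \<in> F ` U"
      proof (cases "F v \<ge> 0")
        case True
        then show ?thesis using ivl[OF FU(1) FU(2), of pi] big pi_gt_zero by auto
      next
        case False
        then show ?thesis using ivl[OF FU(2) FU(1), of "- pi"] big pi_gt_zero by auto
      qed
      then obtain w' where "w' \<in> U" "F w' = pi \<or> F w' = - pi" by auto
      then show False using cos[of w'] by auto
    qed
  qed
  then show ?thesis by (simp add: F_def)
qed

end

section \<open>Change of the base point\<close>

context layer_at
begin

text \<open>The definition quantifies over all directions; constancy of the order reduces it to
  one.\<close>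

lemma positively_charged_iff:
  assumes K: "K \<in> shells" and v: "v \<in> U"
  shows "positively_charged g p e1 e2 x K \<longleftrightarrow> cross e1 K v < cross e2 K v"
proof -
  have on: "t \<in> shortest_range g \<Longrightarrow> ray w t \<in> K \<inter> level_set g p e \<longleftrightarrow> t = cross e K w"
    if "e \<in> {e1, e2}" "w \<in> U" for e w t
    using cross(4)[OF that(1) K that(2)] geodesic_in_model[OF x_model that(2)] by (auto simp: level_set_def)
  have "positively_charged g p e1 e2 x K \<longleftrightarrow> (\<forall>w\<in>U. cross e1 K w < cross e2 K w)"
    unfolding positively_charged_def
    using on[of e1] on[of e2] cross(2)[OF _ K, of e1] cross(2)[OF _ K, of e2] by auto
  also have "\<dots> \<longleftrightarrow> cross e1 K v < cross e2 K v"
    using cross_order_constant[OF _ _ K K _ v, of e1 e2] v e1_less_e2 by auto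
  finally show ?thesis .
qed

lemma cross_eqI:
  assumes "e \<in> {e1, e2}" "K \<in> shells" "v \<in> U" "t \<in> shortest_range g"
    and "ray v t \<in> boundary e K"
  shows "cross e K v = t"
  using cross(3)[OF assms(1-4)] assms(5) by simp

end

text \<open>
  The crossing parameters seen from two points of the domain are compared along a common geodesic.
  In the spherical case, all the boundary spheres are crossed on the same side of the second point,
  since otherwise two of them would be crossed in different orders in opposite directions.
\<close>

lemma (in layer) crossing_order_change_base:
  assumes x: "x \<in> layer_hyperbolicity_domain g d p e1 e2"
    and y: "y \<in> layer_hyperbolicity_domain g d p e1 e2"
  defines "before z v K \<equiv> crossing_param g z (boundary e1 K) v < crossing_param g z (boundary e2 K) v"
  shows "\<exists>v\<in>unit_tangents g x. \<exists>w\<in>unit_tangents g y.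
    (\<forall>K\<in>shells. before y w K \<longleftrightarrow> before x v K) \<or>
    (\<forall>K\<in>shells. before y w K \<longleftrightarrow> \<not> before x v K)"
proof -
  interpret X: layer_at g p d e1 e2 x by unfold_locales (rule x)
  interpret Y: layer_at g p d e1 e2 y by unfold_locales (rule y)
  let ?I = "shortest_range g"
  have before: "before x v K \<longleftrightarrow> X.cross e1 K v < X.cross e2 K v"
    "before y w K \<longleftrightarrow> Y.cross e1 K w < Y.cross e2 K w" for v w K
    by (simp_all add: before_def X.cross_def Y.cross_def)
  have on_ray: "X.ray v (X.cross e K v) \<in> boundary e K" "X.cross e K v \<in> ?I"
    if "e \<in> {e1, e2}" "K \<in> shells" "v \<in> X.U" for e K v
    using X.cross(2,3)[OF that] by auto
  obtain v where v: "v \<in> X.U" using unit_tangents_nonempty[OF X.x_model] by blast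
  consider "y = x" | "y \<noteq> x" "y = - x" | "y \<noteq> x" "y \<noteq> - x" by blast
  then show ?thesis
  proof cases
    case 1
    then show ?thesis using v by blast
  next
    case 2
    have Spherical: "g = Spherical"
      using X.x_model Y.x_model 2 by (cases g) auto
    have vy: "v \<in> Y.U" using v 2 by (simp add: unit_tangents_def ambient_form_simps)
    \<comment> \<open>From the antipode the same half circle is traversed backwards, so every order
      is reversed.\<close>
    have ray: "Y.ray v (pi - t) = X.ray v t" for t
      by (simp add: geodesic_def Spherical 2)
    have "Y.cross e K v = pi - X.cross e K v" if "e \<in> {e1, e2}" "K \<in> shells" for e K
    proof (rule Y.cross_eqI[OF that vy])
      show "pi - X.cross e K v \<in> ?I" using on_ray(2)[OF that v] Spherical by auto
      show "Y.ray v (pi - X.cross e K v) \<in> boundary e K" unfolding ray by (rule on_ray(1)[OF that v])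
    qed
    then have "before y v K \<longleftrightarrow> \<not> before x v K" if "K \<in> shells" for K
      using that X.cross_neq[OF that v] by (auto simp: before)
    then show ?thesis using v vy by blast
  next
    case 3
    then obtain s v where s: "s \<in> ?I" and v: "v \<in> X.U" and y_eq: "y = X.ray v s"
      using ex_geodesic[OF X.x_model Y.x_model] by blast
    obtain w where w: "w \<in> Y.U" and fwd: "\<And>t. Y.ray w t = X.ray v (s + t)"
      and bwd: "\<And>t. Y.ray (- w) t = X.ray v (s - t)"
      using geodesic_rebase[OF X.x_model v, of s] unfolding y_eq by blast
    have w': "- w \<in> Y.U" by (rule uminus_unit_tangents[OF Y.x_model w])
    have v': "- v \<in> X.U" by (rule uminus_unit_tangents[OF X.x_model v])
    have I_diff: "b - a \<in> ?I" if "a \<in> ?I" "b \<in> ?I" "a < b" for a b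
      using that by (cases g) auto
    \<comment> \<open>Boundaries crossed beyond \<open>y\<close> are seen from \<open>y\<close>
      looking ahead, in unchanged order; those crossed before \<open>y\<close> are seen looking
      back, in reversed order.\<close>
    have later: "Y.cross e K w = X.cross e K v - s" if "e \<in> {e1, e2}" "K \<in> shells" "s < X.cross e K v" for e K
      using that on_ray[OF that(1,2) v] s by (intro Y.cross_eqI w I_diff) (auto simp: fwd)
    have earlier: "Y.cross e K (- w) = s - X.cross e K v" if "e \<in> {e1, e2}" "K \<in> shells" "X.cross e K v < s" for e K
      using that on_ray[OF that(1,2) v] s by (intro Y.cross_eqI w' I_diff) (auto simp: bwd)
    have avoid: "y \<notin> boundary e K \<and> (g = Spherical \<longrightarrow> - y \<notin> boundary e K)" if "e \<in> {e1, e2}" "K \<in> shells" for e K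
    proof -
      have "boundary e K \<subseteq> level_set g p e" using boundary(1)[OF that] in_components_subset by blast
      then show ?thesis
        using level_avoids_base[OF Y.x_level[OF that(1)]] by (auto simp: level_set_def)
    qed
    have neq: "X.cross e K v \<noteq> s" if "e \<in> {e1, e2}" "K \<in> shells" for e K
      using on_ray(1)[OF that v] avoid[OF that] y_eq by auto
    have behind: "X.ray v (- X.cross e K (- v)) \<in> boundary e K" if "e \<in> {e1, e2}" "K \<in> shells" for e K
      using on_ray(1)[OF that v'] by (simp add: geodesic_minus[OF X.x_model])
    \<comment> \<open>A boundary crossed before \<open>y\<close> already has its only crossing on
      the backward ray from \<open>y\<close>. Its crossing behind \<open>x\<close> would be a second
      one unless that ray ends first, at \<open>- y\<close>. In the hyperbolic case rays do not end,
      so nothing is crossed before \<open>y\<close>.\<close>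
    have early_back: "g = Spherical \<and> X.cross e K (- v) > pi - s"
      if eK: "e \<in> {e1, e2}" "K \<in> shells" and less: "X.cross e K v < s" for e K
    proof (rule ccontr)
      let ?m = "X.cross e K (- v)"
      assume *: "\<not> (g = Spherical \<and> ?m > pi - s)"
      have m: "?m \<in> ?I" "?m > 0" using on_ray(2)[OF eK v'] shortest_range_facts(2) by auto
      have "s + ?m \<in> ?I"
      proof (cases g)
        case Hyperbolic
        then show ?thesis using m s by auto
      next
        case Spherical
        have "?m \<noteq> pi - s"
        proof
          assume "?m = pi - s"
          then have "X.ray v (- ?m) = - y" by (simp add: y_eq geodesic_def Spherical)
          then show False using behind[OF eK] avoid[OF eK] Spherical by simp
        qed
        then show ?thesis using * m s Spherical by auto
      qed
      then have "Y.cross e K (- w) = s + ?m"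
        using behind[OF eK] by (intro Y.cross_eqI eK w') (simp_all add: bwd)
      then show False
        using earlier[OF eK less] m(2) shortest_range_facts(2)[OF on_ray(2)[OF eK v]] by simp
    qed
    \<comment> \<open>The mirror image: a crossing behind \<open>x\<close> and beyond
      \<open>- y\<close> would be reached from \<open>y\<close> in the forward direction at
      \<open>2 * pi - ?m - s\<close>, a second crossing besides the known one.\<close>
    have late_back: "X.cross e K (- v) < pi - s"
      if eK: "e \<in> {e1, e2}" "K \<in> shells" and less: "s < X.cross e K v" and Spherical: "g = Spherical" for e K
    proof (rule ccontr)
      let ?m = "X.cross e K (- v)"
      assume *: "\<not> ?m < pi - s"
      have m: "0 < ?m" "?m < pi" using on_ray(2)[OF eK v'] Spherical by auto
      have "?m \<noteq> pi - s"
      proof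
        assume "?m = pi - s"
        then have "X.ray v (- ?m) = - y" by (simp add: y_eq geodesic_def Spherical)
        then show False using behind[OF eK] avoid[OF eK] Spherical by simp
      qed
      then have "2 * pi - ?m - s \<in> ?I" using * m s Spherical by auto
      moreover have "X.ray v (s + (2 * pi - ?m - s)) = X.ray v (- ?m)"
        by (simp add: geodesic_def Spherical sin_diff cos_diff)
      then have "Y.ray w (2 * pi - ?m - s) \<in> boundary e K" unfolding fwd using behind[OF eK] by simp
      ultimately have "Y.cross e K w = 2 * pi - ?m - s" by (intro Y.cross_eqI eK w)
      then have "X.cross e K v = 2 * pi - ?m" using later[OF eK less] by simp
      then show False using on_ray(2)[OF eK v] Spherical m by auto
    qed
    have no_mixing: False
      if eK: "e \<in> {e1, e2}" "K \<in> shells" and eK': "e' \<in> {e1, e2}" "K' \<in> shells"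
        and "X.cross e K v < s" "s < X.cross e' K' v" for e e' K K'
    proof -
      have "X.cross e' K' (- v) < X.cross e K (- v)"
        using early_back[OF eK that(5)] late_back[OF eK' that(6)] by auto
      moreover have "X.cross e K (- v) < X.cross e' K' (- v)"
        using that by (intro X.cross_order_constant[OF _ _ _ _ _ v v']) auto
      ultimately show False by simp
    qed
    show ?thesis
    proof (cases "\<exists>e\<in>{e1, e2}. \<exists>K\<in>shells. X.cross e K v < s")
      case True
      then have "X.cross e K v < s" if "e \<in> {e1, e2}" "K \<in> shells" for e K
        using no_mixing[OF _ _ that] neq[OF that] by (meson linorder_neqE_linordered_idom)
      then have "before y (- w) K \<longleftrightarrow> \<not> before x v K" if "K \<in> shells" for K
        using that X.cross_neq[OF that v] earlier[of e1 K] earlier[of e2 K] by (auto simp: before)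
      then show ?thesis using v w' by blast
    next
      case False
      then have "s < X.cross e K v" if "e \<in> {e1, e2}" "K \<in> shells" for e K
        using neq[OF that] that by (meson linorder_neqE_linordered_idom)
      then have "before y w K \<longleftrightarrow> before x v K" if "K \<in> shells" for K
        using that later[of e1 K] later[of e2 K] by (auto simp: before)
      then show ?thesis using v w by blast
    qed
  qed
qed

text \<open>The charges are prescribed at \<open>y\<close>, the widths measured at \<open>x\<close>.
  By \<open>crossing_order_change_base\<close> every charged width is the same multiple
  \<open>\<sigma>\<close> of the oriented width, and the oriented widths balance by
  \<open>cross_sum_balance\<close>.\<close>

lemma (in layer_at) signed_widths_balance:
  fixes \<rho> :: real
  assumes y: "y \<in> layer_hyperbolicity_domain g d p e1 e2" and v: "v \<in> U"
  defines "S \<equiv> \<lambda>v. \<Sum>K\<in>shells.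
    (if positively_charged g p e1 e2 y K then \<rho> else - \<rho>) * \<bar>cross e2 K v - cross e1 K v\<bar>"
  shows "S v = S (- v)"
proof -
  interpret Y: layer_at g p d e1 e2 y by unfold_locales (rule y)
  obtain v0 w0 where v0: "v0 \<in> U" and w0: "w0 \<in> Y.U"
    and orders: "(\<forall>K\<in>shells. Y.cross e1 K w0 < Y.cross e2 K w0 \<longleftrightarrow> cross e1 K v0 < cross e2 K v0) \<or>
      (\<forall>K\<in>shells. Y.cross e1 K w0 < Y.cross e2 K w0 \<longleftrightarrow> \<not> cross e1 K v0 < cross e2 K v0)"
    using crossing_order_change_base[OF x y] unfolding cross_def Y.cross_def by blast
  have "positively_charged g p e1 e2 y K \<longleftrightarrow> Y.cross e1 K w0 < Y.cross e2 K w0" if "K \<in> shells" for K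
    using Y.positively_charged_iff[OF that w0] .
  moreover have "cross e1 K v < cross e2 K v \<longleftrightarrow> cross e1 K v0 < cross e2 K v0" if "K \<in> shells" "v \<in> U" for K v
    using positively_charged_iff[OF that] positively_charged_iff[OF that(1) v0] by simp
  ultimately have "(\<forall>K\<in>shells. \<forall>v\<in>U. positively_charged g p e1 e2 y K \<longleftrightarrow> cross e1 K v < cross e2 K v) \<or>
      (\<forall>K\<in>shells. \<forall>v\<in>U. positively_charged g p e1 e2 y K \<longleftrightarrow> \<not> cross e1 K v < cross e2 K v)"
    using orders by auto
  then obtain \<sigma> where \<sigma>: "\<And>K v. K \<in> shells \<Longrightarrow> v \<in> U \<Longrightarrow>
      (if positively_charged g p e1 e2 y K then \<rho> else - \<rho>) * \<bar>cross e2 K v - cross e1 K v\<bar> =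
      \<sigma> * (cross e2 K v - cross e1 K v)"
  proof
    assume "\<forall>K\<in>shells. \<forall>v\<in>U. positively_charged g p e1 e2 y K \<longleftrightarrow> cross e1 K v < cross e2 K v"
    then show ?thesis by (intro that[of \<rho>]) (auto simp: abs_if algebra_simps)
  next
    assume "\<forall>K\<in>shells. \<forall>v\<in>U. positively_charged g p e1 e2 y K \<longleftrightarrow> \<not> cross e1 K v < cross e2 K v"
    then show ?thesis by (intro that[of "- \<rho>"]) (auto simp: abs_if algebra_simps)
  qed
  have "S v = \<sigma> * (\<Sum>K\<in>shells. cross e2 K v - cross e1 K v)" if "v \<in> U" for v
    unfolding S_def sum_distrib_left using \<sigma> that by (intro sum.cong) auto
  then show ?thesis
    using cross_sum_balance[OF v] v uminus_unit_tangents[OF x_model v] by simp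
qed

section \<open>The volume in polar coordinates\<close>

lemma nn_integral_lborel_affine:
  fixes f :: "'a::euclidean_space \<Rightarrow> ennreal"
  assumes [measurable]: "f \<in> borel_measurable borel" and c: "c \<noteq> 0"
  shows "(\<integral>\<^sup>+x. f x \<partial>lborel) = ennreal (\<bar>c\<bar> ^ DIM('a)) * (\<integral>\<^sup>+x. f (t + c *\<^sub>R x) \<partial>lborel)"
  by (subst lborel_affine[OF c, of t])
    (simp add: nn_integral_density nn_integral_distr nn_integral_cmult)

text \<open>
  Uniqueness of the translation invariant measure, in the form needed for linear changes of variables
  between spaces that are not of the form \<open>real ^ 'n\<close>.
\<close>

lemma nn_integral_lborel_linear_symmetric:
  fixes \<Psi> :: "'a::euclidean_space \<Rightarrow> 'b::euclidean_space"
  assumes \<Psi>: "linear \<Psi>" "surj \<Psi>"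
    and [measurable]: "f \<in> borel_measurable borel" "h \<in> borel_measurable borel"
  shows "(\<integral>\<^sup>+z. f (\<Psi> z) \<partial>lborel) * (\<integral>\<^sup>+y. h y \<partial>lborel) =
         (\<integral>\<^sup>+z. h (\<Psi> z) \<partial>lborel) * (\<integral>\<^sup>+y. (f y :: ennreal) \<partial>lborel)"
proof -
  have \<Psi>m [measurable]: "\<Psi> \<in> borel_measurable borel"
    using \<Psi>(1) by (intro borel_measurable_continuous_onI linear_continuous_on) (simp add: linear_linear)
  obtain \<Phi> where \<Phi>: "\<Psi> (\<Phi> y) = y" for y using \<Psi>(2) by (metis surjD)
  have "(\<integral>\<^sup>+z. f (\<Psi> z) \<partial>lborel) * (\<integral>\<^sup>+y. h y \<partial>lborel) = (\<integral>\<^sup>+z. f (\<Psi> z) * (\<integral>\<^sup>+y. h y \<partial>lborel) \<partial>lborel)"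
    by (subst nn_integral_multc) auto
  \<comment> \<open>Translation by \<open>\<Psi> z\<close> couples the two integrals; after
    exchanging them, translating \<open>z\<close> by \<open>- \<Phi> y\<close> moves the shift from
    \<open>h\<close> to \<open>f\<close>, where a reflection and translation of \<open>y\<close>
    removes it.\<close>
  also have "\<dots> = (\<integral>\<^sup>+z. (\<integral>\<^sup>+y. f (\<Psi> z) * h (\<Psi> z + y) \<partial>lborel) \<partial>lborel)"
  proof (rule nn_integral_cong)
    fix z
    have "(\<integral>\<^sup>+y. h y \<partial>lborel) = (\<integral>\<^sup>+y. h (\<Psi> z + y) \<partial>lborel)"
      using nn_integral_lborel_affine[of h 1 "\<Psi> z"] by simp
    then show "f (\<Psi> z) * (\<integral>\<^sup>+y. h y \<partial>lborel) = (\<integral>\<^sup>+y. f (\<Psi> z) * h (\<Psi> z + y) \<partial>lborel)"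
      by (simp add: nn_integral_cmult)
  qed
  also have "\<dots> = (\<integral>\<^sup>+y. (\<integral>\<^sup>+z. f (\<Psi> z) * h (\<Psi> z + y) \<partial>lborel) \<partial>lborel)"
    by (rule lborel_pair.Fubini'[symmetric]) measurable
  also have "\<dots> = (\<integral>\<^sup>+y. (\<integral>\<^sup>+z. f (\<Psi> z - y) * h (\<Psi> z) \<partial>lborel) \<partial>lborel)"
  proof (rule nn_integral_cong)
    fix y
    have "\<Psi> (- \<Phi> y + z) = \<Psi> z - y" for z
      using \<Phi> by (simp add: linear_add[OF \<Psi>(1)] linear_diff[OF \<Psi>(1)])
    then show "(\<integral>\<^sup>+z. f (\<Psi> z) * h (\<Psi> z + y) \<partial>lborel) = (\<integral>\<^sup>+z. f (\<Psi> z - y) * h (\<Psi> z) \<partial>lborel)"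
      using nn_integral_lborel_affine[of "\<lambda>z. f (\<Psi> z) * h (\<Psi> z + y)" 1 "- \<Phi> y"] by simp
  qed
  also have "\<dots> = (\<integral>\<^sup>+z. (\<integral>\<^sup>+y. f (\<Psi> z - y) * h (\<Psi> z) \<partial>lborel) \<partial>lborel)"
    by (rule lborel_pair.Fubini') measurable
  also have "\<dots> = (\<integral>\<^sup>+z. h (\<Psi> z) * (\<integral>\<^sup>+y. f y \<partial>lborel) \<partial>lborel)"
  proof (rule nn_integral_cong)
    fix z
    have "(\<integral>\<^sup>+y. f y \<partial>lborel) = (\<integral>\<^sup>+y. f (\<Psi> z - y) \<partial>lborel)"
      using nn_integral_lborel_affine[of f "- 1" "\<Psi> z"] by simp
    then show "(\<integral>\<^sup>+y. f (\<Psi> z - y) * h (\<Psi> z) \<partial>lborel) = h (\<Psi> z) * (\<integral>\<^sup>+y. f y \<partial>lborel)"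
      by (simp add: nn_integral_multc mult.commute[of _ "h (\<Psi> z)"] nn_integral_cmult)
  qed
  also have "\<dots> = (\<integral>\<^sup>+z. h (\<Psi> z) \<partial>lborel) * (\<integral>\<^sup>+y. f y \<partial>lborel)"
    by (subst nn_integral_multc) auto
  finally show ?thesis .
qed

text \<open>The preceding symmetry with the indicator of the unit cube as \<open>h\<close> gives the
  factor \<open>c\<close>, the volume of the image of the cube; it is finite because the image is
  compact.\<close>

lemma nn_integral_lborel_linear:
  fixes \<Phi> :: "'b::euclidean_space \<Rightarrow> 'a::euclidean_space"
  assumes \<Phi>: "linear \<Phi>" "bij \<Phi>"
  obtains c :: real where "c \<ge> 0"
    "\<And>f. f \<in> borel_measurable borel \<Longrightarrow> (\<integral>\<^sup>+z. f z \<partial>lborel) = ennreal c * (\<integral>\<^sup>+y. f (\<Phi> y) \<partial>lborel)"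
proof -
  define \<Psi> where "\<Psi> = inv \<Phi>"
  have \<Psi>\<Phi>: "\<Psi> (\<Phi> y) = y" "\<Phi> (\<Psi> z) = z" for y z
    using \<Phi>(2) by (simp_all add: \<Psi>_def bij_def surj_f_inv_f)
  have "linear \<Psi>"
  proof (rule linearI)
    show "\<Psi> (a + b) = \<Psi> a + \<Psi> b" for a b
      using \<Psi>\<Phi>(1)[of "\<Psi> a + \<Psi> b"] by (simp add: linear_add[OF \<Phi>(1)] \<Psi>\<Phi>(2))
    show "\<Psi> (r *\<^sub>R a) = r *\<^sub>R \<Psi> a" for r a
      using \<Psi>\<Phi>(1)[of "r *\<^sub>R \<Psi> a"] by (simp add: linear_scale[OF \<Phi>(1)] \<Psi>\<Phi>(2))
  qed
  have "surj \<Psi>" using \<Psi>\<Phi>(1) by (rule surjI)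
  have \<Phi>m [measurable]: "\<Phi> \<in> borel_measurable borel"
    using \<Phi>(1) by (intro borel_measurable_continuous_onI linear_continuous_on) (simp add: linear_linear)
  define B where "B = (cbox 0 One :: 'b set)"
  have [measurable]: "B \<in> sets borel" by (simp add: B_def)
  have B1: "emeasure lborel B = 1"
    by (simp add: B_def emeasure_lborel_cbox_eq)
  define C where "C = (\<integral>\<^sup>+z. indicator B (\<Psi> z) \<partial>(lborel :: 'a measure))"
  have "C < \<infinity>"
  proof -
    have bl: "bounded_linear \<Phi>" using \<Phi>(1) by (simp add: linear_conv_bounded_linear)
    have "compact (\<Phi> ` B)"
      by (intro compact_continuous_image linear_continuous_on bl) (simp add: B_def)
    then have bdd: "bounded (\<Phi> ` B)" and "closed (\<Phi> ` B)"
      using compact_imp_bounded compact_imp_closed by blast+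
    then have "\<Phi> ` B \<in> sets borel" by simp
    moreover have "indicator B (\<Psi> z) = (indicator (\<Phi> ` B) z :: ennreal)" for z
    proof -
      have "z \<in> \<Phi> ` B \<longleftrightarrow> \<Psi> z \<in> B" using \<Psi>\<Phi> by (metis image_iff)
      then show ?thesis by (simp add: indicator_def)
    qed
    ultimately show ?thesis unfolding C_def using emeasure_bounded_finite[OF bdd] by simp
  qed
  have "(\<integral>\<^sup>+z. f z \<partial>lborel) = ennreal (enn2real C) * (\<integral>\<^sup>+y. f (\<Phi> y) \<partial>lborel)"
    if [measurable]: "f \<in> borel_measurable borel" for f
    using nn_integral_lborel_linear_symmetric[OF \<open>linear \<Psi>\<close> \<open>surj \<Psi>\<close>, of "\<lambda>y. f (\<Phi> y)" "indicator B"] B1 \<open>C < \<infinity>\<close>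
    by (simp add: \<Psi>\<Phi> C_def[symmetric])
  then show ?thesis using that[of "enn2real C"] by simp
qed

text \<open>
  The polar coordinate \<open>t\<close> is parametrized by \<open>q = gcos t / gsin t\<close>, so that the substitution in the
  radial integral is linear; \<open>gparam\<close> is the inverse function and \<open>gscale q = gsin t\<close>.
\<close>

fun grange :: "geometry \<Rightarrow> real set" where
  "grange Spherical = UNIV"
| "grange Hyperbolic = {1<..}"

definition gscale :: "geometry \<Rightarrow> real \<Rightarrow> real" where
  "gscale g q = 1 / sqrt (q\<^sup>2 + gsign g)"

fun gparam :: "geometry \<Rightarrow> real \<Rightarrow> real" where
  "gparam Spherical q = pi / 2 - arctan q"
| "gparam Hyperbolic q = (ln (q + 1) - ln (q - 1)) / 2"

lemma grange_pos: "q \<in> grange g \<Longrightarrow> q\<^sup>2 + gsign g > 0"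
  by (cases g) (auto simp: gsign_def add_nonneg_pos)

lemma gscale_pos: "q \<in> grange g \<Longrightarrow> gscale g q > 0"
  using grange_pos[of q g] by (simp add: gscale_def)

lemma gparam:
  assumes q: "q \<in> grange g"
  shows "gparam g q \<in> shortest_range g" and "gcos g (gparam g q) = q * gscale g q"
    and "gsin g (gparam g q) = gscale g q"
    and "(gparam g has_real_derivative - (gscale g q)\<^sup>2) (at q)"
proof -
  have "gparam g q \<in> shortest_range g \<and> gcos g (gparam g q) = q * gscale g q \<and>
    gsin g (gparam g q) = gscale g q \<and> (gparam g has_real_derivative - (gscale g q)\<^sup>2) (at q)"
  proof (cases g)
    case Spherical
    have eq: "gparam Spherical = (\<lambda>q. pi / 2 - arctan q)" by auto
    have "0 < 1 + q\<^sup>2" by (simp add: add_pos_nonneg)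
    then show ?thesis
      using arctan_lbound[of q] arctan_ubound[of q] unfolding Spherical eq
      by (auto simp: gsign_def gscale_def cos_diff sin_diff sin_arctan cos_arctan add.commute power_divide
          inverse_eq_divide intro!: derivative_eq_intros)
  next
    case Hyperbolic
    have eq: "gparam Hyperbolic = (\<lambda>q. (ln (q + 1) - ln (q - 1)) / 2)" by auto
    have q1: "q > 1" using q Hyperbolic by simp
    then have prod: "q\<^sup>2 - 1 = (q + 1) * (q - 1)" by (simp add: algebra_simps power2_eq_square)
    \<comment> \<open>The function is the inverse hyperbolic cotangent: \<open>a / b\<close> is
      \<open>exp t\<close> for \<open>q = coth t\<close>, and \<open>a * b\<close> is the reciprocal
      of \<open>sinh t\<close>.\<close>
    define a b where "a = sqrt (q + 1)" and "b = sqrt (q - 1)"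
    have ab: "a > 0" "b > 0" "a\<^sup>2 = q + 1" "b\<^sup>2 = q - 1" using q1 by (auto simp: a_def b_def)
    have s: "gscale Hyperbolic q = 1 / (a * b)"
      by (simp add: gscale_def gsign_def a_def b_def prod real_sqrt_mult flip: diff_conv_add_uminus)
    have "exp (ln y / 2) = sqrt y" if "y > 0" for y :: real
      using powr_half_sqrt[of y] that by (simp add: powr_def)
    then have "exp (ln (q + 1) / 2) = a" "exp (ln (q - 1) / 2) = b"
      using q1 by (simp_all add: a_def b_def)
    then have e: "exp (gparam Hyperbolic q) = a / b" "exp (- gparam Hyperbolic q) = b / a"
      by (simp_all add: diff_divide_distrib exp_diff)
    have "cosh (gparam Hyperbolic q) = q / (a * b)"
    proof -
      have "cosh (gparam Hyperbolic q) = (a / b + b / a) / 2"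
        unfolding cosh_field_def e ..
      also have "\<dots> = (a\<^sup>2 + b\<^sup>2) / (2 * (a * b))"
        using ab(1,2) by (simp add: field_simps power2_eq_square)
      finally show ?thesis by (simp add: ab)
    qed
    moreover have "sinh (gparam Hyperbolic q) = 1 / (a * b)"
    proof -
      have "sinh (gparam Hyperbolic q) = (a / b - b / a) / 2"
        unfolding sinh_field_def e ..
      also have "\<dots> = (a\<^sup>2 - b\<^sup>2) / (2 * (a * b))"
        using ab(1,2) by (simp add: field_simps power2_eq_square)
      finally show ?thesis by (simp add: ab)
    qed
    moreover have "gparam Hyperbolic q > 0" using q1 by simp
    moreover have "(gparam Hyperbolic has_real_derivative - (gscale Hyperbolic q)\<^sup>2) (at q)"
    proof -
      have "(gscale Hyperbolic q)\<^sup>2 = 1 / ((q + 1) * (q - 1))"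
        unfolding s by (simp add: power_divide power_mult_distrib ab)
      moreover have "(gparam Hyperbolic has_real_derivative ((1 / (q + 1) - 1 / (q - 1)) / 2)) (at q)"
        unfolding eq using q1 by (auto intro!: derivative_eq_intros)
      moreover have "(1 / (q + 1) - 1 / (q - 1)) / 2 = - (1 / ((q + 1) * (q - 1)))"
        using q1 by (simp add: diff_frac_eq)
      ultimately show ?thesis by simp
    qed
    ultimately show ?thesis using Hyperbolic s by simp
  qed
  then show "gparam g q \<in> shortest_range g" "gcos g (gparam g q) = q * gscale g q"
    "gsin g (gparam g q) = gscale g q" "(gparam g has_real_derivative - (gscale g q)\<^sup>2) (at q)"
    by auto
qed

lemma gparam_surj:
  assumes t: "t \<in> shortest_range g"
  shows "gcos g t / gsin g t \<in> grange g" and "gparam g (gcos g t / gsin g t) = t"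
proof -
  let ?q = "gcos g t / gsin g t"
  show q: "?q \<in> grange g"
  proof (cases g)
    case Hyperbolic
    then show ?thesis using t sinh_less_cosh_real[of t] by simp
  qed simp
  have pos: "gsin g t > 0" by (rule gsin_pos[OF t])
  have "?q\<^sup>2 + gsign g = ((gcos g t)\<^sup>2 + gsign g * (gsin g t)\<^sup>2) / (gsin g t)\<^sup>2"
    using pos by (simp add: power_divide add_divide_distrib)
  then have "gscale g ?q = gsin g t"
    using pos by (simp add: gcos_gsin gscale_def real_sqrt_divide)
  then have "gcos g (gparam g ?q) = gcos g t" using gparam(2)[OF q] pos by simp
  then show "gparam g ?q = t" using gcos_inj_on gparam(1)[OF q] t by (auto dest: inj_onD)
qed

lemma gparam_strict_antimono:
  assumes "q \<in> grange g" "q < r"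
  shows "gparam g r < gparam g q"
proof (rule DERIV_neg_imp_decreasing[OF assms(2)])
  fix y assume "q \<le> y" "y \<le> r"
  then have y: "y \<in> grange g" using assms(1) by (cases g) auto
  show "\<exists>D. (gparam g has_real_derivative D) (at y) \<and> D < 0"
    using gparam(4)[OF y] gscale_pos[OF y] by (intro exI[of _ "- (gscale g y)\<^sup>2"]) simp
qed

lemma gparam_le_iff:
  assumes "q \<in> grange g" "r \<in> grange g"
  shows "gparam g r \<le> gparam g q \<longleftrightarrow> q \<le> r"
  using gparam_strict_antimono[OF assms(1), of r] gparam_strict_antimono[OF assms(2), of q]
  by (cases q r rule: linorder_cases) auto

lemma borel_measurable_gscale [measurable]: "gscale g \<in> borel_measurable borel"
  unfolding gscale_def by measurable

lemma borel_measurable_gparam [measurable]: "gparam g \<in> borel_measurable borel"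
proof (cases g)
  case Spherical
  have "gparam Spherical = (\<lambda>q. pi / 2 - arctan q)" by auto
  then show ?thesis using Spherical by simp
next
  case Hyperbolic
  have "gparam Hyperbolic = (\<lambda>q. (ln (q + 1) - ln (q - 1)) / 2)" by auto
  then show ?thesis using Hyperbolic by simp
qed

lemma grange_sets [measurable]: "grange g \<in> sets borel"
  by (cases g) auto

text \<open>Since \<open>gparam\<close> has derivative \<open>- (gscale g q)\<^sup>2\<close>, this
  is the integral of \<open>dt\<close> over the interval, written in the variable \<open>q\<close>.
  It turns the radial part of the field into the width of a layer component.\<close>

lemma has_bochner_integral_gscale:
  assumes ab: "a \<in> shortest_range g" "b \<in> shortest_range g" "a \<le> b"
  shows "has_bochner_integral lborel
    (\<lambda>q. indicator (grange g) q * indicator {a..b} (gparam g q) * (gscale g q)\<^sup>2) (b - a)"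
proof -
  let ?c = "\<lambda>t. gcos g t / gsin g t"
  note a = gparam_surj[OF ab(1)] and b = gparam_surj[OF ab(2)]
  have le: "?c b \<le> ?c a" using gparam_le_iff[OF b(1) a(1)] a(2) b(2) ab(3) by simp
  have grange_ivl: "q \<in> grange g" if "?c b \<le> q" for q
    using that b(1) by (cases g) auto
  have "has_bochner_integral lborel (\<lambda>q. (gscale g q)\<^sup>2 * indicator {?c b .. ?c a} q)
      (- gparam g (?c a) - - gparam g (?c b))"
  proof (rule has_bochner_integral_FTC_Icc_nonneg[OF _ _ _ le])
    show "(\<lambda>q. (gscale g q)\<^sup>2) \<in> borel_measurable borel" by measurable
    fix q assume "q \<in> {?c b..?c a}"
    then have "?c b \<le> q" by simp
    then show "((\<lambda>q. - gparam g q) has_real_derivative (gscale g q)\<^sup>2) (at q)"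
      using gparam(4)[OF grange_ivl] by (auto intro!: derivative_eq_intros)
  qed simp
  moreover have "(gscale g q)\<^sup>2 * indicator {?c b .. ?c a} q =
      indicator (grange g) q * indicator {a..b} (gparam g q) * (gscale g q)\<^sup>2" for q
  proof (cases "q \<in> grange g")
    case True
    then have "q \<in> {?c b..?c a} \<longleftrightarrow> gparam g q \<in> {a..b}"
      using gparam_le_iff[OF True a(1)] gparam_le_iff[OF b(1) True] a(2) b(2) by auto
    then show ?thesis using True by (simp add: indicator_def)
  next
    case False
    then show ?thesis using grange_ivl[of q] by (auto simp: indicator_def)
  qed
  ultimately show ?thesis using a(2) b(2) by simp
qed

lemma borel_measurable_ambient_form [measurable (raw)]:
  "f \<in> borel_measurable M \<Longrightarrow> h \<in> borel_measurable M \<Longrightarrow> (\<lambda>z. ambient_form g (f z) (h z)) \<in> borel_measurable M"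
  by (rule borel_measurable_continuous_Pair) (auto intro!: continuous_intros)

lemma borel_measurable_gcos [measurable]: "gcos g \<in> borel_measurable borel"
  and borel_measurable_gsin [measurable]: "gsin g \<in> borel_measurable borel"
  by (intro borel_measurable_continuous_onI continuous_on_gcos continuous_on_gsin continuous_on_id)+

lemma borel_measurable_geodesic [measurable (raw)]:
  "v \<in> borel_measurable M \<Longrightarrow> t \<in> borel_measurable M \<Longrightarrow> (\<lambda>z. geodesic g x (v z) (t z)) \<in> borel_measurable M"
  by (rule borel_measurable_continuous_Pair) (auto intro!: continuous_intros)

section \<open>The cone measure on the model\<close>

definition model_cone :: "geometry \<Rightarrow> (real \<times> (real^'n)) set" where
  "model_cone g = {c *\<^sub>R y | c y. 0 < c \<and> c \<le> 1 \<and> y \<in> model g}"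

text \<open>The radius is recovered from the form as
  \<open>sqrt (gsign g * ambient_form g z z)\<close>; in this description the cone is visibly a
  Borel set.\<close>

lemma model_cone_iff:
  "z \<in> model_cone g \<longleftrightarrow> 0 < gsign g * ambient_form g z z \<and> gsign g * ambient_form g z z \<le> 1 \<and>
    (g = Hyperbolic \<longrightarrow> fst z > 0)"
proof
  assume "z \<in> model_cone g"
  then obtain c y where z: "z = c *\<^sub>R y" and c: "0 < c" "c \<le> 1" and y: "y \<in> model g"
    by (auto simp: model_cone_def)
  have "gsign g * ambient_form g z z = c\<^sup>2"
    using ambient_form_model[OF y] by (simp add: z ambient_form_simps power2_eq_square)
  moreover have "fst z > 0" if "g = Hyperbolic" using y that c by (simp add: z)
  ultimately show "0 < gsign g * ambient_form g z z \<and> gsign g * ambient_form g z z \<le> 1 \<and>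
    (g = Hyperbolic \<longrightarrow> fst z > 0)" using c by (simp add: power_le_one)
next
  assume *: "0 < gsign g * ambient_form g z z \<and> gsign g * ambient_form g z z \<le> 1 \<and>
    (g = Hyperbolic \<longrightarrow> fst z > 0)"
  define c where "c = sqrt (gsign g * ambient_form g z z)"
  have c: "0 < c" "c \<le> 1" and c2: "c * c = gsign g * ambient_form g z z" using * by (auto simp: c_def)
  have form: "ambient_form g (z /\<^sub>R c) (z /\<^sub>R c) = gsign g"
  proof -
    have "ambient_form g z z = gsign g * (c * c)" by (simp add: c2)
    then show ?thesis using c(1) by (simp add: ambient_form_simps field_simps)
  qed
  have "z /\<^sub>R c \<in> model g"
  proof (cases g)
    case Spherical
    then have "(z /\<^sub>R c) \<bullet> (z /\<^sub>R c) = 1" using form by (simp add: gsign_def inner_prod_def)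
    then have "norm (z /\<^sub>R c) = 1" by (simp only: norm_eq_1)
    then show ?thesis using Spherical by (simp only: model.simps mem_sphere_0)
  next
    case Hyperbolic
    then show ?thesis using form * c(1) by (simp add: gsign_def)
  qed
  moreover have "z = c *\<^sub>R (z /\<^sub>R c)" using c(1) by simp
  ultimately show "z \<in> model_cone g" using c unfolding model_cone_def by blast
qed

lemma model_cone_sets [measurable]: "model_cone g \<in> sets (borel :: (real \<times> (real^'n)) measure)"
proof -
  have "model_cone g = {z :: real \<times> (real^'n). 0 < gsign g * ambient_form g z z} \<inter> {z. gsign g * ambient_form g z z \<le> 1} \<inter>
      {z. g = Hyperbolic \<longrightarrow> 0 < fst z}"
    by (auto simp: model_cone_iff)
  moreover have "{z :: real \<times> (real^'n). 0 < gsign g * ambient_form g z z} \<in> sets borel"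
    by (intro borel_open open_Collect_less continuous_intros)
  moreover have "{z :: real \<times> (real^'n). gsign g * ambient_form g z z \<le> 1} \<in> sets borel"
    by (intro borel_closed closed_Collect_le continuous_intros)
  moreover have "{z :: real \<times> (real^'n). 0 < fst z} \<in> sets borel"
    by (intro borel_open open_Collect_less continuous_intros)
  then have "{z :: real \<times> (real^'n). g = Hyperbolic \<longrightarrow> 0 < fst z} \<in> sets borel"
    by (cases "g = Hyperbolic") simp_all
  ultimately show ?thesis by (simp only: sets.Int)
qed

lemma nn_integral_volume:
  fixes F :: "real \<times> (real^'n) \<Rightarrow> ennreal"
  assumes [measurable]: "F \<in> borel_measurable borel"
  shows "(\<integral>\<^sup>+y. F y \<partial>volume g) = of_nat (CARD('n) + 1) *
    (\<integral>\<^sup>+z. F (z /\<^sub>R sqrt \<bar>ambient_form g z z\<bar>) * indicator (model_cone g) z \<partial>lborel)"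
proof -
  have [measurable]: "(\<lambda>z :: real \<times> (real^'n). z /\<^sub>R sqrt \<bar>ambient_form g z z\<bar>) \<in> borel_measurable borel"
    by measurable
  have m: "(\<lambda>z. z /\<^sub>R sqrt \<bar>ambient_form g z z\<bar>) \<in> borel_measurable (restrict_space lborel (model_cone g :: (real \<times> (real^'n)) set))"
    by (intro measurable_restrict_space1) measurable
  have "(\<integral>\<^sup>+y. F y \<partial>volume g) = of_nat (CARD('n) + 1) *
      (\<integral>\<^sup>+y. F y \<partial>distr (restrict_space lborel (model_cone g)) borel (\<lambda>z. z /\<^sub>R sqrt \<bar>ambient_form g z z\<bar>))"
    unfolding volume_def model_cone_def[symmetric] by (rule nn_integral_scale_measure) simp
  also have "(\<integral>\<^sup>+y. F y \<partial>distr (restrict_space lborel (model_cone g)) borel (\<lambda>z. z /\<^sub>R sqrt \<bar>ambient_form g z z\<bar>)) =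
      (\<integral>\<^sup>+z. F (z /\<^sub>R sqrt \<bar>ambient_form g z z\<bar>) \<partial>restrict_space lborel (model_cone g))"
    by (rule nn_integral_distr[OF m]) simp
  also have "\<dots> = (\<integral>\<^sup>+z. F (z /\<^sub>R sqrt \<bar>ambient_form g z z\<bar>) * indicator (model_cone g) z \<partial>lborel)"
    by (rule nn_integral_restrict_space) simp
  finally show ?thesis .
qed

lemma sets_volume [measurable_cong]: "sets (volume g) = sets borel"
  by (simp add: volume_def)

text \<open>\<open>T\<close> parametrizes the tangent space at \<open>x\<close> by
  \<open>real^'n\<close>. A vector \<open>u\<close> there encodes two things: \<open>dir u\<close>
  is the direction of a ray, and \<open>N u\<close> is the radial coordinate in the cone over the
  model.\<close>

locale polar_coordinates =
  fixes g :: geometry and x :: "real \<times> (real^'n)" and T :: "real^'n \<Rightarrow> real \<times> (real^'n)"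
  assumes base: "x \<in> model g"
    and T: "linear T" "inj T" "range T = {v. ambient_form g x v = 0}"
begin

definition N :: "real^'n \<Rightarrow> real" where
  "N u = sqrt (ambient_form g (T u) (T u))"

definition dir :: "real^'n \<Rightarrow> real \<times> (real^'n)" where
  "dir u = T u /\<^sub>R N u"

lemma N_pos: "u \<noteq> 0 \<Longrightarrow> N u > 0"
  and dir_unit: "u \<noteq> 0 \<Longrightarrow> dir u \<in> unit_tangents g x"
  using unit_tangents_parametrization[OF base T] by (auto simp: N_def dir_def)

lemma N_0 [simp]: "N 0 = 0"
  by (simp add: N_def linear_0[OF T(1)] ambient_form_simps)

lemma N_nonneg: "N u \<ge> 0"
  using N_pos[of u] by (cases "u = 0") auto

lemma N_scale: "s \<ge> 0 \<Longrightarrow> N (s *\<^sub>R u) = s * N u"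
  by (simp add: N_def linear_scale[OF T(1)] ambient_form_simps real_sqrt_mult flip: mult.assoc)

lemma N_minus: "N (- u) = N u"
  by (simp add: N_def linear_neg[OF T(1)] ambient_form_simps)

lemma T_eq: "T u = N u *\<^sub>R dir u"
  using N_pos[of u] by (cases "u = 0") (auto simp: dir_def linear_0[OF T(1)])

lemma dir_minus: "dir (- u) = - dir u"
  by (simp add: dir_def N_minus linear_neg[OF T(1)])

lemma borel_measurable_T [measurable]: "T \<in> borel_measurable borel"
  using T(1) by (intro borel_measurable_continuous_onI linear_continuous_on) (simp add: linear_conv_bounded_linear)

lemma borel_measurable_N [measurable]: "N \<in> borel_measurable borel"
  unfolding N_def by measurable

lemma borel_measurable_dir [measurable]: "dir \<in> borel_measurable borel"
  unfolding dir_def by measurable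

text \<open>Explains the substitution: in linear coordinates \<open>a *\<^sub>R x + T w\<close>, the
  choice \<open>a = N w * q\<close> and \<open>w = gscale g q *\<^sub>R u\<close> produces the cone
  point of radius \<open>N u\<close> over the point at distance \<open>gparam g q\<close> in
  direction \<open>dir u\<close>.\<close>

lemma plane_point_eq:
  assumes u: "u \<noteq> 0" and q: "q \<in> grange g"
  shows "(gscale g q * N u * q) *\<^sub>R x + gscale g q *\<^sub>R T u = N u *\<^sub>R geodesic g x (dir u) (gparam g q)"
  by (subst T_eq) (simp add: geodesic_def gparam[OF q] scaleR_add_right mult.commute mult.left_commute)

lemma cone_ray:
  assumes u: "u \<noteq> 0"
  shows "N u *\<^sub>R geodesic g x (dir u) t \<in> model_cone g \<longleftrightarrow> N u \<le> 1"
    and "(N u *\<^sub>R geodesic g x (dir u) t) /\<^sub>R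
      sqrt \<bar>ambient_form g (N u *\<^sub>R geodesic g x (dir u) t) (N u *\<^sub>R geodesic g x (dir u) t)\<bar> = geodesic g x (dir u) t"
proof -
  let ?y = "geodesic g x (dir u) t"
  have y: "?y \<in> model g" by (rule geodesic_in_model[OF base dir_unit[OF u]])
  have form: "ambient_form g (N u *\<^sub>R ?y) (N u *\<^sub>R ?y) = (N u)\<^sup>2 * gsign g"
    using ambient_form_model[OF y] by (simp add: ambient_form_simps power2_eq_square)
  have "fst (N u *\<^sub>R ?y) > 0" if "g = Hyperbolic" using y that N_pos[OF u] by simp
  then show "N u *\<^sub>R ?y \<in> model_cone g \<longleftrightarrow> N u \<le> 1"
    unfolding model_cone_iff form using N_pos[OF u] by (auto simp: power_le_one_iff mult.commute)
  have "\<bar>gsign g\<bar> = 1" by (cases g) (auto simp: gsign_def)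
  then show "(N u *\<^sub>R ?y) /\<^sub>R sqrt \<bar>ambient_form g (N u *\<^sub>R ?y) (N u *\<^sub>R ?y)\<bar> = ?y"
    unfolding form using N_pos[OF u] by (simp add: abs_mult)
qed

text \<open>This concerns the hyperbolic case with \<open>q \<le> 1\<close>. Such points are not
  timelike if \<open>\<bar>q\<bar> \<le> 1\<close>; otherwise they are negatives of points over the
  upper sheet, since \<open>- q > 1\<close>.\<close>

lemma cone_only_grange:
  assumes u: "u \<noteq> 0" and q: "q \<notin> grange g"
  shows "(N u * q) *\<^sub>R x + T u \<notin> model_cone g"
proof
  let ?z = "(N u * q) *\<^sub>R x + T u"
  assume z: "?z \<in> model_cone g"
  have g: "g = Hyperbolic" and q1: "q \<le> 1" using q by (cases g; simp)+
  have "ambient_form g ?z ?z = (N u)\<^sup>2 * (q\<^sup>2 * gsign g + 1)"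
    using dir_unit[OF u] ambient_form_model[OF base] unfolding T_eq[of u]
    by (simp add: unit_tangents_def ambient_form_simps ambient_form_commute[of g "dir u" x] algebra_simps power2_eq_square)
  then have "(N u)\<^sup>2 * (q\<^sup>2 - 1) > 0"
    using z g by (simp add: model_cone_iff gsign_def algebra_simps)
  then have "q\<^sup>2 > 1" using N_pos[OF u] by (simp add: zero_less_mult_iff)
  then have "\<bar>q\<bar> > 1" by (metis abs_square_le_1 not_le)
  then have q': "- q \<in> grange g" using q1 g by auto
  have "(gscale g (- q) * N (- u) * (- q)) *\<^sub>R x + gscale g (- q) *\<^sub>R T (- u) =
      N (- u) *\<^sub>R geodesic g x (dir (- u)) (gparam g (- q))"
    using u by (intro plane_point_eq q') simp
  moreover have "(gscale g (- q) * N (- u) * (- q)) *\<^sub>R x + gscale g (- q) *\<^sub>R T (- u) = - (gscale g (- q) *\<^sub>R ?z)"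
    by (simp add: N_minus linear_neg[OF T(1)] scaleR_add_right mult.assoc)
  moreover have "fst (geodesic g x (dir (- u)) (gparam g (- q))) > 0"
    using geodesic_in_model[OF base dir_unit[of "- u"]] u g by simp
  ultimately have "fst (- (gscale g (- q) *\<^sub>R ?z)) > 0"
    using N_pos[of "- u"] u by (metis fst_scaleR neg_equal_0_iff_equal real_scaleR_def mult_pos_pos)
  then have "gscale g (- q) * fst ?z < 0" by simp
  moreover have "fst ?z > 0" using z g by (simp add: model_cone_iff)
  ultimately show False using gscale_pos[OF q'] by (simp add: mult_less_0_iff)
qed

text \<open>The Jacobian of the substitutions: \<open>a = N w * q\<close> contributes
  \<open>N w = gscale g q * N u\<close>, and \<open>w = gscale g q *\<^sub>R u\<close> contributes
  \<open>gscale g q ^ CARD('n)\<close>. As \<open>gscale g q\<close> is \<open>gsin g t\<close> and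
  \<open>dq\<close> corresponds to \<open>dt / (gsin g t)\<^sup>2\<close>, this is the polar density
  \<open>gsin g t ^ (n - 1)\<close>; \<open>N u \<le> 1\<close> cuts off the cone.\<close>

definition weight :: "real^'n \<Rightarrow> real \<Rightarrow> real" where
  "weight u q = indicator {u. N u \<le> 1} u * N u * (indicator (grange g) q * gscale g q ^ (CARD('n) + 1))"

lemma weight_nonneg: "weight u q \<ge> 0"
  using gscale_pos[of q g] N_nonneg[of u] by (auto simp: weight_def indicator_def)

lemma borel_measurable_weight [measurable]:
  "(\<lambda>z. weight (fst z) (snd z)) \<in> borel_measurable (borel \<Otimes>\<^sub>M borel)"
proof -
  have [measurable]: "{u. N u \<le> 1} \<in> sets borel" by measurable
  show ?thesis unfolding weight_def by measurable
qed

text \<open>Linear coordinates \<open>(a, w)\<close> along \<open>x\<close> and the tangent space,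
  followed by a substitution in \<open>a\<close> for fixed \<open>w\<close> and one in
  \<open>w\<close> for fixed \<open>q\<close>; Fubini switches between them.\<close>

lemma nn_integral_volume_polar:
  obtains C :: real where "C \<ge> 0"
    "\<And>F. F \<in> borel_measurable borel \<Longrightarrow> (\<integral>\<^sup>+y. F y \<partial>volume g) =
      ennreal C * (\<integral>\<^sup>+u. \<integral>\<^sup>+q. ennreal (weight u q) * F (geodesic g x (dir u) (gparam g q)) \<partial>lborel \<partial>lborel)"
proof -
  define \<Phi> where "\<Phi> y = fst y *\<^sub>R x + T (snd y)" for y
  have lin: "linear \<Phi>"
    by (rule linearI) (simp_all add: \<Phi>_def linear_add[OF T(1)] linear_scale[OF T(1)] algebra_simps)
  have "inj \<Phi>"
    unfolding linear_injective_0[OF lin]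
  proof (intro allI impI)
    fix y assume y: "\<Phi> y = 0"
    have "ambient_form g x (T (snd y)) = 0" using T(3) by blast
    then have "ambient_form g x (\<Phi> y) = fst y * gsign g"
      using ambient_form_model[OF base] by (simp add: \<Phi>_def ambient_form_simps)
    then have "fst y = 0" using y by (simp add: ambient_form_simps)
    then have "T (snd y) = T 0" using y by (simp add: \<Phi>_def linear_0[OF T(1)])
    then have "snd y = 0" by (rule injD[OF T(2)])
    then show "y = 0" using \<open>fst y = 0\<close> by (simp add: prod_eq_iff)
  qed
  then have "bij \<Phi>" using linear_injective_imp_surjective[OF lin] by (simp add: bij_def)
  then obtain c where c: "c \<ge> 0" "\<And>f. f \<in> borel_measurable borel \<Longrightarrow>
      (\<integral>\<^sup>+z. f z \<partial>lborel) = ennreal c * (\<integral>\<^sup>+y. f (\<Phi> y) \<partial>lborel)"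
    using nn_integral_lborel_linear[OF lin] by blast
  have \<Phi>m [measurable]: "\<Phi> \<in> borel_measurable borel"
    using lin by (intro borel_measurable_continuous_onI linear_continuous_on) (simp add: linear_conv_bounded_linear)
  have [measurable]: "{u. N u \<le> 1} \<in> sets borel" by measurable
  have main: "(\<integral>\<^sup>+y. F y \<partial>volume g) = ennreal (real (CARD('n) + 1) * c) *
      (\<integral>\<^sup>+u. \<integral>\<^sup>+q. ennreal (weight u q) * F (geodesic g x (dir u) (gparam g q)) \<partial>lborel \<partial>lborel)"
    if [measurable]: "F \<in> borel_measurable borel" for F
  proof -
    define G where "G z = F (z /\<^sub>R sqrt \<bar>ambient_form g z z\<bar>) * indicator (model_cone g) z" for z
    have Gm [measurable]: "G \<in> borel_measurable borel" unfolding G_def by measurable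
    have "(\<integral>\<^sup>+y. G (\<Phi> y) \<partial>lborel) = (\<integral>\<^sup>+y. G (\<Phi> y) \<partial>(lborel \<Otimes>\<^sub>M lborel))"
      by (simp add: lborel_prod)
    also have "\<dots> = (\<integral>\<^sup>+w. \<integral>\<^sup>+a. G (\<Phi> (a, w)) \<partial>lborel \<partial>lborel)"
    proof (rule lborel_pair.nn_integral_snd[symmetric])
      have "(\<lambda>y. G (\<Phi> y)) \<in> borel_measurable borel" by measurable
      then show "(\<lambda>y. G (\<Phi> y)) \<in> borel_measurable (lborel \<Otimes>\<^sub>M lborel)" by (simp add: lborel_prod)
    qed
    also have "\<dots> = (\<integral>\<^sup>+w. \<integral>\<^sup>+a. G (a *\<^sub>R x + T w) \<partial>lborel \<partial>lborel)"
      by (simp add: \<Phi>_def)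
    also have "\<dots> = (\<integral>\<^sup>+w. \<integral>\<^sup>+q. ennreal (N w) * G ((N w * q) *\<^sub>R x + T w) \<partial>lborel \<partial>lborel)"
    proof (rule nn_integral_cong_AE)
      \<comment> \<open>At \<open>w = 0\<close> the scaling by \<open>N w\<close> degenerates, but
        this is a null set.\<close>
      have "AE w in lborel. w \<noteq> (0 :: real^'n)" by (rule AE_lborel_singleton)
      then show "AE w in lborel. (\<integral>\<^sup>+a. G (a *\<^sub>R x + T w) \<partial>lborel) =
          (\<integral>\<^sup>+q. ennreal (N w) * G ((N w * q) *\<^sub>R x + T w) \<partial>lborel)"
      proof eventually_elim
        case (elim w)
        have "(\<integral>\<^sup>+a. G (a *\<^sub>R x + T w) \<partial>lborel) =
            ennreal \<bar>N w\<bar> * (\<integral>\<^sup>+q. G ((0 + N w * q) *\<^sub>R x + T w) \<partial>lborel)"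
          using N_pos[OF elim] by (intro nn_integral_real_affine) auto
        then show ?case using N_pos[OF elim] by (simp add: nn_integral_cmult)
      qed
    qed
    also have "\<dots> = (\<integral>\<^sup>+q. \<integral>\<^sup>+w. ennreal (N w) * G ((N w * q) *\<^sub>R x + T w) \<partial>lborel \<partial>lborel)"
      by (rule lborel_pair.Fubini') measurable
    also have "\<dots> = (\<integral>\<^sup>+q. \<integral>\<^sup>+u. ennreal (weight u q) * F (geodesic g x (dir u) (gparam g q)) \<partial>lborel \<partial>lborel)"
    proof (rule nn_integral_cong)
      fix q :: real
      show "(\<integral>\<^sup>+w. ennreal (N w) * G ((N w * q) *\<^sub>R x + T w) \<partial>lborel) =
          (\<integral>\<^sup>+u. ennreal (weight u q) * F (geodesic g x (dir u) (gparam g q)) \<partial>lborel)"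
      proof (cases "q \<in> grange g")
        case False
        have zero: "ennreal (N w) * G ((N w * q) *\<^sub>R x + T w) = 0" for w
          using cone_only_grange[OF _ False, of w] by (cases "w = 0") (auto simp: G_def)
        show ?thesis unfolding zero using False by (simp add: weight_def)
      next
        case True
        let ?s = "gscale g q"
        have s: "?s > 0" by (rule gscale_pos[OF True])
        have "(\<integral>\<^sup>+w. ennreal (N w) * G ((N w * q) *\<^sub>R x + T w) \<partial>lborel) =
            ennreal (\<bar>?s\<bar> ^ DIM(real^'n)) * (\<integral>\<^sup>+u. ennreal (N (0 + ?s *\<^sub>R u)) *
              G ((N (0 + ?s *\<^sub>R u) * q) *\<^sub>R x + T (0 + ?s *\<^sub>R u)) \<partial>lborel)"
          using s by (intro nn_integral_lborel_affine) auto
        also have "\<dots> = (\<integral>\<^sup>+u. ennreal (?s ^ CARD('n)) * (ennreal (?s * N u) *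
              G ((?s * N u * q) *\<^sub>R x + ?s *\<^sub>R T u)) \<partial>lborel)"
          using s by (subst nn_integral_cmult) (auto simp: N_scale linear_scale[OF T(1)])
        also have "\<dots> = (\<integral>\<^sup>+u. ennreal (weight u q) * F (geodesic g x (dir u) (gparam g q)) \<partial>lborel)"
        proof (rule nn_integral_cong)
          fix u :: "real^'n"
          show "ennreal (?s ^ CARD('n)) * (ennreal (?s * N u) * G ((?s * N u * q) *\<^sub>R x + ?s *\<^sub>R T u)) =
            ennreal (weight u q) * F (geodesic g x (dir u) (gparam g q))"
          proof (cases "u = 0")
            case False
            have Gu: "G ((?s * N u * q) *\<^sub>R x + ?s *\<^sub>R T u) = F (geodesic g x (dir u) (gparam g q)) * indicator {u. N u \<le> 1} u"
              unfolding plane_point_eq[OF False True] G_def cone_ray(2)[OF False]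
              by (simp add: indicator_def cone_ray(1)[OF False])
            have Wu: "ennreal (?s ^ CARD('n)) * ennreal (?s * N u) * indicator {u. N u \<le> 1} u = ennreal (weight u q)"
              using s N_nonneg[of u] True by (auto simp: weight_def indicator_def mult_ac simp flip: ennreal_mult)
            show ?thesis unfolding Gu Wu[symmetric] by (simp only: mult_ac)
          qed (simp add: weight_def)
        qed
        finally show ?thesis .
      qed
    qed
    also have "\<dots> = (\<integral>\<^sup>+u. \<integral>\<^sup>+q. ennreal (weight u q) * F (geodesic g x (dir u) (gparam g q)) \<partial>lborel \<partial>lborel)"
      by (rule lborel_pair.Fubini') measurable
    finally have "(\<integral>\<^sup>+y. G (\<Phi> y) \<partial>lborel) =
      (\<integral>\<^sup>+u. \<integral>\<^sup>+q. ennreal (weight u q) * F (geodesic g x (dir u) (gparam g q)) \<partial>lborel \<partial>lborel)" .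
    then show ?thesis
      unfolding nn_integral_volume[OF that] G_def[symmetric] c(2)[OF Gm]
      using c(1) by (simp add: ennreal_mult ennreal_of_nat_eq_real_of_nat mult.assoc del: of_nat_add of_nat_Suc)
  qed
  show ?thesis by (rule that[OF _ main]) (use c(1) in auto)
qed

end

section \<open>The electrostatic field\<close>

text \<open>Outside \<open>{-1..1}\<close> the description defining \<open>arccos\<close> has no
  witness, so it takes one fixed default value there, represented by
  \<open>arccos 2\<close>.\<close>

lemma borel_measurable_arccos [measurable]: "arccos \<in> borel_measurable borel"
proof -
  have "arccos y = (if y \<in> {-1..1} then arccos y else arccos 2)" for y :: real
  proof (cases "y \<in> {-1..1}")
    case False
    have "arccos z = (THE x. False)" if "z \<notin> {-1..1}" for z :: real
    proof -
      have "cos x \<noteq> z" for x using that cos_ge_minus_one[of x] cos_le_one[of x] by auto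
      then show ?thesis unfolding arccos_def by simp
    qed
    then show ?thesis using False by (auto simp: not_le)
  qed simp
  moreover have "(\<lambda>y :: real. if y \<in> {-1..1} then arccos y else arccos 2) \<in> borel_measurable borel"
    by (intro borel_measurable_continuous_on_if continuous_on_arccos' continuous_on_const) auto
  ultimately show ?thesis by (simp cong: measurable_cong)
qed

lemma borel_measurable_arcosh [measurable]: "(arcosh :: real \<Rightarrow> real) \<in> borel_measurable borel"
  unfolding arcosh_def[abs_def] by measurable

lemma borel_measurable_gdist [measurable]: "gdist g x \<in> borel_measurable borel"
proof (cases g)
  case Spherical
  have "(\<lambda>y. arccos (ambient_form Spherical x y)) \<in> borel_measurable borel" by measurable
  then show ?thesis using Spherical by (simp add: fun_eq_iff[symmetric] cong: measurable_cong del: ambient_form.simps)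
next
  case Hyperbolic
  have "(\<lambda>y. arcosh (- ambient_form Hyperbolic x y)) \<in> borel_measurable borel" by measurable
  then show ?thesis using Hyperbolic by (simp cong: measurable_cong del: ambient_form.simps)
qed

lemma borel_measurable_point_charge_field [measurable]:
  "(\<lambda>y. point_charge_field g \<kappa> y x) \<in> borel_measurable borel"
  unfolding point_charge_field_def direction_to_def by measurable

lemma lborel_distr_uminus_euclidean: "distr lborel borel uminus = (lborel :: 'a::euclidean_space measure)"
  using lborel_affine[of "- 1" "0 :: 'a"] by (simp add: density_1)

context polar_coordinates
begin

text \<open>The integral formula for nonnegative functions, applied to indicators, identifies the
  measures, so that Bochner integrals of vector fields can be transferred too.\<close>

lemma volume_eq_distr:
  obtains C :: real where "C \<ge> 0"
    "volume g = distr (density (lborel \<Otimes>\<^sub>M lborel) (\<lambda>z. ennreal (C * weight (fst z) (snd z)))) borel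
      (\<lambda>z. geodesic g x (dir (fst z)) (gparam g (snd z)))"
proof -
  obtain C where C: "C \<ge> 0" "\<And>F. F \<in> borel_measurable borel \<Longrightarrow> (\<integral>\<^sup>+y. F y \<partial>volume g) =
      ennreal C * (\<integral>\<^sup>+u. \<integral>\<^sup>+q. ennreal (weight u q) * F (geodesic g x (dir u) (gparam g q)) \<partial>lborel \<partial>lborel)"
    using nn_integral_volume_polar by blast
  let ?\<theta> = "\<lambda>z :: (real^'n) \<times> real. geodesic g x (dir (fst z)) (gparam g (snd z))"
  let ?w = "\<lambda>z. ennreal (C * weight (fst z) (snd z))"
  let ?L = "lborel \<Otimes>\<^sub>M lborel :: ((real^'n) \<times> real) measure"
  have [measurable]: "weight u \<in> borel_measurable borel" for u
    unfolding weight_def by measurable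
  have \<theta>m: "?\<theta> \<in> borel_measurable (borel \<Otimes>\<^sub>M borel)" by measurable
  have "volume g = distr (density ?L ?w) borel ?\<theta>"
  proof (rule measure_eqI)
    show "sets (volume g) = sets (distr (density ?L ?w) borel ?\<theta>)"
      by (simp add: sets_volume)
    fix A :: "(real \<times> (real^'n)) set" assume "A \<in> sets (volume g)"
    then have A [measurable]: "A \<in> sets borel" by (simp add: sets_volume)
    have "emeasure (distr (density ?L ?w) borel ?\<theta>) A = (\<integral>\<^sup>+y. indicator A y \<partial>distr (density ?L ?w) borel ?\<theta>)"
      by (simp add: A)
    also have "\<dots> = (\<integral>\<^sup>+z. indicator A (?\<theta> z) \<partial>density ?L ?w)"
      by (rule nn_integral_distr) (simp_all add: \<theta>m cong: measurable_cong_sets)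
    also have "\<dots> = (\<integral>\<^sup>+z. ?w z * indicator A (?\<theta> z) \<partial>?L)"
    proof (rule nn_integral_density)
      show "?w \<in> borel_measurable ?L" by measurable
      show "(\<lambda>z. indicator A (?\<theta> z)) \<in> borel_measurable ?L" by measurable
    qed
    also have "\<dots> = (\<integral>\<^sup>+u. \<integral>\<^sup>+q. ?w (u, q) * indicator A (?\<theta> (u, q)) \<partial>lborel \<partial>lborel)"
      by (rule lborel.nn_integral_fst[symmetric]) measurable
    also have "\<dots> = (\<integral>\<^sup>+u. \<integral>\<^sup>+q. ennreal C * (ennreal (weight u q) *
        indicator A (geodesic g x (dir u) (gparam g q))) \<partial>lborel \<partial>lborel)"
      using C(1) weight_nonneg by (simp add: ennreal_mult mult.assoc)
    also have "\<dots> = (\<integral>\<^sup>+u. ennreal C * (\<integral>\<^sup>+q. ennreal (weight u q) *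
        indicator A (geodesic g x (dir u) (gparam g q)) \<partial>lborel) \<partial>lborel)"
      by (intro nn_integral_cong nn_integral_cmult) measurable
    also have "\<dots> = ennreal C * (\<integral>\<^sup>+u. \<integral>\<^sup>+q. ennreal (weight u q) *
        indicator A (geodesic g x (dir u) (gparam g q)) \<partial>lborel \<partial>lborel)"
      by (rule nn_integral_cmult) measurable
    also have "\<dots> = (\<integral>\<^sup>+y. indicator A y \<partial>volume g)"
      by (rule C(2)[symmetric]) measurable
    also have "\<dots> = emeasure (volume g) A"
      using A by (simp add: sets_volume)
    finally show "emeasure (volume g) A = emeasure (distr (density ?L ?w) borel ?\<theta>) A" by simp
  qed
  then show ?thesis using that C(1) by blast
qed

text \<open>\<open>N\<close> has a positive minimum on the Euclidean unit sphere. The resulting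
  finite measure of this ball enters the integrability of the field.\<close>

lemma unit_ball_bounded: "bounded {u. N u \<le> 1}"
proof -
  have N_cont: "continuous_on A N" for A
    unfolding N_def using T(1)
    by (intro continuous_intros linear_continuous_on) (simp_all add: linear_conv_bounded_linear)
  have "sphere (0 :: real^'n) 1 \<noteq> {}" by simp
  then obtain w where w: "w \<in> sphere 0 1" "\<And>u. u \<in> sphere 0 1 \<Longrightarrow> N w \<le> N u"
    using continuous_attains_inf[OF compact_sphere _ N_cont] by blast
  have "w \<noteq> 0" using w(1) by auto
  then have pos: "N w > 0" by (rule N_pos)
  have "norm u \<le> 1 / N w" if "N u \<le> 1" for u
  proof (cases "u = 0")
    case False
    have "u /\<^sub>R norm u \<in> sphere 0 1" using False by simp
    then have "N w \<le> N (u /\<^sub>R norm u)" by (rule w(2))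
    also have "\<dots> = N u / norm u" by (subst N_scale) (auto simp: field_simps)
    finally have "norm u * N w \<le> N u" using False by (simp add: field_simps)
    then show ?thesis using that pos by (simp add: field_simps)
  qed (use pos in simp)
  then show ?thesis by (auto simp: bounded_iff)
qed

text \<open>On each ray the kernel cancels the factor \<open>gscale g q ^ (CARD('n) - 1)\<close> of
  the density, and the radial integral leaves the charge-weighted widths times \<open>T u\<close>.
  By \<open>balance\<close> this is an odd function of \<open>u\<close>, so its integral vanishes.
  The bound on the widths serves to show that the field exists.\<close>

lemma field_of_balanced_shells:
  fixes Q :: "(real \<times> (real^'n)) set \<Rightarrow> real"
  assumes \<K>: "finite \<K>" "\<And>K. K \<in> \<K> \<Longrightarrow> closed K"
    and I: "\<And>K v. K \<in> \<K> \<Longrightarrow> v \<in> unit_tangents g x \<Longrightarrow>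
      lo K v \<in> shortest_range g \<and> hi K v \<in> shortest_range g \<and> lo K v \<le> hi K v"
    and ray: "\<And>K v t. K \<in> \<K> \<Longrightarrow> v \<in> unit_tangents g x \<Longrightarrow> t \<in> shortest_range g \<Longrightarrow>
      geodesic g x v t \<in> K \<longleftrightarrow> lo K v \<le> t \<and> t \<le> hi K v"
    and bound: "\<And>K. K \<in> \<K> \<Longrightarrow> \<exists>R. \<forall>v\<in>unit_tangents g x. hi K v - lo K v \<le> R"
    and balance: "\<And>v. v \<in> unit_tangents g x \<Longrightarrow>
      (\<Sum>K\<in>\<K>. Q K * (hi K v - lo K v)) = (\<Sum>K\<in>\<K>. Q K * (hi K (- v) - lo K (- v)))"
  shows "has_electrostatic_field g \<kappa> (\<lambda>y. \<Sum>K\<in>\<K>. Q K * indicator K y) x 0"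
proof -
  obtain C where C: "C \<ge> 0" "volume g = distr (density (lborel \<Otimes>\<^sub>M lborel) (\<lambda>z. ennreal (C * weight (fst z) (snd z)))) borel
      (\<lambda>z. geodesic g x (dir (fst z)) (gparam g (snd z)))"
    using volume_eq_distr by blast
  let ?\<theta> = "\<lambda>z :: (real^'n) \<times> real. geodesic g x (dir (fst z)) (gparam g (snd z))"
  let ?L = "lborel \<Otimes>\<^sub>M lborel :: ((real^'n) \<times> real) measure"
  have [measurable]: "K \<in> sets borel" if "K \<in> \<K>" for K using \<K>(2)[OF that] by simp
  define f where "f y = (\<Sum>K\<in>\<K>. Q K * indicator K y) *\<^sub>R point_charge_field g \<kappa> y x" for y
  have fm [measurable]: "f \<in> borel_measurable borel" unfolding f_def by measurable
  have Bm [measurable]: "{u. N u \<le> 1} \<in> sets borel" by measurable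
  \<comment> \<open>What remains of component \<open>K\<close> on the ray: its parameter interval,
    with \<open>dt\<close> expressed as \<open>(gscale g q)\<^sup>2 dq\<close>.\<close>
  define b where "b K u q = indicator (grange g) q * indicator {lo K (dir u)..hi K (dir u)} (gparam g q) * (gscale g q)\<^sup>2" for K u q
  define k where "k u = - \<kappa> * C * indicator {u. N u \<le> 1} u" for u
  define h where "h z = (C * weight (fst z) (snd z)) *\<^sub>R f (?\<theta> z)" for z
  have hm [measurable]: "h \<in> borel_measurable ?L" unfolding h_def by measurable
  have h: "h (u, q) = (k u * (\<Sum>K\<in>\<K>. Q K * b K u q)) *\<^sub>R T u" for u q
  proof (cases "u \<noteq> 0 \<and> q \<in> grange g")
    case True
    then have u: "u \<noteq> 0" and q: "q \<in> grange g" by auto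
    let ?t = "gparam g q" and ?s = "gscale g q" and ?v = "dir u"
    have v: "?v \<in> unit_tangents g x" by (rule dir_unit[OF u])
    have t: "?t \<in> shortest_range g" by (rule gparam(1)[OF q])
    define P where "P = ?s ^ (CARD('n) - 1)"
    have P: "P > 0" using gscale_pos[OF q] by (simp add: P_def)
    have field: "point_charge_field g \<kappa> (geodesic g x ?v ?t) x = - (\<kappa> / P) *\<^sub>R ?v"
      by (simp add: point_charge_field_def gdist_geodesic[OF base v t] direction_to_geodesic[OF base v t] gparam(3)[OF q] P_def)
    have weight: "weight u q = indicator {u. N u \<le> 1} u * N u * (P * ?s\<^sup>2)"
    proof -
      \<comment> \<open>Splits off the power cancelled by the kernel; positivity of the dimension
        makes the truncated subtraction exact.\<close>
      have "CARD('n) + 1 = CARD('n) - 1 + 2" using zero_less_card_finite[where 'a = 'n] by linarith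
      then have "?s ^ (CARD('n) + 1) = P * ?s\<^sup>2" unfolding P_def by (metis power_add)
      then show ?thesis using q by (simp only: weight_def) simp
    qed
    have charge: "(\<Sum>K\<in>\<K>. Q K * indicator K (geodesic g x ?v ?t)) * ?s\<^sup>2 = (\<Sum>K\<in>\<K>. Q K * b K u q)"
      unfolding sum_distrib_right using q ray[OF _ v t]
      by (intro sum.cong) (auto simp: b_def indicator_def)
    have "h (u, q) = (C * (indicator {u. N u \<le> 1} u * N u) * - (\<kappa> * ?s\<^sup>2) *
        (\<Sum>K\<in>\<K>. Q K * indicator K (geodesic g x ?v ?t))) *\<^sub>R ?v"
      using P by (simp add: h_def f_def weight field mult_ac)
    also have "\<dots> = (k u * ((\<Sum>K\<in>\<K>. Q K * indicator K (geodesic g x ?v ?t)) * ?s\<^sup>2)) *\<^sub>R (N u *\<^sub>R ?v)"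
      by (simp add: k_def mult_ac)
    finally show ?thesis
      unfolding T_eq[symmetric] charge .
  next
    case False
    then show ?thesis by (auto simp: h_def weight_def b_def linear_0[OF T(1)])
  qed
  define width where "width K u = hi K (dir u) - lo K (dir u)" for K u
  have b: "has_bochner_integral lborel (b K u) (width K u)" if "K \<in> \<K>" "u \<noteq> 0" for K u
    unfolding b_def width_def using I[OF that(1) dir_unit[OF that(2)]] by (intro has_bochner_integral_gscale) auto
  have inner: "has_bochner_integral lborel (\<lambda>q. h (u, q)) ((k u * (\<Sum>K\<in>\<K>. Q K * width K u)) *\<^sub>R T u)" for u
  proof (cases "u = 0")
    case False
    show ?thesis
      unfolding h
      by (intro has_bochner_integral_scaleR_left has_bochner_integral_mult_right has_bochner_integral_sum b False) auto
  qed (simp add: h linear_0[OF T(1)] has_bochner_integral_zero)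
  obtain R where R: "\<And>K v. K \<in> \<K> \<Longrightarrow> v \<in> unit_tangents g x \<Longrightarrow> hi K v - lo K v \<le> R K"
    using bound by metis
  obtain M where M: "\<And>v. v \<in> unit_tangents g x \<Longrightarrow> norm v \<le> M"
    using compact_imp_bounded[OF compact_unit_tangents[OF base]] unfolding bounded_iff by blast
  \<comment> \<open>A bound independent of \<open>u\<close>: the widths are weighted with absolute
    charges, and \<open>M\<close>, which bounds the Euclidean norm of unit tangent vectors, bounds
    \<open>T u\<close> as long as \<open>N u \<le> 1\<close>.\<close>
  define B where "B = \<bar>\<kappa> * C\<bar> * (\<Sum>K\<in>\<K>. \<bar>Q K\<bar> * R K) * M"
  have norm_bound: "(\<integral>q. norm (h (u, q)) \<partial>lborel) \<le> B * indicator {u. N u \<le> 1} u" for u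
  proof (cases "u = 0 \<or> \<not> N u \<le> 1")
    case True
    then have "h (u, q) = 0" for q by (auto simp: h k_def linear_0[OF T(1)])
    moreover have "B \<ge> 0"
    proof -
      obtain v where v: "v \<in> unit_tangents g x" using unit_tangents_nonempty[OF base] by blast
      have "R K \<ge> 0" if "K \<in> \<K>" for K using R[OF that v] I[OF that v] by linarith
      moreover have "M \<ge> 0" using M[OF v] norm_ge_zero order_trans by blast
      ultimately show ?thesis unfolding B_def by (intro mult_nonneg_nonneg sum_nonneg) auto
    qed
    ultimately show ?thesis by (simp add: indicator_def)
  next
    case False
    then have u: "u \<noteq> 0" "N u \<le> 1" by auto
    note v = dir_unit[OF u(1)]
    let ?B' = "\<lambda>q. \<bar>\<kappa> * C\<bar> * (\<Sum>K\<in>\<K>. \<bar>Q K\<bar> * b K u q) * norm (T u)"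
    have B': "has_bochner_integral lborel ?B' (\<bar>\<kappa> * C\<bar> * (\<Sum>K\<in>\<K>. \<bar>Q K\<bar> * width K u) * norm (T u))"
      by (intro has_bochner_integral_mult_left has_bochner_integral_mult_right has_bochner_integral_sum b u) auto
    have "(\<integral>q. norm (h (u, q)) \<partial>lborel) \<le> integral\<^sup>L lborel ?B'"
    proof (rule integral_mono)
      show "integrable lborel (\<lambda>q. norm (h (u, q)))" using inner[of u] by (auto simp: has_bochner_integral_iff)
      show "integrable lborel ?B'" using B' unfolding has_bochner_integral_iff by blast
      fix q
      have "\<bar>\<Sum>K\<in>\<K>. Q K * b K u q\<bar> \<le> (\<Sum>K\<in>\<K>. \<bar>Q K\<bar> * b K u q)"
      proof -
        have "\<bar>\<Sum>K\<in>\<K>. Q K * b K u q\<bar> \<le> (\<Sum>K\<in>\<K>. \<bar>Q K * b K u q\<bar>)" by (rule sum_abs)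
        also have "\<dots> = (\<Sum>K\<in>\<K>. \<bar>Q K\<bar> * b K u q)"
          by (intro sum.cong) (auto simp: abs_mult b_def)
        finally show ?thesis .
      qed
      then show "norm (h (u, q)) \<le> ?B' q"
        using u(2) by (auto simp: h k_def abs_mult intro!: mult_right_mono mult_left_mono)
    qed
    then have "(\<integral>q. norm (h (u, q)) \<partial>lborel) \<le> \<bar>\<kappa> * C\<bar> * (\<Sum>K\<in>\<K>. \<bar>Q K\<bar> * width K u) * norm (T u)"
      unfolding has_bochner_integral_integral_eq[OF B'] .
    also have "\<dots> \<le> B"
      unfolding B_def
    proof (intro mult_mono sum_mono order_refl)
      show "norm (T u) \<le> M"
      proof -
        have "norm (T u) = N u * norm (dir u)" using N_nonneg[of u] by (subst T_eq) simp
        also have "\<dots> \<le> 1 * norm (dir u)" using u(2) by (intro mult_right_mono) auto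
        finally show ?thesis using M[OF v] by simp
      qed
      show "width K u \<le> R K" if "K \<in> \<K>" for K using R[OF that v] by (simp add: width_def)
      show "0 \<le> width K u" if "K \<in> \<K>" for K using I[OF that v] by (simp add: width_def)
      have "R K \<ge> 0" if "K \<in> \<K>" for K using R[OF that v] I[OF that v] by linarith
      then show "0 \<le> \<bar>\<kappa> * C\<bar> * (\<Sum>K\<in>\<K>. \<bar>Q K\<bar> * R K)" by (intro mult_nonneg_nonneg sum_nonneg) auto
      show "0 \<le> (\<Sum>K\<in>\<K>. \<bar>Q K\<bar> * width K u)" using I[OF _ v] by (intro sum_nonneg mult_nonneg_nonneg) (auto simp: width_def)
    qed auto
    finally show ?thesis using u(2) by simp
  qed
  have int: "integrable ?L h"
  proof (rule lborel_pair.Fubini_integrable[OF hm])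
    show "AE u in lborel. integrable lborel (\<lambda>q. h (u, q))"
      using inner by (auto simp: has_bochner_integral_iff)
    show "integrable lborel (\<lambda>u. \<integral>q. norm (h (u, q)) \<partial>lborel)"
    proof (rule Bochner_Integration.integrable_bound)
      have "emeasure lborel {u. N u \<le> 1} < \<infinity>" by (rule emeasure_bounded_finite[OF unit_ball_bounded])
      then show "integrable lborel (\<lambda>u. B * indicator {u. N u \<le> 1} u)"
        by (intro integrable_mult_right integrable_real_indicator) auto
      show "(\<lambda>u. \<integral>q. norm (h (u, q)) \<partial>lborel) \<in> borel_measurable lborel" by measurable
      show "AE u in lborel. norm (\<integral>q. norm (h (u, q)) \<partial>lborel) \<le> norm (B * indicator {u. N u \<le> 1} u)"
      proof (rule AE_I2)
        fix u
        have "0 \<le> (\<integral>q. norm (h (u, q)) \<partial>lborel)" by (intro integral_nonneg_AE) auto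
        then show "norm (\<integral>q. norm (h (u, q)) \<partial>lborel) \<le> norm (B * indicator {u. N u \<le> 1} u)"
          using norm_bound[of u] by (simp only: real_norm_def)
      qed
    qed
  qed
  define G where "G u = (\<integral>q. h (u, q) \<partial>lborel)" for u
  have Gm [measurable]: "G \<in> borel_measurable lborel" unfolding G_def by measurable
  have G: "G u = (k u * (\<Sum>K\<in>\<K>. Q K * width K u)) *\<^sub>R T u" for u
    unfolding G_def by (rule has_bochner_integral_integral_eq[OF inner])
  have G_odd: "G (- u) = - G u" for u
  proof (cases "u = 0")
    case False
    have "(\<Sum>K\<in>\<K>. Q K * width K (- u)) = (\<Sum>K\<in>\<K>. Q K * width K u)"
      unfolding width_def dir_minus using balance[OF dir_unit[OF False]] by simp
    then show ?thesis by (simp add: G k_def N_minus linear_neg[OF T(1)] indicator_def)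
  qed (simp add: G linear_0[OF T(1)])
  have "(\<integral>u. G u \<partial>lborel) = (\<integral>u. G u \<partial>distr lborel borel uminus)"
    by (simp add: lborel_distr_uminus_euclidean)
  also have "\<dots> = (\<integral>u. G (- u) \<partial>lborel)"
    by (rule integral_distr) (use Gm in auto)
  also have "\<dots> = - (\<integral>u. G u \<partial>lborel)" by (simp add: G_odd)
  finally have "(\<integral>u. G u \<partial>lborel) = 0" by (simp add: eq_neg_iff_add_eq_0 flip: scaleR_2)
  moreover have "(\<integral>u. G u \<partial>lborel) = integral\<^sup>L ?L h"
    unfolding G_def by (rule lborel_pair.integral_fst'[OF int])
  ultimately have "has_bochner_integral ?L h 0" using int by (simp add: has_bochner_integral_iff)
  then have "has_bochner_integral (density ?L (\<lambda>z. ennreal (C * weight (fst z) (snd z)))) (\<lambda>z. f (?\<theta> z)) 0"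
    unfolding h_def using C(1) weight_nonneg by (intro has_bochner_integral_density) auto
  then have "has_bochner_integral (volume g) f 0"
    unfolding C(2) by (intro has_bochner_integral_distr) auto
  then show ?thesis by (simp add: has_electrostatic_field_def f_def[abs_def])
qed

end

section \<open>The charge density as a combination of shell components\<close>

theorem theorem15:
  fixes g :: geometry
    and p :: "real \<times> (real^'n) \<Rightarrow> real"
    and d :: nat
    and e1 e2 \<rho> \<kappa> :: real
    and x\<^sub>0 x :: "real \<times> (real^'n)"
  assumes "CARD('n) \<ge> 2"
    and "d \<ge> 2"
    and "homogeneous_polynomial d p"
    and "hyperbolic_surface g d p"
    and "standard_layer g d p e1 e2"
    and "\<rho> > 0"
    and "x\<^sub>0 \<in> layer_hyperbolicity_domain g d p e1 e2"
    and "x \<in> layer_hyperbolicity_domain g d p e1 e2"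
  shows "has_electrostatic_field g \<kappa> (charge_density g p e1 e2 \<rho> x\<^sub>0) x 0"
proof -
  have "d > 0" using assms(2) by simp
  \<comment> \<open>Hyperbolicity of the zero surface enters here, through the parity of the
    degree.\<close>
  interpret layer_at g p d e1 e2 x
    using assms even_degree_of_hyperbolic_surface[OF assms(1) \<open>d > 0\<close> assms(3)]
    by unfold_locales auto
  obtain T :: "real^'n \<Rightarrow> real \<times> (real^'n)" where
    "linear T" "inj T" "range T = {v. ambient_form g x v = 0}"
    by (rule tangent_parametrization[OF x_model])
  then interpret polar_coordinates g x T by (rule polar_coordinates.intro[OF x_model])
  let ?S = "shell g p e1 e2"
  let ?Q = "\<lambda>K. if positively_charged g p e1 e2 x\<^sub>0 K then \<rho> else - \<rho>"
  have "has_electrostatic_field g \<kappa> (\<lambda>y. \<Sum>K\<in>shells. ?Q K * indicator K y) x 0"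
  proof (rule field_of_balanced_shells)
    show "finite (shells)" by (rule finite_shell_components)
    show "closed K" if "K \<in> shells" for K using closed_shell_component that .
  next
    fix K v assume K: "K \<in> shells" and v: "v \<in> U"
    show "min (cross e1 K v) (cross e2 K v) \<in> shortest_range g \<and>
      max (cross e1 K v) (cross e2 K v) \<in> shortest_range g \<and>
      min (cross e1 K v) (cross e2 K v) \<le> max (cross e1 K v) (cross e2 K v)"
      using cross(2)[OF _ K v] by (auto simp: min_def max_def)
    show "ray v t \<in> K \<longleftrightarrow> min (cross e1 K v) (cross e2 K v) \<le> t \<and> t \<le> max (cross e1 K v) (cross e2 K v)"
      if "t \<in> shortest_range g" for t
      by (rule shell_component_inside[OF K v that])
  next
    fix K assume K: "K \<in> shells"
    have "continuous_on U (\<lambda>v. max (cross e1 K v) (cross e2 K v) - min (cross e1 K v) (cross e2 K v))"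
      by (intro continuous_intros cross(1)[OF _ K]) auto
    then have "bounded ((\<lambda>v. max (cross e1 K v) (cross e2 K v) - min (cross e1 K v) (cross e2 K v)) ` U)"
      by (intro compact_imp_bounded compact_continuous_image compact_U)
    then show "\<exists>R. \<forall>v\<in>U. max (cross e1 K v) (cross e2 K v) - min (cross e1 K v) (cross e2 K v) \<le> R"
      unfolding bounded_real by (meson abs_le_D1 image_eqI)
  next
    fix v assume v: "v \<in> U"
    have "max a b - min a b = \<bar>b - a\<bar>" for a b :: real by (simp add: max_def min_def)
    then show "(\<Sum>K\<in>shells. ?Q K * (max (cross e1 K v) (cross e2 K v) - min (cross e1 K v) (cross e2 K v))) =
      (\<Sum>K\<in>shells. ?Q K * (max (cross e1 K (- v)) (cross e2 K (- v)) - min (cross e1 K (- v)) (cross e2 K (- v))))"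
      using signed_widths_balance[OF assms(7) v, of \<rho>] by simp
  qed
  \<comment> \<open>The components of the shell are disjoint, so at each point at most one indicator
    is nonzero, that of the component containing it.\<close>
  moreover have "(\<Sum>K\<in>shells. ?Q K * indicator K y) = charge_density g p e1 e2 \<rho> x\<^sub>0 y" for y
  proof (cases "y \<in> ?S")
    case True
    let ?Y = "connected_component_set ?S y"
    have Y: "?Y \<in> shells" "y \<in> ?Y" using True by (auto simp: components_def)
    have "indicator K y = (if K = ?Y then 1 else 0 :: real)" if "K \<in> shells" for K
      using components_eq[OF that Y(1)] Y(2) by (auto simp: indicator_def)
    then have "(\<Sum>K\<in>shells. ?Q K * indicator K y) = (\<Sum>K\<in>shells. if K = ?Y then ?Q K else 0)"
      by (intro sum.cong) auto
    also have "\<dots> = ?Q ?Y" using Y(1) finite_shell_components by simp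
    finally show ?thesis using True by (simp add: charge_density_def)
  next
    case False
    then have "indicator K y = (0 :: real)" if "K \<in> shells" for K
      using in_components_subset[OF that] by (auto simp: indicator_def)
    then show ?thesis using False by (simp add: charge_density_def)
  qed
  ultimately show ?thesis by simp
qed

end
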